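(* Let $\alpha,\beta,\gamma\in\mathbb{C}$ be not all zero and let $x_{\alpha\beta\gamma}=\alpha e+\beta fk+\gamma(k-1)\in\mathcal{U}$. If the right action $R_{x_{\alpha\beta\gamma}}$ (or the left action $L_{x_{\alpha\beta\gamma}}$) on $\mathcal{A}$ has nontrivial invariants for all $\ell\in\frac12\mathbb{Z}_+$ (i.e. for every $\ell\in\frac12\mathbb{Z}_+$ there is a nonzero $u\in M_\ell\oplus M_\ell\sigma$ with $R_{x_{\alpha\beta\gamma}}(u)=0$, respectively $L_{x_{\alpha\beta\gamma}}(u)=0$), then $x_{\alpha\beta\gamma}$ is a scalar multiple of $e$ or of $fk$. Moreover, the right invariants in $\mathcal{A}$ of the coideal $\mathbb{C}e$ are exactly the linear combinations of the elements $m^{(\ell)}_{\ell j}\sigma^s$ ($\ell\in\frac12\mathbb{Z}_+$, $j\in I_\ell$, $s=0,1$), and the right invariants in $\mathcal{A}$ of the coideal $\mathbb{C}fk$ are exactly the linear combinations of the elements $m^{(\ell)}_{-\ell\, j}\sigma^s$ ($\ell\in\frac12\mathbb{Z}_+$, $j\in I_\ell$, $s=0,1$).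
   Context: Let $0\ne q\in\mathbb{C}$ be not a root of $1$, $\mathbf{i}=\sqrt{-1}$, $t=\mathbf{i}\sqrt q$ (fixed square root). The algebra $\mathcal{U}=U_q(osp(1,2))$: the $\mathbb{Z}_2$-graded $\mathbb{C}$-algebra generated by $k^{\pm1},e,f$ with $kk^{-1}=k^{-1}k=1$, $kek^{-1}=qe$, $kfk^{-1}=q^{-1}f$, $ef+fe=\frac{k-k^{-1}}{q-q^{-1}}$, parity $p(k^{\pm1})=0$, $p(e)=p(f)=1$; $\mathbb{Z}_2$-graded Hopf structure $\Delta(k^{\pm1})=k^{\pm1}\otimes k^{\pm1}$, $\Delta(e)=e\otimes1+k\otimes e$, $\Delta(f)=f\otimes k^{-1}+1\otimes f$, $S(k^{\pm1})=k^{\mp1}$, $S(e)=-k^{-1}e$, $S(f)=-fk$, $\varepsilon(k^{\pm1})=1$, $\varepsilon(e)=\varepsilon(f)=0$. The algebra $\mathcal{A}=\mathbb{C}_q[osp(1,2)]$: the $\mathbb{Z}_2$-graded $\mathbb{C}$-algebra generated by $a,b,c,d,\sigma$ with relations $ab=tba$, $ac=tca$, $bc=-cb$, $bd=-tdb$, $cd=-tdc$, $ad-da=(t^{-1}-t)bc$, $ad+tbc=\sigma$, $\sigma^2=1$, parity $p(a)=p(d)=p(\sigma)=0$, $p(b)=p(c)=1$; $\Delta(a)=a\otimes a+b\otimes c$, $\Delta(b)=a\otimes b+b\otimes d$, $\Delta(c)=c\otimes a+d\otimes c$, $\Delta(d)=c\otimes b+d\otimes d$, $\Delta(\sigma)=\sigma\otimes\sigma$;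 $\varepsilon(a)=\varepsilon(d)=\varepsilon(\sigma)=1$, $\varepsilon(b)=\varepsilon(c)=0$. Coproducts are multiplicative for the graded tensor product $(x\otimes y)(z\otimes w)=(-1)^{p(y)p(z)}xz\otimes yw$. Dual pairing $u(x)=x(u)$ ($u\in\mathcal{U}$, $x\in\mathcal{A}$): $k^{\pm1}$ are algebra homomorphisms $\mathcal{A}\to\mathbb{C}$ with $k^{\pm1}(a)=t^{\pm1}$, $k^{\pm1}(d)=-t^{\mp1}$, $k^{\pm1}(\sigma)=-1$, $k^{\pm1}(b)=k^{\pm1}(c)=0$; $e(b)=\frac{t-t^{-1}}{q-q^{-1}}$ and $e$ vanishes on $1,a,c,d,\sigma$; $f(c)=1$ and $f$ vanishes on $1,a,b,d,\sigma$; $e(xy)=e(x)\varepsilon(y)+(-1)^{p(x)}k(x)e(y)$, $f(xy)=f(x)k^{-1}(y)+(-1)^{p(x)}\varepsilon(x)f(y)$; and products in $\mathcal{U}$ are dual to the coproduct of $\mathcal{A}$. Actions of $\mathcal{U}$ on $\mathcal{A}$: for homogeneous $x$, with $\Delta(u)=\sum u_1\otimes u_2$, $L_x(u)=\sum(-1)^{p(x)p(u_1)}x(u_2)u_1$ and $R_x(u)=\sum x(u_1)u_2$, extended linearly in $x$. One has $R_{xy}=(-1)^{p(x)p(y)}R_yR_x$ and $L_{xy}=L_xL_y$. The right (left) invariants of a coideal $J\subset\mathcal{U}$ are the $u\in\mathcal{A}$ with $R_x(u)=\varepsilon(x)u$ (resp. $L_x(u)=\varepsilon(x)u$) for all $x\in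 J$; note $\varepsilon(x_{\alpha\beta\gamma})=0$. For $\ell\in\frac12\mathbb{Z}_+$ (with $\mathbb{Z}_+=\{0,1,2,\dots\}$) let $I_\ell=\{-\ell,-\ell+1,\dots,\ell\}$ and, for $i\in I_\ell$, $\xi^{(\ell)}_i=\mathbf{i}^{[\frac{\ell+i}2]}\binom{2\ell}{\ell+i}^{1/2}_{t^{-2}}a^{\ell-i}c^{\ell+i}$, where $[\cdot]$ is the integer part, $\binom mn_v=\frac{(v;v)_m}{(v;v)_n(v;v)_{m-n}}$, $(u;v)_m=\prod_{r=0}^{m-1}(1-uv^r)$, with square roots fixed. The span of the $\xi^{(\ell)}_i\sigma^s$ ($i\in I_\ell$) is an irreducible left $\mathcal{A}$-subcomodule, and the matrix elements $m^{(\ell)}_{ij}\in\mathcal{A}$ ($i,j\in I_\ell$) are defined by $\Delta(\xi^{(\ell)}_i\sigma^s)=\sum_{j\in I_\ell}m^{(\ell)}_{ij}\sigma^s\otimes\xi^{(\ell)}_j\sigma^s$ ($s=0,1$). Put $M_\ell\sigma^s=\sum_{i,j\in I_\ell}\mathbb{C}m^{(\ell)}_{ij}\sigma^s$. It is known that $\mathcal{A}=\bigoplus_{\ell\in\frac12\mathbb{Z}_+}(M_\ell\oplus M_\ell\sigma)$. *)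

theory Defs
  imports Complex_Main "HOL-Library.Poly_Mapping" "HOL-Algebra.QuotRing"
begin

section \<open>Presented algebras\<close>

text \<open>Words form the free monoid, written additively because \<^typ>\<open>'k \<Rightarrow>\<^sub>0 'v\<close> takes its convolution
  product from an additive structure on the keys. The complex free algebra is the monoid algebra
  of the free monoid.\<close>

instantiation list :: (type) monoid_add
begin
definition zero_list :: "'a list" where "zero_list = []"
definition plus_list :: "'a list \<Rightarrow> 'a list \<Rightarrow> 'a list" where "plus_list = (@)"
instance by standard (simp_all add: zero_list_def plus_list_def)
end

type_synonym 'g free_alg = "'g list \<Rightarrow>\<^sub>0 complex"

definition gen :: "'g \<Rightarrow> 'g free_alg" where
  "gen g = Poly_Mapping.single [g] 1"

definition const :: "complex \<Rightarrow> 'g free_alg" where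
  "const z = Poly_Mapping.single [] z"

definition free_ring :: "'g free_alg ring" where
  "free_ring = \<lparr>carrier = UNIV, mult = (*), one = 1, zero = 0, add = (+)\<rparr>"

text \<open>Algebra elements are cosets of the two-sided ideal generated by \<open>rels\<close>; the ideal is a
  complex subspace because the free algebra contains the scalars.\<close>

definition presented :: "'g free_alg set \<Rightarrow> 'g free_alg set ring" where
  "presented rels = free_ring Quot (Idl\<^bsub>free_ring\<^esub> rels)"

definition cls :: "'g free_alg set \<Rightarrow> 'g free_alg \<Rightarrow> 'g free_alg set" where
  "cls rels x = (Idl\<^bsub>free_ring\<^esub> rels) +>\<^bsub>free_ring\<^esub> x"

definition scal :: "'g free_alg set \<Rightarrow> complex \<Rightarrow> 'g free_alg set \<Rightarrow> 'g free_alg set" where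
  "scal rels z X = cls rels (const z) \<otimes>\<^bsub>presented rels\<^esub> X"

definition lincombs :: "'g free_alg set \<Rightarrow> 'g free_alg set set \<Rightarrow> 'g free_alg set set" where
  "lincombs rels S =
     {(\<Oplus>\<^bsub>presented rels\<^esub>x\<in>T. scal rels (z x) x) | T z. finite T \<and> T \<subseteq> S}"

definition word_parity :: "('g \<Rightarrow> nat) \<Rightarrow> 'g list \<Rightarrow> nat" where
  "word_parity p w = sum_list (map p w)"

section \<open>The algebra U\<close>

datatype ugen = UK | UKinv | UE | UF

primrec upar :: "ugen \<Rightarrow> nat" where
  "upar UK = 0" | "upar UKinv = 0" | "upar UE = 1" | "upar UF = 1"

definition urels :: "complex \<Rightarrow> ugen free_alg set" where
  "urels q =
     {gen UK * gen UKinv - 1,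
      gen UKinv * gen UK - 1,
      gen UK * gen UE * gen UKinv - const q * gen UE,
      gen UK * gen UF * gen UKinv - const (inverse q) * gen UF,
      gen UE * gen UF + gen UF * gen UE
        - const (1 / (q - inverse q)) * (gen UK - gen UKinv)}"

abbreviation U :: "complex \<Rightarrow> ugen free_alg set ring" where
  "U q \<equiv> presented (urels q)"

primrec ucounit_gen :: "ugen \<Rightarrow> complex" where
  "ucounit_gen UK = 1" | "ucounit_gen UKinv = 1" | "ucounit_gen UE = 0" | "ucounit_gen UF = 0"

text \<open>Here and below a map on a presented algebra is induced by one on representatives:
  \<^const>\<open>the_elem\<close> picks the single value taken on the coset.\<close>

definition ucounit :: "ugen free_alg set \<Rightarrow> complex" where
  "ucounit X = the_elem
     ((\<lambda>x. \<Sum>w\<in>Poly_Mapping.keys x.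
          Poly_Mapping.lookup x w * prod_list (map ucounit_gen w)) ` X)"

definition u_e :: "complex \<Rightarrow> ugen free_alg set" where
  "u_e q = cls (urels q) (gen UE)"

definition u_fk :: "complex \<Rightarrow> ugen free_alg set" where
  "u_fk q = cls (urels q) (gen UF * gen UK)"

definition u_x :: "complex \<Rightarrow> complex \<Rightarrow> complex \<Rightarrow> complex \<Rightarrow> ugen free_alg set" where
  "u_x q \<alpha> \<beta> \<gamma> = cls (urels q)
     (const \<alpha> * gen UE + const \<beta> * gen UF * gen UK + const \<gamma> * (gen UK - 1))"

section \<open>The algebra A and its coproduct\<close>

datatype agen = Aa | Ab | Ac | Ad | Asigma

primrec apar :: "agen \<Rightarrow> nat" where
  "apar Aa = 0" | "apar Ab = 1" | "apar Ac = 1" | "apar Ad = 0" | "apar Asigma = 0"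

definition arels :: "complex \<Rightarrow> agen free_alg set" where
  "arels t =
     {gen Aa * gen Ab - const t * gen Ab * gen Aa,
      gen Aa * gen Ac - const t * gen Ac * gen Aa,
      gen Ab * gen Ac + gen Ac * gen Ab,
      gen Ab * gen Ad + const t * gen Ad * gen Ab,
      gen Ac * gen Ad + const t * gen Ad * gen Ac,
      gen Aa * gen Ad - gen Ad * gen Aa - const (inverse t - t) * gen Ab * gen Ac,
      gen Aa * gen Ad + const t * gen Ab * gen Ac - gen Asigma,
      gen Asigma * gen Asigma - 1}"

abbreviation A :: "complex \<Rightarrow> agen free_alg set ring" where
  "A t \<equiv> presented (arels t)"

definition sigma :: "complex \<Rightarrow> agen free_alg set" where
  "sigma t = cls (arels t) (gen Asigma)"

text \<open>The tensor square of the free algebra has the pairs of words as basis.\<close>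

type_synonym free_tens = "agen list \<times> agen list \<Rightarrow>\<^sub>0 complex"

definition tens :: "agen free_alg \<Rightarrow> agen free_alg \<Rightarrow> free_tens" where
  "tens x y = (\<Sum>u\<in>Poly_Mapping.keys x. \<Sum>v\<in>Poly_Mapping.keys y.
     Poly_Mapping.single (u, v) (Poly_Mapping.lookup x u * Poly_Mapping.lookup y v))"

definition tens_mult :: "free_tens \<Rightarrow> free_tens \<Rightarrow> free_tens" where
  "tens_mult D D' = (\<Sum>(x, y)\<in>Poly_Mapping.keys D. \<Sum>(z, w)\<in>Poly_Mapping.keys D'.
     Poly_Mapping.single (x @ z, y @ w)
       ((-1) ^ (word_parity apar y * word_parity apar z)
         * Poly_Mapping.lookup D (x, y) * Poly_Mapping.lookup D' (z, w)))"

definition free_tens_ring :: "free_tens ring" where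
  "free_tens_ring = \<lparr>carrier = UNIV, mult = tens_mult,
     one = Poly_Mapping.single ([], []) 1, zero = 0, add = (+)\<rparr>"

text \<open>With \<open>A = F / I\<close>, the tensor square of \<open>A\<close> is the quotient of \<open>F \<otimes> F\<close> by
  \<open>I \<otimes> F + F \<otimes> I\<close>.\<close>

definition tens_ker :: "complex \<Rightarrow> free_tens set" where
  "tens_ker t = (let I = Idl\<^bsub>free_ring\<^esub> (arels t) in
     {(\<Sum>(x, y)\<in>S. tens x y) | S. finite S \<and> S \<subseteq> I \<times> UNIV \<union> UNIV \<times> I})"

definition AA :: "complex \<Rightarrow> free_tens set ring" where
  "AA t = free_tens_ring Quot (tens_ker t)"

definition tens_cls :: "complex \<Rightarrow> free_tens \<Rightarrow> free_tens set" where
  "tens_cls t D = tens_ker t +>\<^bsub>free_tens_ring\<^esub> D"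

definition A_tens :: "complex \<Rightarrow> agen free_alg set \<Rightarrow> agen free_alg set \<Rightarrow> free_tens set" where
  "A_tens t X Y = the_elem ((\<lambda>(x, y). tens_cls t (tens x y)) ` (X \<times> Y))"

primrec coprod_gen :: "agen \<Rightarrow> free_tens" where
  "coprod_gen Aa = tens (gen Aa) (gen Aa) + tens (gen Ab) (gen Ac)"
| "coprod_gen Ab = tens (gen Aa) (gen Ab) + tens (gen Ab) (gen Ad)"
| "coprod_gen Ac = tens (gen Ac) (gen Aa) + tens (gen Ad) (gen Ac)"
| "coprod_gen Ad = tens (gen Ac) (gen Ab) + tens (gen Ad) (gen Ad)"
| "coprod_gen Asigma = tens (gen Asigma) (gen Asigma)"

primrec coprod_word :: "agen list \<Rightarrow> free_tens" where
  "coprod_word [] = Poly_Mapping.single ([], []) 1"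
| "coprod_word (g # w) = tens_mult (coprod_gen g) (coprod_word w)"

definition coprod_free :: "agen free_alg \<Rightarrow> free_tens" where
  "coprod_free u = (\<Sum>w\<in>Poly_Mapping.keys u.
     Poly_Mapping.map ((*) (Poly_Mapping.lookup u w)) (coprod_word w))"

definition coprod :: "complex \<Rightarrow> agen free_alg set \<Rightarrow> free_tens set" where
  "coprod t X = the_elem ((\<lambda>u. tens_cls t (coprod_free u)) ` X)"

section \<open>The dual pairing and the two actions\<close>

primrec eps_gen :: "agen \<Rightarrow> complex" where
  "eps_gen Aa = 1" | "eps_gen Ab = 0" | "eps_gen Ac = 0" | "eps_gen Ad = 1" | "eps_gen Asigma = 1"

primrec k_gen :: "complex \<Rightarrow> agen \<Rightarrow> complex" where
  "k_gen t Aa = t" | "k_gen t Ab = 0" | "k_gen t Ac = 0" | "k_gen t Ad = - inverse t"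
| "k_gen t Asigma = -1"

primrec kinv_gen :: "complex \<Rightarrow> agen \<Rightarrow> complex" where
  "kinv_gen t Aa = inverse t" | "kinv_gen t Ab = 0" | "kinv_gen t Ac = 0" | "kinv_gen t Ad = - t"
| "kinv_gen t Asigma = -1"

definition e_gen :: "complex \<Rightarrow> complex \<Rightarrow> agen \<Rightarrow> complex" where
  "e_gen q t g = (if g = Ab then (t - inverse t) / (q - inverse q) else 0)"

definition f_gen :: "agen \<Rightarrow> complex" where
  "f_gen g = (if g = Ac then 1 else 0)"

definition eps_word :: "agen list \<Rightarrow> complex" where
  "eps_word w = prod_list (map eps_gen w)"

definition k_word :: "complex \<Rightarrow> agen list \<Rightarrow> complex" where
  "k_word t w = prod_list (map (k_gen t) w)"

definition kinv_word :: "complex \<Rightarrow> agen list \<Rightarrow> complex" where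
  "kinv_word t w = prod_list (map (kinv_gen t) w)"

text \<open>The twisted Leibniz rules for \<open>e(xy)\<close> and \<open>f(xy)\<close>, with \<open>x\<close> a generator.\<close>

primrec e_word :: "complex \<Rightarrow> complex \<Rightarrow> agen list \<Rightarrow> complex" where
  "e_word q t [] = 0"
| "e_word q t (g # w) = e_gen q t g * eps_word w + (-1) ^ apar g * k_gen t g * e_word q t w"

primrec f_word :: "complex \<Rightarrow> agen list \<Rightarrow> complex" where
  "f_word t [] = 0"
| "f_word t (g # w) = f_gen g * kinv_word t w + (-1) ^ apar g * eps_gen g * f_word t w"

primrec pair_gen :: "complex \<Rightarrow> complex \<Rightarrow> ugen \<Rightarrow> agen list \<Rightarrow> complex" where
  "pair_gen q t UK = k_word t"
| "pair_gen q t UKinv = kinv_word t"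
| "pair_gen q t UE = e_word q t"
| "pair_gen q t UF = f_word t"

text \<open>A product in \<open>U\<close> pairs by \<open>(xy)(u) = \<Sum> x(u\<^sub>1) y(u\<^sub>2)\<close>. An extra sign for odd \<open>x\<close> and \<open>y\<close> would
  be incompatible with the relation for \<open>ef + fe\<close>: evaluate both sides at \<open>a\<close>.\<close>

primrec pair_word :: "complex \<Rightarrow> complex \<Rightarrow> ugen list \<Rightarrow> agen list \<Rightarrow> complex" where
  "pair_word q t [] v = eps_word v"
| "pair_word q t (x # xs) v = (\<Sum>(v1, v2)\<in>Poly_Mapping.keys (coprod_word v).
     Poly_Mapping.lookup (coprod_word v) (v1, v2) * pair_gen q t x v1 * pair_word q t xs v2)"

definition R_free :: "complex \<Rightarrow> complex \<Rightarrow> ugen free_alg \<Rightarrow> agen free_alg \<Rightarrow> agen free_alg" where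
  "R_free q t x u = (\<Sum>w\<in>Poly_Mapping.keys x. \<Sum>(v1, v2)\<in>Poly_Mapping.keys (coprod_free u).
     Poly_Mapping.single v2
       (Poly_Mapping.lookup x w * Poly_Mapping.lookup (coprod_free u) (v1, v2)
         * pair_word q t w v1))"

definition L_free :: "complex \<Rightarrow> complex \<Rightarrow> ugen free_alg \<Rightarrow> agen free_alg \<Rightarrow> agen free_alg" where
  "L_free q t x u = (\<Sum>w\<in>Poly_Mapping.keys x. \<Sum>(v1, v2)\<in>Poly_Mapping.keys (coprod_free u).
     Poly_Mapping.single v1
       ((-1) ^ (word_parity upar w * word_parity apar v1)
         * Poly_Mapping.lookup x w * Poly_Mapping.lookup (coprod_free u) (v1, v2)
         * pair_word q t w v2))"

definition R_act ::
  "complex \<Rightarrow> complex \<Rightarrow> ugen free_alg set \<Rightarrow> agen free_alg set \<Rightarrow> agen free_alg set" where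
  "R_act q t X Y = the_elem ((\<lambda>(x, u). cls (arels t) (R_free q t x u)) ` (X \<times> Y))"

definition L_act ::
  "complex \<Rightarrow> complex \<Rightarrow> ugen free_alg set \<Rightarrow> agen free_alg set \<Rightarrow> agen free_alg set" where
  "L_act q t X Y = the_elem ((\<lambda>(x, u). cls (arels t) (L_free q t x u)) ` (X \<times> Y))"

definition right_invariants ::
  "complex \<Rightarrow> complex \<Rightarrow> ugen free_alg set set \<Rightarrow> agen free_alg set set" where
  "right_invariants q t J =
     {u \<in> carrier (A t). \<forall>x\<in>J. R_act q t x u = scal (arels t) (ucounit x) u}"

definition uline :: "complex \<Rightarrow> ugen free_alg set \<Rightarrow> ugen free_alg set set" where
  "uline q x = {scal (urels q) z x | z. True}"

section \<open>Matrix elements\<close>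

definition half_nats :: "rat set" where
  "half_nats = {of_nat n / 2 | n. True}"

definition idx :: "rat \<Rightarrow> rat set" where
  "idx l = {i. \<exists>r::nat. i = - l + of_nat r \<and> i \<le> l}"

definition qpoch :: "complex \<Rightarrow> complex \<Rightarrow> nat \<Rightarrow> complex" where
  "qpoch u v m = (\<Prod>r<m. 1 - u * v ^ r)"

definition qbinom :: "complex \<Rightarrow> nat \<Rightarrow> nat \<Rightarrow> complex" where
  "qbinom v m n = qpoch v v m / (qpoch v v n * qpoch v v (m - n))"

text \<open>\<open>rt m n\<close> is the chosen square root of the \<open>t\<^sup>-\<^sup>2\<close>-binomial coefficient. The arguments of
  \<^const>\<open>nat\<close> are nonnegative and, apart from \<open>(l + i) / 2\<close>, integral for \<open>l\<close> in \<^const>\<open>half_nats\<close> and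
  \<open>i\<close> in \<^term>\<open>idx l\<close>.\<close>

definition xi :: "complex \<Rightarrow> (nat \<Rightarrow> nat \<Rightarrow> complex) \<Rightarrow> rat \<Rightarrow> rat \<Rightarrow> agen free_alg set" where
  "xi t rt l i = cls (arels t)
     (const (\<i> ^ nat \<lfloor>(l + i) / 2\<rfloor> * rt (nat \<lfloor>2 * l\<rfloor>) (nat \<lfloor>l + i\<rfloor>))
       * gen Aa ^ nat \<lfloor>l - i\<rfloor> * gen Ac ^ nat \<lfloor>l + i\<rfloor>)"

definition is_matrix_elements ::
  "complex \<Rightarrow> (nat \<Rightarrow> nat \<Rightarrow> complex) \<Rightarrow> rat \<Rightarrow> (rat \<Rightarrow> rat \<Rightarrow> agen free_alg set) \<Rightarrow> bool" where
  "is_matrix_elements t rt l m \<longleftrightarrow>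
     (\<forall>i\<in>idx l. \<forall>j\<in>idx l. m i j \<in> carrier (A t)) \<and>
     (\<forall>i\<in>idx l. \<forall>s\<in>{0, 1::nat}.
        coprod t (xi t rt l i \<otimes>\<^bsub>A t\<^esub> sigma t [^]\<^bsub>A t\<^esub> s) =
        (\<Oplus>\<^bsub>AA t\<^esub>j\<in>idx l. A_tens t (m i j \<otimes>\<^bsub>A t\<^esub> sigma t [^]\<^bsub>A t\<^esub> s)
                                (xi t rt l j \<otimes>\<^bsub>A t\<^esub> sigma t [^]\<^bsub>A t\<^esub> s)))"

text \<open>The entries with indices in \<^term>\<open>idx l\<close> are determined by linear independence of the \<open>\<xi>\<^sub>j\<close>;
  all others are irrelevant.\<close>

definition mat_elt ::
  "complex \<Rightarrow> (nat \<Rightarrow> nat \<Rightarrow> complex) \<Rightarrow> rat \<Rightarrow> rat \<Rightarrow> rat \<Rightarrow> agen free_alg set" where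
  "mat_elt t rt l = (SOME m. is_matrix_elements t rt l m)"

definition Msp :: "complex \<Rightarrow> (nat \<Rightarrow> nat \<Rightarrow> complex) \<Rightarrow> rat \<Rightarrow> nat \<Rightarrow> agen free_alg set set" where
  "Msp t rt l s = lincombs (arels t)
     {mat_elt t rt l i j \<otimes>\<^bsub>A t\<^esub> sigma t [^]\<^bsub>A t\<^esub> s | i j. i \<in> idx l \<and> j \<in> idx l}"

end

theory Submission
  imports Defs
begin

text \<open>Both actions of \<open>x = \<alpha> e + \<beta> f k + \<gamma> (k - 1)\<close> are a twisted derivation plus \<open>\<gamma>\<close> times a diagonal
  automorphism minus the identity, already on the free algebra. The words \<open>a\<^sup>i b\<^sup>j c\<^sup>k \<sigma>\<^sup>s\<close> and
  \<open>d\<^sup>l b\<^sup>j c\<^sup>k \<sigma>\<^sup>s\<close> form a basis of \<open>A\<close>: let the generators act on formal combinations of them, and check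
  the relations. A leading term argument in the exponent of \<open>b\<close> then shows that \<open>e\<close> kills
  exactly the span of the \<open>d\<^sup>l c\<^sup>k \<sigma>\<^sup>s\<close>, which up to nonzero scalars are the matrix elements of the row \<open>\<ell>\<close>; the
  isomorphism \<open>a \<leftrightarrow> d, b \<leftrightarrow> c, t \<leftrightarrow> - 1 / t\<close> carries this over to \<open>f k\<close>. For the first
  claim, the action of \<open>x\<close> on the columns of the matrix elements of spin 1/2 (if exactly one of
  \<open>\<gamma>\<close> and \<open>\<alpha> \<beta>\<close> vanishes) or of spin 1 (if neither does) is given by a matrix of nonzero determinant. The left
  action is conjugate to the right action of another such element.\<close>

text \<open>Why two spins are needed: let l = \<alpha> e(b) and m = \<beta> t be the values at b and
  c of the odd part of x. On a column of spin 1/2 the determinant is -\<gamma>^2 (t^2 - 1) / t - l m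
  without \<sigma> and \<gamma>^2 (t^2 - 1) / t - l m with it, so it may vanish when \<gamma> and l
  m are both nonzero. On a column of spin 1 the two determinants are nonzero multiples of \<gamma>^3
  and of \<gamma> l m, which covers exactly that case. All columns with the same power of \<sigma>
  share a characteristic polynomial, so two polynomials with nonzero constant term dispose of the
  whole span.

  The maps of the statement are read off from cosets by \<open>the_elem\<close>, so each must be
  shown constant on cosets before it can be evaluated. Hence operators are computed on words, and
  stability of the ideal is shown separately. The basis makes membership in the ideal the vanishing
  of a normal form, so that checks on the relations are finite computations.

  The extreme rows come from expanding the coproducts of a^N and c^N by the quantum binomial
  theorem; the Gaussian coefficients in t^-2 are nonzero because t^2 = -q is not a root of
  unity.\<close>

abbreviation "lookup \<equiv> Poly_Mapping.lookup"
abbreviation "single \<equiv> Poly_Mapping.single"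
abbreviation "keys \<equiv> Poly_Mapping.keys"

section \<open>Complex vector spaces and linear extension\<close>

text \<open>A single class covers free algebras, tensor squares, formal combinations of keys and the
  scalars, so that one notion of linearity serves for all of them.\<close>

class cvec = ab_group_add +
  fixes cs :: "complex \<Rightarrow> 'a \<Rightarrow> 'a" (infixr "\<cdot>" 75)
  assumes cs_add: "z \<cdot> (x + y) = z \<cdot> x + z \<cdot> y"
    and cs_add2: "(z + w) \<cdot> x = z \<cdot> x + w \<cdot> x"
    and cs_cs: "z \<cdot> (w \<cdot> x) = (z * w) \<cdot> x"
    and cs_one [simp]: "1 \<cdot> x = x"
begin

lemma cs_zero [simp]: "z \<cdot> 0 = 0"
  using cs_add[of z 0 0] by simp

lemma cs_zero_left [simp]: "0 \<cdot> x = 0"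
  using cs_add2[of 0 0 x] by simp

lemma cs_minus: "z \<cdot> (- x) = - (z \<cdot> x)"
  using cs_add[of z x "- x"] by (simp add: eq_neg_iff_add_eq_0 add.commute)

lemma cs_minus_left: "(- z) \<cdot> x = - (z \<cdot> x)"
  using cs_add2[of z "- z" x] by (simp add: eq_neg_iff_add_eq_0 add.commute)

lemma cs_diff: "z \<cdot> (x - y) = z \<cdot> x - z \<cdot> y"
  using cs_add[of z x "- y"] by (simp add: cs_minus)

lemma cs_diff_left: "(z - w) \<cdot> x = z \<cdot> x - w \<cdot> x"
  using cs_add2[of z "- w" x] by (simp add: cs_minus_left)

lemma cs_sum: "z \<cdot> sum f S = (\<Sum>x\<in>S. z \<cdot> f x)"
  by (induction S rule: infinite_finite_induct) (auto simp: cs_add)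

end

instantiation complex :: cvec
begin
definition cs_complex :: "complex \<Rightarrow> complex \<Rightarrow> complex" where "cs_complex = (*)"
instance by standard (simp_all add: cs_complex_def algebra_simps)
end

instantiation poly_mapping :: (type, cvec) cvec
begin
definition cs_poly_mapping :: "complex \<Rightarrow> ('a \<Rightarrow>\<^sub>0 'b) \<Rightarrow> ('a \<Rightarrow>\<^sub>0 'b)" where
  "cs_poly_mapping z p = Poly_Mapping.map (cs z) p"

lemma lookup_cs_raw: "lookup (z \<cdot> p) k = z \<cdot> lookup p k"
  by (simp add: cs_poly_mapping_def map.rep_eq when_def)

instance
  by standard (auto intro!: poly_mapping_eqI simp: lookup_cs_raw lookup_add cs_add cs_add2 cs_cs)
end

lemma lookup_cs [simp]: "lookup (z \<cdot> p) k = z * lookup p k"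
  for p :: "'k \<Rightarrow>\<^sub>0 complex"
  by (simp add: lookup_cs_raw cs_complex_def)

lemma cs_single: "z \<cdot> single k w = single k (z * w)"
  by (rule poly_mapping_eqI) (simp add: lookup_single when_def)

lemma cs_eq_map: "z \<cdot> p = Poly_Mapping.map ((*) z) p"
  for p :: "'k \<Rightarrow>\<^sub>0 complex"
  by (simp add: cs_poly_mapping_def cs_complex_def)

definition lin :: "('a::cvec \<Rightarrow> 'b::cvec) \<Rightarrow> bool" where
  "lin f \<longleftrightarrow> (\<forall>x y. f (x + y) = f x + f y) \<and> (\<forall>z x. f (z \<cdot> x) = z \<cdot> f x)"

lemma linI: "\<lbrakk>\<And>x y. f (x + y) = f x + f y; \<And>z x. f (z \<cdot> x) = z \<cdot> f x\<rbrakk> \<Longrightarrow> lin f"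
  by (simp add: lin_def)

lemma lin_plus: "lin f \<Longrightarrow> f (x + y) = f x + f y"
  and lin_cs: "lin f \<Longrightarrow> f (z \<cdot> x) = z \<cdot> f x"
  by (simp_all add: lin_def)

lemma lin_0: "lin f \<Longrightarrow> f 0 = 0"
  using lin_cs[of f 0 0] by simp

lemma lin_minus: "lin f \<Longrightarrow> f (- x) = - f x"
  using lin_cs[of f "-1" x] by (simp add: cs_minus_left)

lemma lin_diff: "lin f \<Longrightarrow> f (x - y) = f x - f y"
  using lin_plus[of f x "- y"] by (simp add: lin_minus)

lemma lin_sum: "lin f \<Longrightarrow> f (sum g S) = (\<Sum>x\<in>S. f (g x))"
  by (induction S rule: infinite_finite_induct) (auto simp: lin_0 lin_plus)

lemmas lin_simps = lin_plus lin_cs lin_0 lin_minus lin_diff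

lemma lin_id: "lin (\<lambda>x. x)"
  by (simp add: lin_def)

lemma lin_sub: "lin f \<Longrightarrow> lin g \<Longrightarrow> lin (\<lambda>x. f x - g x)"
  by (simp add: lin_def cs_diff)

lemma lin_scale: "lin f \<Longrightarrow> lin (\<lambda>x. z \<cdot> f x)"
  by (simp add: lin_def cs_add cs_cs mult.commute)

lemma lin_const0: "lin (\<lambda>x. 0)"
  by (simp add: lin_def)

text \<open>The universal property of the vector space with basis 'k. Pairings, coproduct, actions
  and normal forms are brought to this shape, because identities of linear maps then need checking
  on basis elements only (\<open>lin_ext\<close>).\<close>

definition lext :: "('k \<Rightarrow> 'v::cvec) \<Rightarrow> ('k \<Rightarrow>\<^sub>0 complex) \<Rightarrow> 'v" where
  "lext \<phi> x = (\<Sum>k\<in>keys x. lookup x k \<cdot> \<phi> k)"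

lemma lext_superset:
  assumes "finite S" "keys x \<subseteq> S"
  shows "lext \<phi> x = (\<Sum>k\<in>S. lookup x k \<cdot> \<phi> k)"
  unfolding lext_def
  by (rule sum.mono_neutral_left) (use assms in \<open>auto simp: in_keys_iff\<close>)

lemma keys_cs_subset: "keys (z \<cdot> x) \<subseteq> keys x"
  for x :: "'k \<Rightarrow>\<^sub>0 complex"
  by (auto simp: in_keys_iff)

lemma lin_lext [simp, intro]: "lin (lext \<phi>)"
proof (rule linI)
  fix x y :: "'a \<Rightarrow>\<^sub>0 complex" and z
  let ?S = "keys x \<union> keys y"
  have "lext \<phi> (x + y) = (\<Sum>k\<in>?S. lookup (x + y) k \<cdot> \<phi> k)"
    by (rule lext_superset) (simp_all add: Poly_Mapping.keys_add)
  also have "\<dots> = (\<Sum>k\<in>?S. lookup x k \<cdot> \<phi> k) + (\<Sum>k\<in>?S. lookup y k \<cdot> \<phi> k)"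
    by (simp add: lookup_add cs_add2 sum.distrib)
  also have "\<dots> = lext \<phi> x + lext \<phi> y"
    by (simp add: lext_superset[symmetric])
  finally show "lext \<phi> (x + y) = lext \<phi> x + lext \<phi> y" .
  have "lext \<phi> (z \<cdot> x) = (\<Sum>k\<in>keys x. lookup (z \<cdot> x) k \<cdot> \<phi> k)"
    by (rule lext_superset) (auto intro: keys_cs_subset[THEN subsetD])
  then show "lext \<phi> (z \<cdot> x) = z \<cdot> lext \<phi> x"
    by (simp add: lext_def cs_sum cs_cs)
qed

lemmas lext_plus = lin_plus[OF lin_lext]
  and lext_cs = lin_cs[OF lin_lext]
  and lext_0 = lin_0[OF lin_lext]
  and lext_minus = lin_minus[OF lin_lext]
  and lext_diff = lin_diff[OF lin_lext]
  and lext_sum = lin_sum[OF lin_lext]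

lemma lext_single [simp]: "lext \<phi> (single k z) = z \<cdot> \<phi> k"
  by (cases "z = 0") (simp_all add: lext_def)

lemma sum_single: "(\<Sum>k\<in>keys x. single k (lookup x k)) = x"
  by (rule poly_mapping_eqI)
    (auto simp: lookup_sum lookup_single when_def sum.delta' in_keys_iff)

lemma lin_eq_lext:
  fixes f :: "('k \<Rightarrow>\<^sub>0 complex) \<Rightarrow> 'v::cvec"
  assumes "lin f"
  shows "f x = lext (\<lambda>k. f (single k 1)) x"
proof -
  have "f x = f (\<Sum>k\<in>keys x. lookup x k \<cdot> single k 1)"
    by (simp add: cs_single sum_single)
  then show ?thesis
    by (simp add: lin_sum[OF assms] lin_cs[OF assms] lext_def)
qed

lemma lin_ext:
  fixes f g :: "('k \<Rightarrow>\<^sub>0 complex) \<Rightarrow> 'v::cvec"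
  assumes "lin f" "lin g" "\<And>k. f (single k 1) = g (single k 1)"
  shows "f x = g x"
  by (subst lin_eq_lext[OF assms(1)], subst lin_eq_lext[OF assms(2)]) (simp add: assms(3))

lemma lext_add_fun: "lext (\<lambda>k. \<phi> k + \<psi> k) x = lext \<phi> x + lext \<psi> x"
  and lext_cs_fun: "lext (\<lambda>k. z \<cdot> \<phi> k) x = z \<cdot> lext \<phi> x"
  by (simp_all add: lext_def cs_add sum.distrib cs_sum cs_cs mult.commute)

lemma lext_lin_fun: "lin h \<Longrightarrow> h (lext \<phi> x) = lext (\<lambda>k. h (\<phi> k)) x"
  by (simp add: lext_def lin_sum lin_cs)

lemma lin_arg_cs_fun: "(\<And>k. lin (\<lambda>x. \<phi> x k)) \<Longrightarrow> lin (\<lambda>x. lext (\<phi> x) y)"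
proof -
  assume lin: "\<And>k. lin (\<lambda>x. \<phi> x k)"
  have "\<phi> (x + y) k = \<phi> x k + \<phi> y k" "\<phi> (z \<cdot> x) k = z \<cdot> \<phi> x k" for x y z k
    using lin[of k] by (simp_all add: lin_def)
  then show "lin (\<lambda>x. lext (\<phi> x) y)"
    by (intro linI) (simp_all add: lext_def cs_add sum.distrib cs_sum cs_cs mult.commute)
qed

text \<open>Adding one multiple at a time makes minimality of the span a plain induction.\<close>

inductive_set cspan :: "'v::cvec set \<Rightarrow> 'v set" for G where
  zero: "0 \<in> cspan G"
| step: "x \<in> G \<Longrightarrow> y \<in> cspan G \<Longrightarrow> z \<cdot> x + y \<in> cspan G"

lemma cspan_base: "x \<in> G \<Longrightarrow> x \<in> cspan G"
  using cspan.step[of x G 0 1] by (simp add: cspan.zero)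

lemma cspan_add: "x \<in> cspan G \<Longrightarrow> y \<in> cspan G \<Longrightarrow> x + y \<in> cspan G"
  by (induction rule: cspan.induct) (auto simp: add.assoc intro: cspan.step)

lemma cspan_cs: "x \<in> cspan G \<Longrightarrow> z \<cdot> x \<in> cspan G"
  by (induction rule: cspan.induct) (auto simp: cs_add cs_cs intro: cspan.intros)

lemma cspan_sum: "(\<And>i. i \<in> S \<Longrightarrow> f i \<in> cspan G) \<Longrightarrow> sum f S \<in> cspan G"
  by (induction S rule: infinite_finite_induct) (auto intro: cspan.zero cspan_add)

lemma cspan_minimal:
  assumes "x \<in> cspan G" "G \<subseteq> S" "0 \<in> S"
    "\<And>x y. x \<in> S \<Longrightarrow> y \<in> S \<Longrightarrow> x + y \<in> S" "\<And>z x. x \<in> S \<Longrightarrow> z \<cdot> x \<in> S"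
  shows "x \<in> S"
  using assms(1) by induction (use assms(2-) in auto)

lemma cspan_image_lin: "lin f \<Longrightarrow> x \<in> cspan G \<Longrightarrow> f x \<in> cspan (f ` G)"
  by (rotate_tac, induction rule: cspan.induct) (auto simp: lin_simps intro: cspan.intros)

section \<open>The free algebra and its quotients\<close>

abbreviation mon :: "'g list \<Rightarrow> 'g free_alg" where
  "mon w \<equiv> single w 1"

lemma single_mult: "single v x * single w y = single (v @ w) (x * y)"
  for x y :: complex
  by (simp add: mult_single plus_list_def)

lemma mon_Nil: "mon [] = 1"
  by (metis single_one zero_list_def)

lemma mon_Cons: "mon (g # w) = gen g * mon w"
  by (simp add: gen_def single_mult)

lemma const_mult: "const z * x = z \<cdot> x"
  by (simp add: const_def cs_eq_map mult_map_scale_conv_mult zero_list_def)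

lemma cs_mult_left: "(z \<cdot> x) * y = z \<cdot> (x * y)" for x y :: "'g free_alg"
  by (metis const_mult mult.assoc)

lemma lin_mult_right: "lin (\<lambda>x. x * y)" for y :: "'g free_alg"
  by (rule linI) (simp_all add: algebra_simps cs_mult_left)

lemma const_central: "x * const z = const z * x" for x :: "'g free_alg"
  by (rule lin_ext[of "\<lambda>x. x * const z" "\<lambda>x. const z * x"])
    (simp_all add: lin_mult_right const_mult lin_id lin_scale, simp add: const_def single_mult cs_single)

lemma cs_mult_right: "x * (z \<cdot> y) = z \<cdot> (x * y)" for x y :: "'g free_alg"
  by (metis const_central const_mult mult.assoc)

lemma lin_mult_left: "lin (\<lambda>y. x * y)" for x :: "'g free_alg"
  by (rule linI) (simp_all add: algebra_simps cs_mult_right)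

lemmas cs_mult = cs_mult_left cs_mult_right

lemma lin_ext2:
  fixes f g :: "('k \<Rightarrow>\<^sub>0 complex) \<Rightarrow> ('l \<Rightarrow>\<^sub>0 complex) \<Rightarrow> 'v::cvec"
  assumes "\<And>y. lin (\<lambda>x. f x y)" "\<And>y. lin (\<lambda>x. g x y)" "\<And>x. lin (f x)" "\<And>x. lin (g x)"
    "\<And>k l. f (single k 1) (single l 1) = g (single k 1) (single l 1)"
  shows "f x y = g x y"
proof (rule lin_ext[OF assms(1,2)])
  fix k
  show "f (single k 1) y = g (single k 1) y"
    by (rule lin_ext[OF assms(3,4)]) (rule assms(5))
qed

lemma ring_free_ring: "ring (free_ring :: 'g free_alg ring)"
proof (rule ringI)
  show "abelian_group (free_ring :: 'g free_alg ring)"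
  proof (rule abelian_groupI)
    fix x :: "'g free_alg"
    show "\<exists>y\<in>carrier free_ring. y \<oplus>\<^bsub>free_ring\<^esub> x = \<zero>\<^bsub>free_ring\<^esub>"
      by (auto simp: free_ring_def intro: exI[of _ "- x"])
  qed (auto simp: free_ring_def)
  show "monoid (free_ring :: 'g free_alg ring)"
    by (rule monoidI) (auto simp: free_ring_def mult.assoc)
qed (auto simp: free_ring_def algebra_simps)

abbreviation idl :: "'g free_alg set \<Rightarrow> 'g free_alg set" where
  "idl rels \<equiv> Idl\<^bsub>free_ring\<^esub> rels"

lemma ideal_idl: "ideal (idl rels) free_ring"
  by (rule ring.genideal_ideal[OF ring_free_ring]) (simp add: free_ring_def)

lemma idl_rel: "r \<in> rels \<Longrightarrow> r \<in> idl rels"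
  using ring.genideal_self[OF ring_free_ring, of rels] by (auto simp: free_ring_def)

lemma idl_0: "0 \<in> idl rels"
  using additive_subgroup.zero_closed[OF ideal.axioms(1)[OF ideal_idl[of rels]]]
  by (simp add: free_ring_def)

lemma idl_add: "x \<in> idl rels \<Longrightarrow> y \<in> idl rels \<Longrightarrow> x + y \<in> idl rels"
  using additive_subgroup.a_closed[OF ideal.axioms(1)[OF ideal_idl[of rels]]]
  by (simp add: free_ring_def)

lemma idl_mult: "x \<in> idl rels \<Longrightarrow> y * x \<in> idl rels" "x \<in> idl rels \<Longrightarrow> x * y \<in> idl rels"
  using ideal.I_l_closed[OF ideal_idl[of rels], of x y] ideal.I_r_closed[OF ideal_idl[of rels], of x y]
  by (simp_all add: free_ring_def)

lemma idl_cs: "x \<in> idl rels \<Longrightarrow> z \<cdot> x \<in> idl rels"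
  by (metis const_mult idl_mult(1))

lemma idl_minus: "x \<in> idl rels \<Longrightarrow> - x \<in> idl rels"
  using idl_cs[of x rels "-1"] by (simp add: cs_minus_left)

lemma idl_diff: "x \<in> idl rels \<Longrightarrow> y \<in> idl rels \<Longrightarrow> x - y \<in> idl rels"
  using idl_add[of x rels "- y"] by (simp add: idl_minus)

lemma idl_sum: "(\<And>i. i \<in> S \<Longrightarrow> f i \<in> idl rels) \<Longrightarrow> sum f S \<in> idl rels"
  by (induction S rule: infinite_finite_induct) (auto intro: idl_0 idl_add)

text \<open>The elements satisfying \<open>P\<close> form an ideal containing \<open>rels\<close>.
  Closure under negation is the case \<open>left\<close> with factor -1.\<close>

lemma idl_induct [consumes 1, case_names rel zero add left right]:
  assumes "x \<in> idl rels" "\<And>r. r \<in> rels \<Longrightarrow> P r" "P 0" "\<And>x y. P x \<Longrightarrow> P y \<Longrightarrow> P (x + y)"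
    "\<And>x y. P x \<Longrightarrow> P (y * x)" "\<And>x y. P x \<Longrightarrow> P (x * y)"
  shows "P x"
proof -
  have "ideal {x. P x} (free_ring :: 'a free_alg ring)"
  proof (rule idealI[OF ring_free_ring])
    have neg: "P (- x)" if "P x" for x
      using assms(5)[OF that, of "- 1"] by simp
    have inv: "inv\<^bsub>add_monoid (free_ring :: 'a free_alg ring)\<^esub> x = - x" for x :: "'a free_alg"
    proof -
      interpret ring "free_ring :: 'a free_alg ring" by (rule ring_free_ring)
      have "(- x) \<oplus>\<^bsub>free_ring\<^esub> x = \<zero>\<^bsub>free_ring\<^esub>" by (simp add: free_ring_def)
      then have "\<ominus>\<^bsub>free_ring\<^esub> x = - x"
        using minus_equality[of "- x" x] by (simp add: free_ring_def)
      then show ?thesis by (simp add: a_inv_def)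
    qed
    show "subgroup {x. P x} (add_monoid (free_ring :: 'a free_alg ring))"
      by (rule subgroup.intro, unfold mem_Collect_eq inv) (auto simp: free_ring_def intro: neg assms)
  qed (auto simp: free_ring_def intro: assms)
  then have "idl rels \<subseteq> {x. P x}"
    by (rule ring.genideal_minimal[OF ring_free_ring]) (auto intro: assms)
  then show ?thesis using assms(1) by auto
qed

section \<open>Congruence modulo the ideal, and computing with cosets through
  representatives\<close>

definition cong :: "'g free_alg set \<Rightarrow> 'g free_alg \<Rightarrow> 'g free_alg \<Rightarrow> bool" where
  "cong rels x y \<longleftrightarrow> x - y \<in> idl rels"

abbreviation "aidl t \<equiv> idl (arels t)"
abbreviation "acong t \<equiv> cong (arels t)"
abbreviation "acls t \<equiv> cls (arels t)"

lemma cong_refl [simp]: "cong rels x x"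
  by (simp add: cong_def idl_0)

lemma cong_sym: "cong rels x y \<Longrightarrow> cong rels y x"
  unfolding cong_def using idl_minus[of "x - y" rels] by simp

lemma cong_trans [trans]: "cong rels x y \<Longrightarrow> cong rels y z \<Longrightarrow> cong rels x z"
  unfolding cong_def using idl_add[of "x - y" rels "y - z"] by simp

lemma cong_add: "cong rels x y \<Longrightarrow> cong rels x' y' \<Longrightarrow> cong rels (x + x') (y + y')"
  unfolding cong_def using idl_add[of "x - y" rels "x' - y'"] by (simp add: algebra_simps)

lemma cong_cs: "cong rels x y \<Longrightarrow> cong rels (z \<cdot> x) (z \<cdot> y)"
  unfolding cong_def using idl_cs[of "x - y" rels z] by (simp add: cs_diff)

lemma cong_minus: "cong rels x y \<Longrightarrow> cong rels (- x) (- y)"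
  using cong_cs[of rels x y "-1"] by (simp add: cs_minus_left)

lemma cong_diff: "cong rels x y \<Longrightarrow> cong rels x' y' \<Longrightarrow> cong rels (x - x') (y - y')"
  using cong_add[of rels x y "- x'" "- y'"] by (simp add: cong_minus)

lemma cong_mult_left: "cong rels x y \<Longrightarrow> cong rels (z * x) (z * y)"
  unfolding cong_def using idl_mult(1)[of "x - y" rels z] by (simp add: algebra_simps)

lemma cong_mult_right: "cong rels x y \<Longrightarrow> cong rels (x * z) (y * z)"
  unfolding cong_def using idl_mult(2)[of "x - y" rels z] by (simp add: algebra_simps)

lemma cong_0_iff: "cong rels x 0 \<longleftrightarrow> x \<in> idl rels"
  by (simp add: cong_def)

lemma ring_presented: "ring (presented rels)"
  unfolding presented_def by (rule ideal.quotient_is_ring[OF ideal_idl])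

lemma cls_hom: "ring_hom_ring free_ring (presented rels) (cls rels)"
proof -
  have "cls rels = (+>\<^bsub>free_ring\<^esub>) (idl rels)"
    by (rule ext) (simp add: cls_def)
  then show ?thesis
    unfolding presented_def using ideal.rcos_ring_hom_ring[OF ideal_idl] by simp
qed

lemma cls_carrier [simp]: "cls rels x \<in> carrier (presented rels)"
  using ring_hom_ring.homh[OF cls_hom, THEN ring_hom_closed, of x] by (simp add: free_ring_def)

lemma cls_mult: "cls rels x \<otimes>\<^bsub>presented rels\<^esub> cls rels y = cls rels (x * y)"
  using ring_hom_ring.homh[OF cls_hom, THEN ring_hom_mult, of x y rels] by (simp add: free_ring_def)

lemma cls_add: "cls rels x \<oplus>\<^bsub>presented rels\<^esub> cls rels y = cls rels (x + y)"
  using ring_hom_ring.homh[OF cls_hom, THEN ring_hom_add, of x y rels] by (simp add: free_ring_def)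

lemma cls_one: "\<one>\<^bsub>presented rels\<^esub> = cls rels 1"
  using ring_hom_ring.homh[OF cls_hom, THEN ring_hom_one, of rels] by (simp add: free_ring_def)

lemma cls_pow: "cls rels x [^]\<^bsub>presented rels\<^esub> (n::nat) = cls rels (x ^ n)"
proof (induction n)
  case 0
  then show ?case by (simp add: cls_one)
next
  case (Suc n)
  then show ?case by (simp add: cls_mult power_commutes)
qed

lemma scal_cls: "scal rels z (cls rels x) = cls rels (z \<cdot> x)"
  by (simp add: scal_def cls_mult const_mult)

lemma mem_cls: "y \<in> cls rels x \<longleftrightarrow> cong rels y x"
proof -
  have "y \<in> cls rels x \<longleftrightarrow> (\<exists>h\<in>idl rels. y = h + x)"
    by (auto simp: cls_def a_r_coset_def r_coset_def free_ring_def)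
  also have "\<dots> \<longleftrightarrow> cong rels y x"
    unfolding cong_def by (metis add_diff_cancel_right' diff_add_cancel)
  finally show ?thesis .
qed

lemma cls_0: "\<zero>\<^bsub>presented rels\<^esub> = cls rels 0"
  by (auto simp: mem_cls cong_0_iff presented_def FactRing_def)

lemma cls_eq: "cls rels x = cls rels y \<longleftrightarrow> cong rels x y"
proof
  assume "cls rels x = cls rels y"
  then have "x \<in> cls rels y" using mem_cls[of x rels x] by simp
  then show "cong rels x y" by (simp add: mem_cls)
next
  assume "cong rels x y"
  then show "cls rels x = cls rels y"
    by (metis (mono_tags, lifting) cong_sym cong_trans mem_cls subsetI subset_antisym)
qed

lemma carrier_presented: "carrier (presented rels) = range (cls rels)"
proof -
  have "X \<in> range (cls rels)" if "X \<in> carrier (presented rels)" for X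
    using that by (auto simp: presented_def FactRing_def A_RCOSETS_def RCOSETS_def cls_def a_r_coset_def)
  then show ?thesis by auto
qed

lemma carrier_cases:
  assumes "X \<in> carrier (presented rels)"
  obtains x where "X = cls rels x"
  using assms by (auto simp: carrier_presented)

lemma cls_finsum:
  assumes "finite T"
  shows "(\<Oplus>\<^bsub>presented rels\<^esub>x\<in>T. cls rels (f x)) = cls rels (\<Sum>x\<in>T. f x)"
proof -
  interpret ring "presented rels" by (rule ring_presented)
  show ?thesis using assms
    by (induction T) (auto simp: cls_0 cls_add)
qed

text \<open>\<open>lincombs\<close> sums over a finite set of cosets with one coefficient each,
  whereas \<open>cspan\<close> works with representatives and allows repetitions. The inclusion from
  right to left is therefore an induction in which coefficients may have to be merged.\<close>

lemma lincombs_cspan: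
  assumes "S \<subseteq> carrier (presented rels)"
  shows "lincombs rels S = cls rels ` cspan {x. cls rels x \<in> S}"
proof (intro equalityI subsetI)
  fix X assume "X \<in> lincombs rels S"
  then obtain T z where T: "finite T" "T \<subseteq> S"
    and X: "X = (\<Oplus>\<^bsub>presented rels\<^esub>x\<in>T. scal rels (z x) x)"
    by (auto simp: lincombs_def)
  define r where "r x = (SOME y. cls rels y = x)" for x
  have r: "cls rels (r x) = x" if "x \<in> T" for x
  proof -
    from that T assms obtain y where "cls rels y = x" by (metis carrier_cases subsetD)
    then show ?thesis unfolding r_def by (rule someI)
  qed
  interpret ring "presented rels" by (rule ring_presented)
  have "X = (\<Oplus>\<^bsub>presented rels\<^esub>x\<in>T. cls rels (z x \<cdot> r x))"
    unfolding X
  proof (rule finsum_cong')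
    fix u assume "u \<in> T"
    then show "scal rels (z u) u = cls rels (z u \<cdot> r u)"
      using r[of u] scal_cls[of rels "z u" "r u"] by simp
  qed simp_all
  also have "\<dots> = cls rels (\<Sum>x\<in>T. z x \<cdot> r x)"
    by (rule cls_finsum[OF T(1)])
  finally have X: "X = cls rels (\<Sum>x\<in>T. z x \<cdot> r x)" .
  have "(\<Sum>x\<in>T. z x \<cdot> r x) \<in> cspan {x. cls rels x \<in> S}"
    by (intro cspan_sum cspan_cs cspan_base) (use r T in auto)
  then show "X \<in> cls rels ` cspan {x. cls rels x \<in> S}"
    unfolding X by (rule imageI)
next
  interpret ring "presented rels" by (rule ring_presented)
  fix X assume "X \<in> cls rels ` cspan {x. cls rels x \<in> S}"
  then obtain x where x: "X = cls rels x" "x \<in> cspan {x. cls rels x \<in> S}" by auto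
  from x(2) have "cls rels x \<in> lincombs rels S"
  proof induction
    case zero
    have "cls rels 0 = (\<Oplus>\<^bsub>presented rels\<^esub>x\<in>{}. scal rels ((\<lambda>_. 0) x) x)" by (simp add: cls_0)
    moreover have "finite {}" "{} \<subseteq> S" by simp_all
    ultimately show ?case unfolding lincombs_def
      by (intro CollectI exI[of _ "{}"] exI[of _ "\<lambda>_. 0"]) simp
  next
    case (step x y c)
    from step.IH obtain T z where T: "finite T" "T \<subseteq> S"
      and y: "cls rels y = (\<Oplus>\<^bsub>presented rels\<^esub>x\<in>T. scal rels (z x) x)"
      by (auto simp: lincombs_def)
    have car: "scal rels w u \<in> carrier (presented rels)" if "u \<in> S" for u w
      using assms that by (auto simp: scal_cls elim!: carrier_cases[OF subsetD])
    have sadd: "scal rels (v + w) u = scal rels v u \<oplus>\<^bsub>presented rels\<^esub> scal rels w u" if "u \<in> S" for u v w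
      using assms that by (auto simp: scal_cls cls_add cs_add2 elim!: carrier_cases[OF subsetD])
    have s0: "scal rels 0 u = \<zero>\<^bsub>presented rels\<^esub>" if "u \<in> S" for u
      using assms that by (auto simp: scal_cls cls_0 elim!: carrier_cases[OF subsetD])
    let ?x = "cls rels x"
    have xS: "?x \<in> S" using step.hyps by simp
    \<comment> \<open>A coset already in \<open>T\<close> cannot be listed twice; its coefficient
      absorbs \<open>c\<close>.\<close>
    define z' where "z' u = (if u = ?x then c + (if ?x \<in> T then z u else 0) else z u)" for u
    have rest: "(\<Oplus>\<^bsub>presented rels\<^esub>u\<in>T - {?x}. scal rels (z' u) u)
        = (\<Oplus>\<^bsub>presented rels\<^esub>u\<in>T - {?x}. scal rels (z u) u)"
    proof (rule finsum_cong')
      fix u assume "u \<in> T - {?x}"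
      then show "scal rels (z' u) u = scal rels (z u) u" by (simp add: z'_def)
    next
      show "(\<lambda>u. scal rels (z u) u) \<in> T - {?x} \<rightarrow> carrier (presented rels)"
        using T(2) by (blast intro: car)
    qed simp
    have c2: "(\<Oplus>\<^bsub>presented rels\<^esub>u\<in>T - {?x}. scal rels (z u) u) \<in> carrier (presented rels)"
      by (rule finsum_closed, use T(2) in \<open>blast intro: car\<close>)
    have ins: "(\<Oplus>\<^bsub>presented rels\<^esub>u\<in>insert ?x (T - {?x}). scal rels (f u) u) =
        scal rels (f ?x) ?x \<oplus>\<^bsub>presented rels\<^esub> (\<Oplus>\<^bsub>presented rels\<^esub>u\<in>T - {?x}. scal rels (f u) u)" for f
    proof (rule finsum_insert)
      show "(\<lambda>u. scal rels (f u) u) \<in> T - {?x} \<rightarrow> carrier (presented rels)"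
        using T(2) by (blast intro: car)
      show "scal rels (f ?x) ?x \<in> carrier (presented rels)"
        using xS by (rule car)
    qed (use T(1) in simp_all)
    have "(\<Oplus>\<^bsub>presented rels\<^esub>u\<in>insert ?x T. scal rels (z' u) u) = cls rels (c \<cdot> x + y)"
    proof (cases "?x \<in> T")
      case True
      have "(\<Oplus>\<^bsub>presented rels\<^esub>u\<in>insert ?x T. scal rels (z' u) u)
        = scal rels c ?x \<oplus>\<^bsub>presented rels\<^esub> (scal rels (z ?x) ?x \<oplus>\<^bsub>presented rels\<^esub> (\<Oplus>\<^bsub>presented rels\<^esub>u\<in>T - {?x}. scal rels (z u) u))"
        using ins[of z'] True sadd[OF xS, of c "z ?x"] car[OF xS] c2 rest
        by (simp add: z'_def a_assoc)
      also have "\<dots> = scal rels c ?x \<oplus>\<^bsub>presented rels\<^esub> cls rels y"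
        using ins[of z] True y by (simp add: insert_absorb)
      finally show ?thesis by (simp add: scal_cls cls_add)
    next
      case False
      then show ?thesis
        using ins[of z'] rest by (simp add: z'_def scal_cls cls_add flip: y)
    qed
    moreover have "finite (insert ?x T)" "insert ?x T \<subseteq> S" using T xS by auto
    ultimately show ?case unfolding lincombs_def by (intro CollectI exI[of _ "insert ?x T"] exI[of _ z']) simp
  qed
  then show "X \<in> lincombs rels S" using x by simp
qed

text \<open>Every map given by \<open>the_elem\<close> is evaluated through this rule; the first
  premise is its well-definedness on the coset.\<close>

lemma the_elem_const:
  assumes "\<And>x. x \<in> X \<Longrightarrow> f x = y" "X \<noteq> {}"
  shows "the_elem (f ` X) = y"
  using assms by (metis image_cong image_constant_conv the_elem_eq)

section \<open>Homomorphisms and twisted derivations of free algebras\<close>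

named_theorems lsimps

lemmas [lsimps] = lext_plus lext_cs lext_0 lext_minus lext_diff

definition ahom :: "('g \<Rightarrow> 'h free_alg) \<Rightarrow> 'g free_alg \<Rightarrow> 'h free_alg" where
  "ahom h = lext (\<lambda>w. prod_list (map h w))"

lemma lin_ahom: "lin (ahom h)"
  by (simp add: ahom_def)

lemmas [lsimps] = lin_simps[OF lin_ahom]

lemma ahom_mult: "ahom h (x * y) = ahom h x * ahom h y"
  by (rule lin_ext2[of "\<lambda>x y. ahom h (x * y)" "\<lambda>x y. ahom h x * ahom h y"])
    (simp_all add: lin_def lsimps algebra_simps cs_mult, simp add: ahom_def single_mult)

lemma ahom_1 [simp]: "ahom h 1 = 1"
  by (simp add: ahom_def flip: mon_Nil)

lemma ahom_gen [simp]: "ahom h (gen g) = h g"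
  by (simp add: ahom_def gen_def)

lemma ahom_pow: "ahom h (x ^ n) = ahom h x ^ n"
  by (induction n) (simp_all add: ahom_mult)

lemmas ahom_simps = ahom_mult lin_simps[OF lin_ahom]

lemma ahom_idl:
  assumes "\<And>r. r \<in> rels \<Longrightarrow> ahom h r \<in> idl rels'" "x \<in> idl rels"
  shows "ahom h x \<in> idl rels'"
  using assms(2)
  by (induction rule: idl_induct) (simp_all add: ahom_simps assms idl_0 idl_add idl_mult)

lemma ahom_ahom:
  "ahom h (ahom h' x) = ahom (\<lambda>g. ahom h (h' g)) x"
proof (rule lin_ext[of "\<lambda>x. ahom h (ahom h' x)"])
  fix w show "ahom h (ahom h' (mon w)) = ahom (\<lambda>g. ahom h (h' g)) (mon w)"
    by (induction w) (simp_all add: mon_Nil mon_Cons ahom_mult)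
qed (simp_all add: lin_def lsimps)

lemma ahom_id: "ahom gen x = x"
proof (rule lin_ext[of "ahom gen"])
  fix w show "ahom gen (mon w) = mon w"
    by (induction w) (simp_all add: mon_Nil mon_Cons ahom_mult)
qed (auto intro: lin_id lin_ahom)

section \<open>Diagonal automorphisms and twisted derivations\<close>

definition diag :: "('g \<Rightarrow> complex) \<Rightarrow> 'g free_alg \<Rightarrow> 'g free_alg" where
  "diag \<kappa> = ahom (\<lambda>g. \<kappa> g \<cdot> gen g)"

lemma lin_diag: "lin (diag \<kappa>)"
  and diag_mult: "diag \<kappa> (x * y) = diag \<kappa> x * diag \<kappa> y"
  and diag_1 [simp]: "diag \<kappa> 1 = 1"
  and diag_gen [simp]: "diag \<kappa> (gen g) = \<kappa> g \<cdot> gen g"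
  by (simp_all add: diag_def lin_ahom ahom_mult)

lemmas [lsimps] = lin_simps[OF lin_diag]

lemmas diag_simps = diag_mult lin_simps[OF lin_diag]

lemma diag_diag: "diag \<kappa> (diag \<kappa>' x) = diag (\<lambda>g. \<kappa> g * \<kappa>' g) x"
  unfolding diag_def by (simp add: ahom_ahom ahom_simps cs_cs mult.commute)

lemma diag_one [simp]: "diag (\<lambda>g. 1) x = x"
  by (simp add: diag_def ahom_id)

text \<open>The twisted derivation with values \<delta> on generators; its product rule is
  \<open>tder_mult\<close>. The Koszul sign of an odd operator is not kept apart but absorbed into
  \<kappa>.\<close>

primrec tdw :: "('g \<Rightarrow> complex) \<Rightarrow> ('g \<Rightarrow> complex) \<Rightarrow> ('g \<Rightarrow> 'g free_alg) \<Rightarrow> 'g list \<Rightarrow> 'g free_alg" where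
  "tdw \<kappa> \<rho> \<delta> [] = 0"
| "tdw \<kappa> \<rho> \<delta> (g # w) = \<delta> g * diag \<rho> (mon w) + \<kappa> g \<cdot> (gen g * tdw \<kappa> \<rho> \<delta> w)"

definition tder :: "('g \<Rightarrow> complex) \<Rightarrow> ('g \<Rightarrow> complex) \<Rightarrow> ('g \<Rightarrow> 'g free_alg) \<Rightarrow> 'g free_alg \<Rightarrow> 'g free_alg" where
  "tder \<kappa> \<rho> \<delta> = lext (tdw \<kappa> \<rho> \<delta>)"

lemma lin_tder: "lin (tder \<kappa> \<rho> \<delta>)"
  by (simp add: tder_def)

lemmas [lsimps] = lin_simps[OF lin_tder]

lemma tder_1 [simp]: "tder \<kappa> \<rho> \<delta> 1 = 0"
  by (simp add: tder_def flip: mon_Nil)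

lemma tder_gen [simp]: "tder \<kappa> \<rho> \<delta> (gen g) = \<delta> g"
  by (simp add: tder_def gen_def mon_Nil)

lemma tder_Cons: "tder \<kappa> \<rho> \<delta> (gen g * x) = \<delta> g * diag \<rho> x + \<kappa> g \<cdot> (gen g * tder \<kappa> \<rho> \<delta> x)"
  by (rule lin_ext[of "\<lambda>x. tder \<kappa> \<rho> \<delta> (gen g * x)"])
    (simp_all add: lin_def lsimps algebra_simps cs_mult cs_add cs_cs, simp add: tder_def gen_def single_mult)

lemma tder_mult: "tder \<kappa> \<rho> \<delta> (x * y) = tder \<kappa> \<rho> \<delta> x * diag \<rho> y + diag \<kappa> x * tder \<kappa> \<rho> \<delta> y"
proof (rule lin_ext[of "\<lambda>x. tder \<kappa> \<rho> \<delta> (x * y)"])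
  fix w
  show "tder \<kappa> \<rho> \<delta> (mon w * y) = tder \<kappa> \<rho> \<delta> (mon w) * diag \<rho> y + diag \<kappa> (mon w) * tder \<kappa> \<rho> \<delta> y"
    by (induction w)
      (simp_all add: mon_Nil mon_Cons tder_Cons diag_mult mult.assoc cs_mult cs_add algebra_simps)
qed (simp_all add: lin_def lsimps algebra_simps cs_mult cs_add)

lemmas tder_simps = tder_mult lin_simps[OF lin_tder]

text \<open>The product rule sends a multiple of x to an expression in the derivative of x and in
  both twists of x, so the induction carries all three memberships.\<close>

lemma tder_idl:
  assumes "\<And>r. r \<in> rels \<Longrightarrow> diag \<kappa> r \<in> idl rels" "\<And>r. r \<in> rels \<Longrightarrow> diag \<rho> r \<in> idl rels"
    "\<And>r. r \<in> rels \<Longrightarrow> tder \<kappa> \<rho> \<delta> r \<in> idl rels" "x \<in> idl rels"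
  shows "tder \<kappa> \<rho> \<delta> x \<in> idl rels"
proof -
  have "tder \<kappa> \<rho> \<delta> x \<in> idl rels \<and> diag \<kappa> x \<in> idl rels \<and> diag \<rho> x \<in> idl rels"
    using assms(4)
    by (induction rule: idl_induct)
      (simp_all add: tder_simps diag_simps assms idl_0 idl_add idl_mult)
  then show ?thesis by simp
qed

text \<open>Both sides are twisted derivations along \<open>h\<close>, hence agree as soon as they
  do on generators.\<close>

lemma ahom_tder:
  assumes "\<And>g. tder \<kappa>' (\<lambda>_. 1) \<delta>' (h g) = ahom h (\<delta> g)" "\<And>g. diag \<kappa>' (h g) = \<kappa> g \<cdot> h g"
  shows "ahom h (tder \<kappa> (\<lambda>_. 1) \<delta> x) = tder \<kappa>' (\<lambda>_. 1) \<delta>' (ahom h x)"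
proof (rule lin_ext[of "\<lambda>x. ahom h (tder \<kappa> (\<lambda>_. 1) \<delta> x)"])
  fix w
  show "ahom h (tder \<kappa> (\<lambda>_. 1) \<delta> (mon w)) = tder \<kappa>' (\<lambda>_. 1) \<delta>' (ahom h (mon w))"
    by (induction w) (simp_all add: mon_Nil lin_simps[OF lin_ahom] mon_Cons ahom_simps tder_simps cs_mult assms)
qed (simp_all add: lin_def lsimps)

lemma ahom_diag:
  assumes "\<And>g. diag \<kappa>' (h g) = \<kappa> g \<cdot> h g"
  shows "ahom h (diag \<kappa> x) = diag \<kappa>' (ahom h x)"
  unfolding diag_def ahom_ahom using assms by (simp add: ahom_simps diag_def)

text \<open>If \<delta> shifts weights by the factor z, so does the whole derivation. In this form
  kek^-1 = qe and kfk^-1 = q^-1 f pass to the operators.\<close>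

lemma diag_tder:
  assumes "\<And>g. diag \<pi> (\<delta> g) = (z * \<pi> g) \<cdot> \<delta> g"
  shows "diag \<pi> (tder \<kappa> \<rho> \<delta> x) = z \<cdot> tder \<kappa> \<rho> \<delta> (diag \<pi> x)"
proof (rule lin_ext[of "\<lambda>x. diag \<pi> (tder \<kappa> \<rho> \<delta> x)"])
  fix w
  have comm: "diag \<pi> (diag \<rho> y) = diag \<rho> (diag \<pi> y)" for y
    by (simp add: diag_diag mult.commute)
  show "diag \<pi> (tder \<kappa> \<rho> \<delta> (mon w)) = z \<cdot> tder \<kappa> \<rho> \<delta> (diag \<pi> (mon w))"
    by (induction w) (simp_all add: mon_Nil lin_simps[OF lin_diag] mon_Cons diag_simps tder_simps
        cs_mult cs_cs cs_add assms comm ac_simps)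
qed (simp_all add: lin_def lsimps cs_add cs_cs mult.commute)

definition chom :: "('g \<Rightarrow> complex) \<Rightarrow> 'g free_alg \<Rightarrow> complex" where
  "chom \<kappa> = lext (\<lambda>w. prod_list (map \<kappa> w))"

lemma cs_complex [simp]: "z \<cdot> w = z * w" for w :: complex
  by (simp add: cs_complex_def)

lemma lin_chom: "lin (chom \<kappa>)"
  by (simp add: chom_def)

lemmas [lsimps] = lin_simps[OF lin_chom]

lemma chom_mult: "chom \<kappa> (x * y) = chom \<kappa> x * chom \<kappa> y"
  by (rule lin_ext2[of "\<lambda>x y. chom \<kappa> (x * y)" "\<lambda>x y. chom \<kappa> x * chom \<kappa> y"])
    (simp_all add: lin_def lsimps algebra_simps cs_mult, simp add: chom_def single_mult)

lemma chom_1 [simp]: "chom \<kappa> 1 = 1"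
  by (simp add: chom_def flip: mon_Nil)

lemma chom_gen [simp]: "chom \<kappa> (gen g) = \<kappa> g"
  by (simp add: chom_def gen_def)

lemma chom_mon: "chom \<kappa> (mon w) = prod_list (map \<kappa> w)"
  by (simp add: chom_def)

lemmas chom_simps = chom_mult lin_simps[OF lin_chom]

lemma chom_idl:
  assumes "x \<in> idl rels" "\<And>r. r \<in> rels \<Longrightarrow> chom \<kappa> r = 0"
  shows "chom \<kappa> x = 0"
  using assms by (induction rule: idl_induct) (simp_all add: chom_simps)

section \<open>The coproduct on words\<close>

definition tmul :: "agen list \<times> agen list \<Rightarrow> agen list \<times> agen list \<Rightarrow> free_tens" where
  "tmul p r = single (fst p @ fst r, snd p @ snd r)
     ((-1) ^ (word_parity apar (snd p) * word_parity apar (fst r)))"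

lemma tens_mult_lext: "tens_mult D E = lext (\<lambda>p. lext (tmul p) E) D"
  unfolding tens_mult_def lext_def tmul_def
  by (auto intro!: sum.cong simp: cs_sum cs_single cs_cs ac_simps)

lemma tens_lext: "tens x y = lext (\<lambda>u. lext (\<lambda>v. single (u, v) 1) y) x"
  unfolding tens_def lext_def by (auto intro!: sum.cong simp: cs_sum cs_single cs_cs)

lemma tens_mon [simp]: "tens (mon u) (mon v) = single (u, v) 1"
  by (simp add: tens_lext)

lemma tens_gen: "tens (gen g) (gen h) = single ([g], [h]) 1"
  by (simp add: gen_def)

lemma lin_tens_left: "lin (\<lambda>x. tens x y)"
  unfolding tens_lext by (rule lin_lext)

lemma lin_tens_right: "lin (tens x)"
  unfolding tens_lext by (rule lin_arg_cs_fun) (rule lin_lext)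

lemma lin_tens_mult_left: "lin (\<lambda>D. tens_mult D E)"
  unfolding tens_mult_lext by (rule lin_lext)

lemma lin_tens_mult_right: "lin (tens_mult D)"
  unfolding tens_mult_lext by (rule lin_arg_cs_fun) (rule lin_lext)

lemma tens_mult_single: "tens_mult (single p z) (single r w) = (z * w) \<cdot> tmul p r"
  by (simp add: tens_mult_lext cs_cs)

lemma coprod_free_lext: "coprod_free = lext coprod_word"
  by (rule ext) (simp add: coprod_free_def lext_def cs_eq_map)

lemma lin_coprod_free: "lin coprod_free"
  by (simp add: coprod_free_lext)

lemmas [lsimps] = lin_simps[OF lin_coprod_free] lin_simps[OF lin_tens_left] lin_simps[OF lin_tens_right]
  lin_simps[OF lin_tens_mult_left] lin_simps[OF lin_tens_mult_right]

lemma coprod_free_mon [simp]: "coprod_free (mon w) = coprod_word w"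
  by (simp add: coprod_free_lext)

lemma word_parity_simps [simp]:
  "word_parity p [] = 0" "word_parity p (g # w) = p g + word_parity p w"
  "word_parity p (v @ w) = word_parity p v + word_parity p w"
  by (simp_all add: word_parity_def)

text \<open>Every generator has as coproduct a sum of pairs of generators with coefficient 1.
  Keeping these pairs as a list gives the recursion over words in
  \<open>lext_coprod_Cons\<close>.\<close>

primrec coprod_pairs :: "agen \<Rightarrow> (agen \<times> agen) list" where
  "coprod_pairs Aa = [(Aa, Aa), (Ab, Ac)]"
| "coprod_pairs Ab = [(Aa, Ab), (Ab, Ad)]"
| "coprod_pairs Ac = [(Ac, Aa), (Ad, Ac)]"
| "coprod_pairs Ad = [(Ac, Ab), (Ad, Ad)]"
| "coprod_pairs Asigma = [(Asigma, Asigma)]"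

lemma lext_tens_mult_single:
  "lext \<Phi> (tens_mult (single (x, y) 1) D) =
    lext (\<lambda>(z, w). (-1) ^ (word_parity apar y * word_parity apar z) \<cdot> \<Phi> (x @ z, y @ w)) D"
  by (simp add: tens_mult_lext lext_lin_fun[OF lin_lext] tmul_def case_prod_beta')

lemma lext_coprod_Cons:
  "lext \<Phi> (coprod_word (g # w)) = (\<Sum>(x, y)\<leftarrow>coprod_pairs g.
     lext (\<lambda>(z, v). (-1) ^ (apar y * word_parity apar z) \<cdot> \<Phi> (x # z, y # v)) (coprod_word w))"
  by (cases g) (simp_all add: tens_gen lin_plus[OF lin_tens_mult_left] lext_plus lext_tens_mult_single)

definition Ract :: "(agen list \<Rightarrow> complex) \<Rightarrow> agen free_alg \<Rightarrow> agen free_alg" where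
  "Ract \<phi> u = lext (\<lambda>(v1, v2). \<phi> v1 \<cdot> mon v2) (coprod_free u)"

text \<open>\<open>p\<close> is the parity of the functional in the sign of the left action. It is a
  parameter because stripping a letter off the word changes the parity of the remaining functional
  (\<open>Lact_Cons\<close>).\<close>

definition Lact :: "nat \<Rightarrow> (agen list \<Rightarrow> complex) \<Rightarrow> agen free_alg \<Rightarrow> agen free_alg" where
  "Lact p \<phi> u = lext (\<lambda>(v1, v2). ((-1) ^ (p * word_parity apar v1) * \<phi> v2) \<cdot> mon v1) (coprod_free u)"

lemma lin_Ract: "lin (Ract \<phi>)"
  by (simp add: lin_def Ract_def lsimps)

lemma lin_Lact: "lin (Lact p \<phi>)"
  by (simp add: lin_def Lact_def lsimps)

lemmas [lsimps] = lin_simps[OF lin_Ract] lin_simps[OF lin_Lact]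

definition sg :: "agen \<Rightarrow> complex" where "sg g = (-1) ^ apar g"

lemma sg_simps [simp]: "sg Aa = 1" "sg Ab = -1" "sg Ac = -1" "sg Ad = 1" "sg Asigma = 1"
  by (simp_all add: sg_def)

section \<open>The two actions as twisted derivations\<close>

text \<open>The generators are eigenvectors of k. In the matrix with rows (a, b) and (c, d), the
  right action of k sees the row and the left action (\<open>kL\<close>) the column.\<close>

primrec kR :: "complex \<Rightarrow> agen \<Rightarrow> complex" where
  "kR t Aa = t" | "kR t Ab = t" | "kR t Ac = - inverse t" | "kR t Ad = - inverse t" | "kR t Asigma = -1"

primrec kL :: "complex \<Rightarrow> agen \<Rightarrow> complex" where
  "kL t Aa = t" | "kL t Ab = - inverse t" | "kL t Ac = t" | "kL t Ad = - inverse t" | "kL t Asigma = -1"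

text \<open>\<open>l\<close> and \<open>m\<close> stand for the values of an odd functional at b and
  c. The minus signs in \<open>dL\<close> are the Koszul signs of passing an odd first tensor
  factor.\<close>

primrec dR :: "complex \<Rightarrow> complex \<Rightarrow> agen \<Rightarrow> agen free_alg" where
  "dR l m Aa = l \<cdot> gen Ac" | "dR l m Ab = l \<cdot> gen Ad" | "dR l m Ac = m \<cdot> gen Aa"
| "dR l m Ad = m \<cdot> gen Ab" | "dR l m Asigma = 0"

primrec dL :: "complex \<Rightarrow> complex \<Rightarrow> agen \<Rightarrow> agen free_alg" where
  "dL l m Aa = (- m) \<cdot> gen Ab" | "dL l m Ab = l \<cdot> gen Aa" | "dL l m Ac = m \<cdot> gen Ad"
| "dL l m Ad = (- l) \<cdot> gen Ac" | "dL l m Asigma = 0"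

definition DR :: "complex \<Rightarrow> complex \<Rightarrow> complex \<Rightarrow> agen free_alg \<Rightarrow> agen free_alg" where
  "DR t l m = tder (\<lambda>g. sg g * kR t g) (\<lambda>_. 1) (dR l m)"

definition DL :: "complex \<Rightarrow> complex \<Rightarrow> complex \<Rightarrow> agen free_alg \<Rightarrow> agen free_alg" where
  "DL t l m = tder (\<lambda>g. sg g * kL t g) (\<lambda>_. 1) (dL l m)"

text \<open>Up to scalars both \<open>e\<close> and \<open>fk\<close> are of this form.\<close>

primrec dw :: "complex \<Rightarrow> complex \<Rightarrow> complex \<Rightarrow> agen list \<Rightarrow> complex" where
  "dw t l m [] = 0"
| "dw t l m (g # w) = (if g = Ab then l else if g = Ac then m else 0) * eps_word w + sg g * k_gen t g * dw t l m w"

lemma word_simps [simp]: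
  "eps_word [] = 1" "eps_word (g # w) = eps_gen g * eps_word w"
  "k_word t [] = 1" "k_word t (g # w) = k_gen t g * k_word t w"
  "kinv_word t [] = 1" "kinv_word t (g # w) = kinv_gen t g * kinv_word t w"
  by (simp_all add: eps_word_def k_word_def kinv_word_def)

lemma eps_even: "odd (word_parity apar w) \<Longrightarrow> eps_word w = 0"
  and k_even: "odd (word_parity apar w) \<Longrightarrow> k_word t w = 0"
  and kinv_even: "odd (word_parity apar w) \<Longrightarrow> kinv_word t w = 0"
proof -
  have "eps_word w = 0 \<and> k_word t w = 0 \<and> kinv_word t w = 0" if "odd (word_parity apar w)"
    using that
  proof (induction w)
    case (Cons g w) then show ?case by (cases g) auto
  qed simp
  then show "odd (word_parity apar w) \<Longrightarrow> eps_word w = 0" "odd (word_parity apar w) \<Longrightarrow> k_word t w = 0"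
    "odd (word_parity apar w) \<Longrightarrow> kinv_word t w = 0" by auto
qed

lemma dw_odd: "even (word_parity apar w) \<Longrightarrow> dw t l m w = 0"
proof (induction w)
  case (Cons g w) then show ?case by (cases g) (auto simp: eps_even)
qed simp

lemma f_odd: "even (word_parity apar w) \<Longrightarrow> f_word t w = 0"
proof (induction w)
  case (Cons g w) then show ?case by (cases g) (auto simp: kinv_even f_gen_def)
qed simp

text \<open>All these functionals are homogeneous: they vanish on words of the wrong parity, so the
  Koszul signs in the recursions collapse to constants.\<close>

lemma eps_sign: "(-1) ^ word_parity apar z * eps_word z = eps_word z"
  "(-1) ^ word_parity apar z * k_word t z = k_word t z"
  "(-1) ^ word_parity apar z * kinv_word t z = kinv_word t z"
  "(-1) ^ word_parity apar z * dw t l m z = - dw t l m z"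
  "(-1) ^ word_parity apar z * f_word t z = - f_word t z"
  by (cases "even (word_parity apar z)"; simp add: eps_even k_even kinv_even dw_odd f_odd)+

lemma lext_mon_Cons: "lext (\<lambda>(z, v). \<psi> z \<cdot> mon (g # v)) D = gen g * lext (\<lambda>(z, v). \<psi> z \<cdot> mon v) D"
  and lext_mon_Cons': "lext (\<lambda>(z, v). \<psi>' z v \<cdot> mon (g # z)) D = gen g * lext (\<lambda>(z, v). \<psi>' z v \<cdot> mon z) D"
  by (simp_all add: lext_lin_fun[OF lin_mult_left] case_prod_beta' mon_Cons cs_mult)

lemma Ract_Cons: "Ract \<phi> (mon (g # w)) = (\<Sum>(x, y)\<leftarrow>coprod_pairs g.
     gen y * Ract (\<lambda>z. (-1) ^ (apar y * word_parity apar z) * \<phi> (x # z)) (mon w))"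
proof -
  have *: "(\<lambda>(z, v). c z v \<cdot> (case (x # z, y # v) of (v1, v2) \<Rightarrow> \<phi> v1 \<cdot> mon v2))
      = (\<lambda>(z, v). (c z v * \<phi> (x # z)) \<cdot> mon (y # v))" for c x y
    by (simp add: fun_eq_iff cs_cs cs_single mult_ac)
  show ?thesis
    unfolding Ract_def coprod_free_mon lext_coprod_Cons * lext_mon_Cons ..
qed

lemma Lact_Cons: "Lact p \<phi> (mon (g # w)) = (\<Sum>(x, y)\<leftarrow>coprod_pairs g.
     (-1) ^ (p * apar x) \<cdot> (gen x * Lact (p + apar y) (\<lambda>v. \<phi> (y # v)) (mon w)))"
proof -
  have *: "(\<lambda>(z, v). (-1) ^ (apar y * word_parity apar z) \<cdot>
        (case (x # z, y # v) of (v1, v2) \<Rightarrow> ((-1) ^ (p * word_parity apar v1) * \<phi> v2) \<cdot> mon v1))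
      = (\<lambda>(z, v). (-1) ^ (p * apar x) \<cdot> ((-1) ^ ((p + apar y) * word_parity apar z) * \<phi> (y # v)) \<cdot> mon (x # z))" for x y
    by (simp add: fun_eq_iff cs_cs cs_single mult_ac power_add distrib_left distrib_right)
  have **: "lext (\<lambda>(z, v). c \<cdot> f z v) D = c \<cdot> lext (\<lambda>(z, v). f z v) D" for c and f :: "agen list \<Rightarrow> agen list \<Rightarrow> agen free_alg" and D
    using lext_cs_fun[of c "\<lambda>(z, v). f z v" D] by (simp add: case_prod_beta')
  show ?thesis
    unfolding Lact_def coprod_free_mon lext_coprod_Cons * ** lext_mon_Cons' ..
qed

lemma Ract_Nil: "Ract \<phi> 1 = \<phi> [] \<cdot> 1"
  and Lact_Nil: "Lact p \<phi> 1 = \<phi> [] \<cdot> 1"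
  by (simp_all add: Ract_def Lact_def flip: mon_Nil)

lemma Ract_mult_fun: "Ract (\<lambda>z. c * \<phi> z) u = c \<cdot> Ract \<phi> u"
  and Ract_add_fun: "Ract (\<lambda>z. \<phi> z + \<psi> z) u = Ract \<phi> u + Ract \<psi> u"
  and Ract_uminus_fun: "Ract (\<lambda>z. - \<phi> z) u = - Ract \<phi> u"
  and Ract_0_fun: "Ract (\<lambda>z. 0) u = 0"
  by (simp_all add: Ract_def lext_def case_prod_beta' cs_sum cs_cs cs_add2 cs_add sum.distrib sum_negf
      cs_minus cs_minus_left cs_single distrib_left distrib_right single_add single_uminus mult_ac)

lemma Lact_mult_fun: "Lact p (\<lambda>z. c * \<phi> z) u = c \<cdot> Lact p \<phi> u"
  and Lact_add_fun: "Lact p (\<lambda>z. \<phi> z + \<psi> z) u = Lact p \<phi> u + Lact p \<psi> u"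
  and Lact_uminus_fun: "Lact p (\<lambda>z. - \<phi> z) u = - Lact p \<phi> u"
  and Lact_0_fun: "Lact p (\<lambda>z. 0) u = 0"
  by (simp_all add: Lact_def lext_def case_prod_beta' cs_sum cs_cs cs_add2 cs_add sum.distrib sum_negf
      cs_minus cs_minus_left cs_single distrib_left distrib_right single_add single_uminus mult_ac)

lemma sign_arith: "(-1) ^ n * (a + b) = (-1) ^ n * a + (-1) ^ n * b"
  "(-1) ^ n * (c * x) = c * ((-1) ^ n * x)" "(-1) ^ n * - (x::complex) = - ((-1) ^ n * x)" for a b c x :: complex
  by (simp_all add: distrib_left)

lemma Lact_Suc2: "Lact (Suc (Suc p)) = Lact p"
proof -
  have "(-1) ^ (Suc (Suc p) * n) = ((-1) ^ (p * n) :: complex)" for n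
    by (simp add: power_add flip: mult.assoc)
  then show ?thesis unfolding Lact_def by simp
qed

lemmas act_word_simps = Ract_Cons[unfolded mon_Cons] Lact_Cons[unfolded mon_Cons] mon_Cons eps_sign sign_arith Ract_mult_fun Ract_add_fun Ract_uminus_fun
  Ract_0_fun Lact_mult_fun Lact_add_fun Lact_uminus_fun Lact_0_fun Lact_Suc2

section \<open>The operators of the counit, of k and of the odd functionals\<close>

lemma Ract_eps: "Ract eps_word u = u"
proof (rule lin_ext[of "Ract eps_word"])
  fix w show "Ract eps_word (mon w) = mon w"
  proof (induction w)
    case (Cons g w) then show ?case by (cases g) (simp_all add: act_word_simps)
  qed (simp add: Ract_Nil mon_Nil)
qed (simp_all add: lin_id lin_Ract)

lemma Lact_eps: "Lact 0 eps_word u = u"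
proof (rule lin_ext[of "Lact 0 eps_word"])
  fix w show "Lact 0 eps_word (mon w) = mon w"
  proof (induction w)
    case (Cons g w) then show ?case by (cases g) (simp_all add: act_word_simps)
  qed (simp add: Lact_Nil mon_Nil)
qed (simp_all add: lin_id lin_Lact)

lemma Ract_k: "Ract (k_word t) u = diag (kR t) u"
proof (rule lin_ext[of "Ract (k_word t)"])
  fix w show "Ract (k_word t) (mon w) = diag (kR t) (mon w)"
  proof (induction w)
    case (Cons g w) then show ?case by (cases g) (simp_all add: act_word_simps diag_mult cs_mult)
  qed (simp add: Ract_Nil mon_Nil)
qed (simp_all add: lin_diag lin_Ract)

lemma Lact_k: "Lact 0 (k_word t) u = diag (kL t) u"
proof (rule lin_ext[of "Lact 0 (k_word t)"])
  fix w show "Lact 0 (k_word t) (mon w) = diag (kL t) (mon w)"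
  proof (induction w)
    case (Cons g w) then show ?case by (cases g) (simp_all add: act_word_simps diag_mult cs_mult)
  qed (simp add: Lact_Nil mon_Nil)
qed (simp_all add: lin_diag lin_Lact)

abbreviation kR' :: "complex \<Rightarrow> agen \<Rightarrow> complex" where
  "kR' t g \<equiv> inverse (kR t g)"

lemma Ract_kinv: "Ract (kinv_word t) u = diag (kR' t) u"
proof (rule lin_ext[of "Ract (kinv_word t)"])
  fix w show "Ract (kinv_word t) (mon w) = diag (kR' t) (mon w)"
  proof (induction w)
    case (Cons g w) then show ?case by (cases g) (simp_all add: act_word_simps diag_mult cs_mult)
  qed (simp add: Ract_Nil mon_Nil)
qed (simp_all add: lin_diag lin_Ract)

lemma Ract_dw: "Ract (dw t l m) u = DR t l m u"
proof (rule lin_ext[of "Ract (dw t l m)"])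
  fix w show "Ract (dw t l m) (mon w) = DR t l m (mon w)"
  proof (induction w)
    case (Cons g w) then show ?case
      by (cases g) (simp_all add: act_word_simps Ract_eps DR_def tder_Cons cs_mult cs_minus cs_minus_left)
  qed (simp add: Ract_Nil mon_Nil DR_def)
qed (simp_all add: lin_tder lin_Ract DR_def)

lemma Lact_dw: "Lact (Suc 0) (dw t l m) u = DL t l m u"
proof (rule lin_ext[of "Lact (Suc 0) (dw t l m)"])
  fix w show "Lact (Suc 0) (dw t l m) (mon w) = DL t l m (mon w)"
  proof (induction w)
    case (Cons g w) then show ?case
      by (cases g) (simp_all add: act_word_simps Lact_eps DL_def tder_Cons cs_mult cs_minus_left)
  qed (simp add: Lact_Nil mon_Nil DL_def)
qed (simp_all add: lin_tder lin_Lact DL_def)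

text \<open>The operator of f alone has k^-1 as right twist. In fk this cancels: its coproduct fk
  \<otimes> 1 + k \<otimes> fk has the same shape as that of e.\<close>

definition dF :: "agen \<Rightarrow> agen free_alg" where
  "dF g = (if g = Ac then gen Aa else if g = Ad then gen Ab else 0)"

lemma Ract_f: "Ract (f_word t) u = tder sg (kR' t) dF u"
proof (rule lin_ext[of "Ract (f_word t)"])
  fix w show "Ract (f_word t) (mon w) = tder sg (kR' t) dF (mon w)"
  proof (induction w)
    case (Cons g w) then show ?case
      by (cases g) (simp_all add: act_word_simps Ract_kinv tder_Cons cs_mult dF_def f_gen_def cs_minus_left)
  qed (simp add: Ract_Nil mon_Nil)
qed (simp_all add: lin_tder lin_Ract)

lemma e_word_dw: "e_word q t w = dw t ((t - inverse t) / (q - inverse q)) 0 w"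
  by (induction w) (auto simp: e_gen_def sg_def)

section \<open>The relations of U act trivially\<close>

primrec actU :: "complex \<Rightarrow> complex \<Rightarrow> ugen \<Rightarrow> agen free_alg \<Rightarrow> agen free_alg" where
  "actU q t UK = diag (kR t)"
| "actU q t UKinv = diag (kR' t)"
| "actU q t UE = DR t ((t - inverse t) / (q - inverse q)) 0"
| "actU q t UF = tder sg (kR' t) dF"

lemma Ract_pair_gen: "Ract (pair_gen q t x) u = actU q t x u"
proof -
  have "e_word q t = dw t ((t - inverse t) / (q - inverse q)) 0"
    by (rule ext) (rule e_word_dw)
  then show ?thesis
    by (cases x) (simp_all add: Ract_k Ract_kinv Ract_f Ract_dw)
qed

lemma lin_actU: "lin (actU q t x)"
  by (cases x) (simp_all add: DR_def lin_diag lin_tder)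

lemma lext_Ract: "lext \<psi> (Ract \<phi> u) = lext (\<lambda>(v1, v2). \<phi> v1 \<cdot> \<psi> v2) (coprod_free u)"
  by (simp add: Ract_def lext_lin_fun[OF lin_lext] case_prod_beta' cs_single)

lemma pair_word_Cons: "pair_word q t (x # xs) v = lext (pair_word q t xs) (actU q t x (mon v))"
  by (simp add: lext_Ract flip: Ract_pair_gen, simp add: lext_def case_prod_beta' mult_ac)

text \<open>The first letter acts first, since the right action reverses products. The factor
  \<open>s\<close> for each odd letter is 1 for the right action; for the left action it is the sign
  given by the parity of the tensor factor that is passed (\<open>L_free_x\<close>).\<close>

primrec opw :: "complex \<Rightarrow> complex \<Rightarrow> complex \<Rightarrow> ugen list \<Rightarrow> agen free_alg \<Rightarrow> agen free_alg" where
  "opw q t s [] u = u"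
| "opw q t s (x # xs) u = opw q t s xs (s ^ upar x \<cdot> actU q t x u)"

lemma lin_opw: "lin (opw q t s w)"
  by (induction w) (simp_all add: lin_id lin_def lsimps lin_simps[OF lin_actU] cs_add cs_cs mult.commute)

lemma opw_append: "opw q t s (v @ w) u = opw q t s w (opw q t s v u)"
  by (induction v arbitrary: u) simp_all

text \<open>The pairing is recovered from the right action by u(x) = \<epsilon>(R_u x). This
  replaces the coproduct recursion of \<open>pair_word\<close> by a composition of
  operators.\<close>

lemma pair_word_opw: "s ^ word_parity upar w * pair_word q t w v = chom eps_gen (opw q t s w (mon v))"
proof -
  have "lext (pair_word q t w) u * s ^ word_parity upar w = chom eps_gen (opw q t s w u)" for u
  proof (induction w arbitrary: u)
    case Nil
    have "pair_word q t [] = eps_word" by (rule ext) simp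
    then show ?case by (simp add: chom_def eps_word_def)
  next
    case (Cons x w)
    have "lext (pair_word q t (x # w)) u = lext (pair_word q t w) (actU q t x u)" for u
      by (rule lin_ext[of "lext (pair_word q t (x # w))"])
        (simp_all add: lin_def lsimps lin_simps[OF lin_actU] pair_word_Cons del: pair_word.simps)
    then show ?case
      using Cons[of "s ^ upar x \<cdot> actU q t x u"] by (simp add: lsimps power_add mult_ac del: pair_word.simps)
  qed
  from this[of "mon v"] show ?thesis by (simp add: mult.commute)
qed

definition opx :: "complex \<Rightarrow> complex \<Rightarrow> complex \<Rightarrow> ugen free_alg \<Rightarrow> agen free_alg \<Rightarrow> agen free_alg" where
  "opx q t s x u = lext (\<lambda>w. opw q t s w u) x"

lemma lin_opx: "lin (\<lambda>x. opx q t s x u)"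
  by (simp add: opx_def)

lemma lin_opx2: "lin (opx q t s x)"
  unfolding opx_def by (rule lin_arg_cs_fun) (rule lin_opw)

lemmas [lsimps] = lin_simps[OF lin_opx] lin_simps[OF lin_opx2]

lemma opx_mult: "opx q t s (x * y) u = opx q t s y (opx q t s x u)"
  by (rule lin_ext2[of "\<lambda>x y. opx q t s (x * y) u" "\<lambda>x y. opx q t s y (opx q t s x u)"])
    (simp_all add: lin_def lsimps algebra_simps cs_mult, simp add: opx_def opw_append single_mult)

lemma opx_gen: "opx q t s (gen x) u = s ^ upar x \<cdot> actU q t x u"
  by (simp add: opx_def gen_def)

lemma opx_1: "opx q t s 1 u = u"
  by (simp add: opx_def flip: mon_Nil)

text \<open>As products act in reverse order, kek^-1 = qe says K^-1 E K = q E for the operators;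
  hence the commutation with \<open>diag (kR' t)\<close> rather than with
  \<open>diag (kR t)\<close>.\<close>

lemma K_simps:
  assumes t: "t \<noteq> 0" "q = - t\<^sup>2"
  shows "diag (kR' t) (diag (kR t) u) = u" "diag (kR t) (diag (kR' t) u) = u"
    and "diag (kR' t) (actU q t UE u) = q \<cdot> actU q t UE (diag (kR' t) u)"
    and "diag (kR' t) (actU q t UF u) = inverse q \<cdot> actU q t UF (diag (kR' t) u)"
proof -
  have "kR t g \<noteq> 0" for g using t by (cases g) auto
  then show "diag (kR' t) (diag (kR t) u) = u" "diag (kR t) (diag (kR' t) u) = u"
    by (simp_all add: diag_diag)
  show "diag (kR' t) (actU q t UE u) = q \<cdot> actU q t UE (diag (kR' t) u)"
    unfolding actU.simps DR_def
    by (rule diag_tder, case_tac g) (use t in \<open>simp_all add: lsimps cs_cs power2_eq_square field_simps\<close>)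
  show "diag (kR' t) (actU q t UF u) = inverse q \<cdot> actU q t UF (diag (kR' t) u)"
    unfolding actU.simps
    by (rule diag_tder, case_tac g) (use t in \<open>simp_all add: dF_def lsimps cs_cs power2_eq_square field_simps\<close>)
qed

lemma actU_E_gen: "actU q t UE (gen g * u) = dR ((t - inverse t) / (q - inverse q)) 0 g * u
    + (sg g * kR t g) \<cdot> (gen g * actU q t UE u)"
  and actU_F_gen: "actU q t UF (gen g * u) = dF g * diag (kR' t) u + sg g \<cdot> (gen g * actU q t UF u)"
  by (simp_all add: DR_def tder_Cons)

lemmas lookup_linear = lookup_add lookup_minus lookup_uminus lookup_cs lookup_zero

lemma anticommutator:
  assumes t: "t \<noteq> 0" "q = - t\<^sup>2"
  shows "actU q t UF (actU q t UE u) + actU q t UE (actU q t UF u)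
    = (1 / (q - inverse q)) \<cdot> (diag (kR t) u - diag (kR' t) u)"
proof (rule lin_ext[of "\<lambda>u. actU q t UF (actU q t UE u) + actU q t UE (actU q t UF u)"])
  fix w
  show "actU q t UF (actU q t UE (mon w)) + actU q t UE (actU q t UF (mon w))
    = (1 / (q - inverse q)) \<cdot> (diag (kR t) (mon w) - diag (kR' t) (mon w))"
  proof (induction w)
    case Nil
    then show ?case by (simp add: mon_Nil lsimps DR_def)
  next
    case (Cons g w)
    \<comment> \<open>Treated as an arbitrary scalar: E is proportional to \<open>c\<close>, so both
      sides are, and no division by q - 1/q takes place.\<close>
    define c where "c = 1 / (q - inverse q)"
    have eps: "(t - inverse t) / (q - inverse q) = c * (t - inverse t)"
      by (simp add: c_def)
    have IH: "actU q t UE (actU q t UF (mon w))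
        = c \<cdot> (diag (kR t) (mon w) - diag (kR' t) (mon w)) - actU q t UF (actU q t UE (mon w))"
      using Cons by (simp add: c_def eq_diff_eq add.commute)
    have q: "q * inverse q = 1" "q \<noteq> 0" using t by auto
    show ?case
      unfolding c_def[symmetric]
      by (cases g; simp add: mon_Cons actU_E_gen actU_F_gen eps lin_simps[OF lin_actU] lsimps cs_mult dF_def
          diag_mult IH K_simps[OF t] del: actU.simps; rule poly_mapping_eqI;
          simp add: lookup_linear cs_add cs_diff cs_cs cs_mult ring_distribs t(1) q del: actU.simps;
          simp add: field_simps t power2_eq_square)
  qed
qed (simp_all add: lin_def lsimps lin_simps[OF lin_actU] cs_add cs_diff cs_cs mult.commute del: actU.simps)

text \<open>Since s^2 = 1, rescaling the odd generators by \<open>s\<close> respects the relations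
  of U; what remains is that the operators satisfy them in reverse order.\<close>

lemma opx_urels:
  assumes t: "t \<noteq> 0" "q = - t\<^sup>2" and s: "s\<^sup>2 = 1" and x: "x \<in> idl (urels q)"
  shows "opx q t s x u = 0"
  using x
proof (induction arbitrary: u rule: idl_induct)
  case (rel r)
  have K: "actU q t UK = diag (kR t)" "actU q t UKinv = diag (kR' t)" by simp_all
  have 4: "actU q t UF (actU q t UE u) = (1 / (q - inverse q)) \<cdot> (diag (kR t) u - diag (kR' t) u)
      - actU q t UE (actU q t UF u)" for u
    using anticommutator[OF t, of u] by (simp add: eq_diff_eq del: actU.simps)
  have "s * s = 1" using s by (simp add: power2_eq_square)
  with rel show ?case unfolding urels_def
    by (auto simp: const_mult lsimps opx_mult opx_gen opx_1 cs_cs K K_simps[OF t] 4 lin_simps[OF lin_actU] mult.commute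
       simp del: actU.simps)
qed (simp_all add: lsimps opx_mult)

section \<open>The pairing with x and its two actions on the free algebra\<close>

abbreviation x_rep :: "complex \<Rightarrow> complex \<Rightarrow> complex \<Rightarrow> ugen free_alg" where
  "x_rep \<alpha> \<beta> \<gamma> \<equiv> const \<alpha> * gen UE + const \<beta> * gen UF * gen UK + const \<gamma> * (gen UK - 1)"

definition TR :: "complex \<Rightarrow> complex \<Rightarrow> complex \<Rightarrow> complex \<Rightarrow> agen free_alg \<Rightarrow> agen free_alg" where
  "TR t l m \<gamma> u = DR t l m u + \<gamma> \<cdot> (diag (kR t) u - u)"

definition TL :: "complex \<Rightarrow> complex \<Rightarrow> complex \<Rightarrow> complex \<Rightarrow> agen free_alg \<Rightarrow> agen free_alg" where
  "TL t l m \<gamma> u = DL t l m u + \<gamma> \<cdot> (diag (kL t) u - u)"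

lemma chom_DR: "chom eps_gen (DR t l m (mon v)) = dw t l m v"
proof (induction v)
  case (Cons g v)
  have "chom eps_gen (mon v) = eps_word v" by (simp add: chom_def eps_word_def)
  with Cons show ?case by (cases g) (simp_all add: DR_def mon_Cons tder_Cons chom_simps)
qed (simp add: DR_def mon_Nil chom_simps)

lemma chom_k: "chom eps_gen (diag (kR t) u) = chom (k_gen t) u"
proof (rule lin_ext[of "\<lambda>u. chom eps_gen (diag (kR t) u)"])
  fix w
  have eq: "eps_gen g * kR t g = k_gen t g" for g by (cases g) auto
  show "chom eps_gen (diag (kR t) (mon w)) = chom (k_gen t) (mon w)"
    by (induction w) (simp_all add: mon_Nil mon_Cons diag_mult chom_simps mult_ac flip: eq)
qed (simp_all add: lin_def lsimps)

lemma chom_kinv: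
  assumes "t \<noteq> 0"
  shows "chom (k_gen t) (diag (kR' t) u) = chom eps_gen u"
proof (rule lin_ext[of "\<lambda>u. chom (k_gen t) (diag (kR' t) u)"])
  fix w
  have eq: "k_gen t g * kR' t g = eps_gen g" for g using assms by (cases g) auto
  show "chom (k_gen t) (diag (kR' t) (mon w)) = chom eps_gen (mon w)"
    by (induction w) (simp_all add: mon_Nil mon_Cons diag_mult chom_simps mult_ac flip: eq)
qed (simp_all add: lin_def lsimps)

text \<open>The value of fk at c is f(c) k(a) = t, the origin of the coefficient
  \<open>\<beta> * t\<close>. The right twist k^-1 of f is undone by k
  (\<open>chom_kinv\<close>).\<close>

lemma chom_kF:
  assumes "t \<noteq> 0"
  shows "chom (k_gen t) (tder sg (kR' t) dF (mon v)) = dw t 0 t v"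
proof (induction v)
  case (Cons g v)
  have "chom eps_gen (mon v) = eps_word v" by (simp add: chom_def eps_word_def)
  with Cons show ?case by (cases g) (simp_all add: mon_Cons tder_Cons chom_simps dF_def chom_kinv[OF assms])
qed (simp add: mon_Nil chom_simps)

lemma dw_cs: "dw t (x * l) (x * m) v = x * dw t l m v"
  and dw_add: "dw t (l + l') (m + m') v = dw t l m v + dw t l' m' v"
  by (induction v) (simp_all add: algebra_simps)

text \<open>Any representative of x may be replaced by \<open>x_rep\<close>, because the ideal of U
  acts by zero. The general sign \<open>s\<close> lets one computation serve both actions.\<close>

lemma pair_x_rep:
  assumes t: "t \<noteq> 0" "q = - t\<^sup>2" and s: "s\<^sup>2 = 1" and x: "cong (urels q) x (x_rep \<alpha> \<beta> \<gamma>)"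
  shows "lext (\<lambda>w. s ^ word_parity upar w * pair_word q t w v) x
    = s * dw t (\<alpha> * ((t - inverse t) / (q - inverse q))) (\<beta> * t) v + \<gamma> * (k_word t v - eps_word v)"
proof -
  let ?e = "(t - inverse t) / (q - inverse q)"
  have K: "chom (k_gen t) (mon v) = k_word t v" "chom eps_gen (mon v) = eps_word v"
    by (simp_all add: chom_mon eps_word_def k_word_def)
  have "lext (\<lambda>w. s ^ word_parity upar w * pair_word q t w v) x = chom eps_gen (opx q t s x (mon v))"
    by (simp add: pair_word_opw opx_def lext_lin_fun[OF lin_chom])
  also have "opx q t s x (mon v) = opx q t s (x_rep \<alpha> \<beta> \<gamma>) (mon v)"
    using opx_urels[OF t s, of "x - x_rep \<alpha> \<beta> \<gamma>" "mon v"] x by (simp add: cong_def lsimps)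
  also have "chom eps_gen \<dots> = s * (\<alpha> * dw t ?e 0 v + \<beta> * dw t 0 t v) + \<gamma> * (k_word t v - eps_word v)"
    by (simp add: const_mult cs_mult lsimps opx_mult opx_gen opx_1 chom_DR chom_k chom_kF t(1) K
        lin_simps[OF lin_tder] del: times_divide_eq_right; simp add: algebra_simps)
  also have "\<alpha> * dw t ?e 0 v + \<beta> * dw t 0 t v = dw t (\<alpha> * ?e) (\<beta> * t) v"
    using dw_add[of t "\<alpha> * ?e" 0 0 "\<beta> * t" v] dw_cs[of t \<alpha> ?e 0 v] dw_cs[of t \<beta> 0 t v] by simp
  finally show ?thesis by simp
qed

lemma lext_swap: "lext (\<lambda>w. lext (\<lambda>p. \<phi> w p \<cdot> \<psi> p) D) x = lext (\<lambda>p. lext (\<lambda>w. \<phi> w p) x \<cdot> \<psi> p) D"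
  for \<phi> :: "_ \<Rightarrow> _ \<Rightarrow> complex"
proof (rule lin_ext[of "\<lambda>x. lext (\<lambda>w. lext (\<lambda>p. \<phi> w p \<cdot> \<psi> p) D) x"])
  show "lin (\<lambda>x. lext (\<lambda>p. lext (\<lambda>w. \<phi> w p) x \<cdot> \<psi> p) D)"
    by (rule lin_arg_cs_fun) (simp add: lin_def lsimps cs_add2 cs_cs)
qed simp_all

text \<open>An exact identity in the free algebra for every representative of x; dependence on the
  representative has already disappeared in the pairing.\<close>

lemma R_free_x:
  assumes t: "t \<noteq> 0" "q = - t\<^sup>2" and x: "cong (urels q) x (x_rep \<alpha> \<beta> \<gamma>)"
  shows "R_free q t x u = TR t (\<alpha> * ((t - inverse t) / (q - inverse q))) (\<beta> * t) \<gamma> u"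
proof -
  let ?l = "\<alpha> * ((t - inverse t) / (q - inverse q))"
  have "R_free q t x u = lext (\<lambda>w. lext (\<lambda>p. pair_word q t w (fst p) \<cdot> mon (snd p)) (coprod_free u)) x"
    by (simp add: R_free_def lext_def case_prod_beta' cs_sum cs_single cs_cs mult_ac)
  also have "\<dots> = Ract (\<lambda>v. lext (\<lambda>w. pair_word q t w v) x) u"
    unfolding lext_swap Ract_def by (simp add: case_prod_beta')
  also have "\<dots> = Ract (\<lambda>v. dw t ?l (\<beta> * t) v + (\<gamma> * k_word t v + (- \<gamma>) * eps_word v)) u"
  proof -
    have "lext (\<lambda>w. pair_word q t w v) x = dw t ?l (\<beta> * t) v + (\<gamma> * k_word t v + (- \<gamma>) * eps_word v)" for v
      using pair_x_rep[OF t _ x, of 1 v] by (simp add: right_diff_distrib)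
    then show ?thesis by simp
  qed
  also have "\<dots> = TR t ?l (\<beta> * t) \<gamma> u"
    unfolding Ract_add_fun Ract_mult_fun Ract_dw Ract_k Ract_eps by (simp add: TR_def cs_minus_left cs_diff)
  finally show ?thesis .
qed

lemma L_free_x:
  assumes t: "t \<noteq> 0" "q = - t\<^sup>2" and x: "cong (urels q) x (x_rep \<alpha> \<beta> \<gamma>)"
  shows "L_free q t x u = TL t (\<alpha> * ((t - inverse t) / (q - inverse q))) (\<beta> * t) \<gamma> u"
proof -
  let ?l = "\<alpha> * ((t - inverse t) / (q - inverse q))"
  \<comment> \<open>In each term of the coproduct the sign of \<open>L_free\<close> is a power of
    this fixed square root of 1, with the parity of the word in U as exponent.\<close>
  let ?s = "\<lambda>p. (-1) ^ word_parity apar (fst p) :: complex"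
  have "L_free q t x u = lext (\<lambda>w. lext (\<lambda>p. (?s p ^ word_parity upar w * pair_word q t w (snd p)) \<cdot> mon (fst p))
      (coprod_free u)) x"
    by (simp add: L_free_def lext_def case_prod_beta' cs_sum cs_single cs_cs mult_ac flip: power_mult)
  also have "\<dots> = lext (\<lambda>p. (?s p * dw t ?l (\<beta> * t) (snd p) + (\<gamma> * k_word t (snd p) + (- \<gamma>) * eps_word (snd p)))
      \<cdot> mon (fst p)) (coprod_free u)"
    unfolding lext_swap
  proof -
    have sq: "(?s p)\<^sup>2 = 1" for p :: "agen list \<times> agen list" by (simp flip: power_mult)
    have "lext (\<lambda>w. ?s p ^ word_parity upar w * pair_word q t w (snd p)) x
      = ?s p * dw t ?l (\<beta> * t) (snd p) + (\<gamma> * k_word t (snd p) + - \<gamma> * eps_word (snd p))" for p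
      using pair_x_rep[OF t sq[of p] x, of "snd p"] by (simp add: right_diff_distrib)
    then show "lext (\<lambda>p. lext (\<lambda>w. ?s p ^ word_parity upar w * pair_word q t w (snd p)) x \<cdot> mon (fst p)) (coprod_free u) =
      lext (\<lambda>p. (?s p * dw t ?l (\<beta> * t) (snd p) + (\<gamma> * k_word t (snd p) + - \<gamma> * eps_word (snd p))) \<cdot> mon (fst p)) (coprod_free u)"
      by presburger
  qed
  also have "\<dots> = Lact (Suc 0) (dw t ?l (\<beta> * t)) u + Lact 0 (\<lambda>v. \<gamma> * k_word t v + (- \<gamma>) * eps_word v) u"
    by (simp add: Lact_def case_prod_beta' cs_add2 lext_add_fun)
  also have "\<dots> = TL t ?l (\<beta> * t) \<gamma> u"
    unfolding Lact_add_fun Lact_mult_fun Lact_dw Lact_k Lact_eps by (simp add: TL_def cs_minus_left cs_diff)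
  finally show ?thesis .
qed

lemma ucounit_cls:
  assumes "chom ucounit_gen x = z"
  shows "ucounit (cls (urels q) x) = z"
proof -
  have *: "ucounit X = the_elem (chom ucounit_gen ` X)" for X
    by (simp add: ucounit_def chom_def lext_def)
  have 0: "chom ucounit_gen r = 0" if "r \<in> urels q" for r
    using that by (auto simp: urels_def chom_simps const_mult)
  show ?thesis
    unfolding *
  proof (rule the_elem_const)
    fix y assume "y \<in> cls (urels q) x"
    then have "y - x \<in> idl (urels q)" by (simp add: mem_cls cong_def)
    from chom_idl[OF this 0] show "chom ucounit_gen y = z" using assms by (simp add: lsimps)
  next
    have "x \<in> cls (urels q) x" by (simp add: mem_cls)
    then show "cls (urels q) x \<noteq> {}" by blast
  qed
qed

section \<open>A basis of A\<close>

text \<open>\<open>(i, j, k, s)\<close> stands for \<open>a\<^sup>i b\<^sup>j c\<^sup>k \<sigma>\<^sup>s\<close>, with \<open>d\<^sup>-\<^sup>i\<close> in place of \<open>a\<^sup>i\<close> for negative \<open>i\<close>.\<close>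

type_synonym key = "int \<times> nat \<times> nat \<times> bool"

abbreviation bs :: "key \<Rightarrow> (key \<Rightarrow>\<^sub>0 complex)" where
  "bs n \<equiv> single n 1"

text \<open>The scalar in b y = \<open>bt t i\<close> y b for y = \<open>pw i\<close>, and likewise
  for c (\<open>qc_pw\<close>).\<close>

definition bt :: "complex \<Rightarrow> int \<Rightarrow> complex" where
  "bt t i = (if i \<ge> 0 then inverse t ^ nat i else (- t) ^ nat (- i))"

text \<open>What left multiplication by a generator has to do to the candidate basis. Where a meets
  d, the product is replaced by ad = \<sigma> - t bc or da = \<sigma> - t^-1 bc, and \<sigma>, b, c
  are moved to their places; b and c together give the squared \<open>bt\<close>. That the relations
  are respected is \<open>actF_arels\<close>.\<close>

fun act :: "complex \<Rightarrow> agen \<Rightarrow> key \<Rightarrow> (key \<Rightarrow>\<^sub>0 complex)" where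
  "act t Aa (i, j, k, s) = (if i \<ge> 0 then bs (i + 1, j, k, s)
     else (-1) ^ (j + k) \<cdot> bs (i + 1, j, k, \<not> s)
        - (t * (-1) ^ j * (bt t (i + 1))\<^sup>2) \<cdot> bs (i + 1, Suc j, Suc k, s))"
| "act t Ab (i, j, k, s) = bt t i \<cdot> bs (i, Suc j, k, s)"
| "act t Ac (i, j, k, s) = ((-1) ^ j * bt t i) \<cdot> bs (i, j, Suc k, s)"
| "act t Ad (i, j, k, s) = (if i \<le> 0 then bs (i - 1, j, k, s)
     else (-1) ^ (j + k) \<cdot> bs (i - 1, j, k, \<not> s)
        - (inverse t * (-1) ^ j * (bt t (i - 1))\<^sup>2) \<cdot> bs (i - 1, Suc j, Suc k, s))"
| "act t Asigma (i, j, k, s) = (-1) ^ (j + k) \<cdot> bs (i, j, k, \<not> s)"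

primrec actw :: "complex \<Rightarrow> agen list \<Rightarrow> (key \<Rightarrow>\<^sub>0 complex) \<Rightarrow> (key \<Rightarrow>\<^sub>0 complex)" where
  "actw t [] v = v"
| "actw t (g # w) v = lext (act t g) (actw t w v)"

definition actF :: "complex \<Rightarrow> agen free_alg \<Rightarrow> (key \<Rightarrow>\<^sub>0 complex) \<Rightarrow> (key \<Rightarrow>\<^sub>0 complex)" where
  "actF t x v = lext (\<lambda>w. actw t w v) x"

lemma lin_actw: "lin (actw t w)"
  by (induction w) (simp_all add: lin_def lsimps)

lemma lin_actF: "lin (\<lambda>x. actF t x v)"
  by (simp add: actF_def)

lemma lin_actF2: "lin (actF t x)"
  unfolding actF_def by (rule lin_arg_cs_fun) (rule lin_actw)

lemmas [lsimps] = lin_simps[OF lin_actw] lin_simps[OF lin_actF] lin_simps[OF lin_actF2]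

lemma actw_append: "actw t (v @ w) x = actw t v (actw t w x)"
  by (induction v) simp_all

lemma actF_mult: "actF t (x * y) v = actF t x (actF t y v)"
  by (rule lin_ext2[of "\<lambda>x y. actF t (x * y) v" "\<lambda>x y. actF t x (actF t y v)"])
    (simp_all add: lin_def lsimps algebra_simps cs_mult, simp add: actF_def actw_append single_mult)

lemma actF_gen: "actF t (gen g) v = lext (act t g) v"
  by (simp add: actF_def gen_def)

lemma actF_1: "actF t 1 v = v"
  by (simp add: actF_def flip: mon_Nil)

lemma bt_simps: "bt t 0 = 1"
  "i \<ge> 0 \<Longrightarrow> bt t (i + 1) = inverse t * bt t i"
  "i < 0 \<Longrightarrow> bt t i = - t * bt t (i + 1)"
  "i > 0 \<Longrightarrow> bt t i = inverse t * bt t (i - 1)"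
  "i \<le> 0 \<Longrightarrow> bt t (i - 1) = - t * bt t i"
proof -
  show "bt t 0 = 1" by (simp add: bt_def)
  show "i \<ge> 0 \<Longrightarrow> bt t (i + 1) = inverse t * bt t i" by (simp add: bt_def nat_add_distrib)
  show "i > 0 \<Longrightarrow> bt t i = inverse t * bt t (i - 1)"
    by (simp add: bt_def) (metis Suc_nat_eq_nat_zadd1 add.commute diff_add_cancel diff_ge_0_iff_ge
        int_one_le_iff_zero_less power_Suc)
  have *: "bt t i = - t * bt t (i + 1)" if "i < 0" for i
  proof -
    have "nat (- i) = Suc (nat (- (i + 1)))" using that by linarith
    then show ?thesis using that by (cases "i = -1") (auto simp: bt_def)
  qed
  then show "i < 0 \<Longrightarrow> bt t i = - t * bt t (i + 1)" .
  show "i \<le> 0 \<Longrightarrow> bt t (i - 1) = - t * bt t i" using *[of "i - 1"] by simp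
qed

lemma arels_all:
  assumes "P (gen Aa * gen Ab - t \<cdot> (gen Ab * gen Aa))"
    "P (gen Aa * gen Ac - t \<cdot> (gen Ac * gen Aa))"
    "P (gen Ab * gen Ac + gen Ac * gen Ab)"
    "P (gen Ab * gen Ad + t \<cdot> (gen Ad * gen Ab))"
    "P (gen Ac * gen Ad + t \<cdot> (gen Ad * gen Ac))"
    "P (gen Aa * gen Ad - gen Ad * gen Aa - (inverse t - t) \<cdot> (gen Ab * gen Ac))"
    "P (gen Aa * gen Ad + t \<cdot> (gen Ab * gen Ac) - gen Asigma)"
    "P (gen Asigma * gen Asigma - 1)"
    "r \<in> arels t"
  shows "P r"
  using assms unfolding arels_def const_mult cs_mult_left by blast

lemma arels_mem:
  "gen Aa * gen Ab - t \<cdot> (gen Ab * gen Aa) \<in> arels t"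
  "gen Aa * gen Ac - t \<cdot> (gen Ac * gen Aa) \<in> arels t"
  "gen Ab * gen Ac + gen Ac * gen Ab \<in> arels t"
  "gen Ab * gen Ad + t \<cdot> (gen Ad * gen Ab) \<in> arels t"
  "gen Ac * gen Ad + t \<cdot> (gen Ad * gen Ac) \<in> arels t"
  "gen Aa * gen Ad - gen Ad * gen Aa - (inverse t - t) \<cdot> (gen Ab * gen Ac) \<in> arels t"
  "gen Aa * gen Ad + t \<cdot> (gen Ab * gen Ac) - gen Asigma \<in> arels t"
  "gen Asigma * gen Asigma - 1 \<in> arels t"
  unfolding arels_def const_mult cs_mult_left by blast+

lemma actF_arels:
  assumes t: "t \<noteq> 0" and "r \<in> arels t"
  shows "actF t r v = 0"
proof (rule lin_ext[of "actF t r" "\<lambda>v. 0"])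
  fix n :: key
  obtain i j k s where n: "n = (i, j, k, s)" by (cases n)
  \<comment> \<open>The branches of \<open>act\<close> change at i = 0, and no relation moves i by
    more than one.\<close>
  consider "i > 0" | "i = 0" | "i = -1" | "i < -1" by linarith
  then show "actF t r (bs n) = 0"
    unfolding n
    by (cases; intro arels_all[OF _ _ _ _ _ _ _ _ assms(2), of "\<lambda>r. actF t r (bs (i, j, k, s)) = 0"];
      simp add: lsimps actF_mult actF_gen actF_1 cs_cs bt_simps t cs_diff;
      (rule poly_mapping_eqI; simp add: lookup_linear lookup_single when_def power2_eq_square field_simps t)?)
qed (simp_all add: lin_actF2 lin_const0)

section \<open>Commutation up to scalars in A\<close>

definition qc :: "complex \<Rightarrow> complex \<Rightarrow> agen free_alg \<Rightarrow> agen free_alg \<Rightarrow> bool" where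
  "qc t z x y \<longleftrightarrow> acong t (x * y) (z \<cdot> (y * x))"

lemma qc_mult_left:
  assumes "qc t z x y" "qc t w x' y"
  shows "qc t (z * w) (x * x') y"
proof -
  have "acong t (x * (x' * y)) (x * (w \<cdot> (y * x')))"
    using assms(2) by (simp add: qc_def cong_mult_left)
  also have "x * (w \<cdot> (y * x')) = w \<cdot> (x * y * x')" by (simp add: cs_mult mult.assoc)
  also have "acong t \<dots> (w \<cdot> ((z \<cdot> (y * x)) * x'))"
    using assms(1) by (simp add: qc_def cong_mult_right cong_cs)
  finally show ?thesis by (simp add: qc_def cs_mult cs_cs mult.assoc mult.commute[of z])
qed

lemma qc_mult_right:
  assumes "qc t z x y" "qc t w x y'"
  shows "qc t (z * w) x (y * y')"
proof -
  have "acong t (x * y * y') ((z \<cdot> (y * x)) * y')"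
    using assms(1) by (simp add: qc_def cong_mult_right)
  also have "(z \<cdot> (y * x)) * y' = z \<cdot> (y * (x * y'))" by (simp add: cs_mult mult.assoc)
  also have "acong t \<dots> (z \<cdot> (y * (w \<cdot> (y' * x))))"
    using assms(2) by (simp add: qc_def cong_mult_left cong_cs)
  finally show ?thesis by (simp add: qc_def cs_mult cs_cs mult.assoc)
qed

lemma qc_add_left:
  assumes "qc t z x y" "qc t z x' y"
  shows "qc t z (x + x') y"
proof -
  have "acong t (x * y + x' * y) (z \<cdot> (y * x) + z \<cdot> (y * x'))"
    using assms unfolding qc_def by (rule cong_add)
  then show ?thesis by (simp add: qc_def distrib_left distrib_right cs_add)
qed

lemma qc_cs_left: "qc t z x y \<Longrightarrow> qc t z (w \<cdot> x) y"
  unfolding qc_def using cong_cs[of "arels t" "x * y" "z \<cdot> (y * x)" w]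
  by (simp add: cs_mult cs_cs mult.commute)

lemma qc_cong_left:
  assumes "acong t x' x" "qc t z x y"
  shows "qc t z x' y"
proof -
  have "acong t (x' * y) (x * y)" using assms(1) by (rule cong_mult_right)
  also have "acong t \<dots> (z \<cdot> (y * x))" using assms(2) by (simp add: qc_def)
  also have "acong t \<dots> (z \<cdot> (y * x'))"
    by (intro cong_cs cong_mult_left cong_sym[OF assms(1)])
  finally show ?thesis by (simp add: qc_def)
qed

lemma qc_pow_right: "qc t z x y \<Longrightarrow> qc t (z ^ n) x (y ^ n)"
  by (induction n) (simp_all add: qc_mult_right, simp add: qc_def)

lemma qc_self: "qc t 1 x x"
  by (simp add: qc_def)

lemma qc_swap: "qc t z x y \<Longrightarrow> z * w = 1 \<Longrightarrow> qc t w y x"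
  unfolding qc_def
  by (drule cong_cs[of _ _ _ w], drule cong_sym) (simp add: cs_cs mult.commute)

lemma qc_move: "qc t z x y \<Longrightarrow> acong t (x * (y * r)) (z \<cdot> (y * (x * r)))"
  unfolding qc_def using cong_mult_right[of "arels t" "x * y" "z \<cdot> (y * x)" r]
  by (simp add: cs_mult mult.assoc)

lemma relI: "x - y \<in> arels t \<Longrightarrow> acong t x y"
  unfolding cong_def by (rule idl_rel)

lemma A_cong:
  assumes t: "t \<noteq> 0"
  shows qc_ab: "qc t t (gen Aa) (gen Ab)" and qc_ac: "qc t t (gen Aa) (gen Ac)"
    and qc_bc: "qc t (-1) (gen Ab) (gen Ac)" and qc_bd: "qc t (- t) (gen Ab) (gen Ad)"
    and qc_cd: "qc t (- t) (gen Ac) (gen Ad)"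
    and cong_ad: "acong t (gen Aa * gen Ad) (gen Asigma - t \<cdot> (gen Ab * gen Ac))"
    and cong_da: "acong t (gen Ad * gen Aa) (gen Asigma - inverse t \<cdot> (gen Ab * gen Ac))"
    and cong_ss: "acong t (gen Asigma * gen Asigma) 1"
    and cong_s: "acong t (gen Asigma) (gen Aa * gen Ad + t \<cdot> (gen Ab * gen Ac))"
proof -
  note m = arels_mem[of t]
  show "qc t t (gen Aa) (gen Ab)" "qc t t (gen Aa) (gen Ac)" "qc t (-1) (gen Ab) (gen Ac)"
    "qc t (- t) (gen Ab) (gen Ad)" "qc t (- t) (gen Ac) (gen Ad)"
    unfolding qc_def by (rule relI; use m in \<open>simp add: cs_minus_left\<close>)+
  have 6: "acong t (gen Aa * gen Ad - (inverse t - t) \<cdot> (gen Ab * gen Ac)) (gen Ad * gen Aa)"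
    using m(6) by (intro relI) (simp add: algebra_simps)
  have 7: "acong t (gen Aa * gen Ad) (gen Asigma - t \<cdot> (gen Ab * gen Ac))"
    using m(7) by (intro relI) (simp add: algebra_simps)
  have "acong t (gen Ad * gen Aa) (gen Aa * gen Ad - (inverse t - t) \<cdot> (gen Ab * gen Ac))"
    using 6 by (rule cong_sym)
  also have "acong t \<dots> (gen Asigma - t \<cdot> (gen Ab * gen Ac) - (inverse t - t) \<cdot> (gen Ab * gen Ac))"
    by (intro cong_diff 7 cong_refl)
  also have "\<dots> = gen Asigma - inverse t \<cdot> (gen Ab * gen Ac)"
    using cs_add2[of "t" "inverse t - t" "gen Ab * gen Ac"] by (simp add: algebra_simps)
  finally show "acong t (gen Ad * gen Aa) (gen Asigma - inverse t \<cdot> (gen Ab * gen Ac))" .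
  show "acong t (gen Aa * gen Ad) (gen Asigma - t \<cdot> (gen Ab * gen Ac))" by (fact 7)
  show "acong t (gen Asigma * gen Asigma) 1" by (rule relI) (rule m(8))
  show "acong t (gen Asigma) (gen Aa * gen Ad + t \<cdot> (gen Ab * gen Ac))"
    by (rule cong_sym, rule relI) (rule m(7))
qed

text \<open>These rules are not among the relations but follow from \<sigma> = ad + t bc. Both
  summands anticommute with b and c; for a and d the two forms of \<sigma>, through ad and through
  da, are played against each other.\<close>

lemma qc_sigma:
  assumes t: "t \<noteq> 0"
  shows qc_sb: "qc t (-1) (gen Asigma) (gen Ab)" and qc_sc: "qc t (-1) (gen Asigma) (gen Ac)"
    and qc_sa: "qc t 1 (gen Asigma) (gen Aa)" and qc_sd: "qc t 1 (gen Asigma) (gen Ad)"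
proof -
  note [simp] = t
  note c = A_cong[OF t]
  have db: "qc t (- inverse t) (gen Ad) (gen Ab)" and dc: "qc t (- inverse t) (gen Ad) (gen Ac)"
    and ba: "qc t (inverse t) (gen Ab) (gen Aa)" and ca: "qc t (inverse t) (gen Ac) (gen Aa)"
    and cb: "qc t (-1) (gen Ac) (gen Ab)"
    using c by (auto elim!: qc_swap)
  have "qc t (t * (- inverse t)) (gen Aa * gen Ad) (gen Ab)" by (rule qc_mult_left[OF c(1) db])
  moreover have "qc t (1 * -1) (gen Ab * gen Ac) (gen Ab)" by (rule qc_mult_left[OF qc_self cb])
  ultimately have "qc t (-1) (gen Aa * gen Ad + t \<cdot> (gen Ab * gen Ac)) (gen Ab)"
    by (simp add: qc_add_left qc_cs_left)
  then show "qc t (-1) (gen Asigma) (gen Ab)" by (rule qc_cong_left[OF c(9)])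
  have "qc t (t * (- inverse t)) (gen Aa * gen Ad) (gen Ac)" by (rule qc_mult_left[OF c(2) dc])
  moreover have "qc t (-1 * 1) (gen Ab * gen Ac) (gen Ac)" by (rule qc_mult_left[OF c(3) qc_self])
  ultimately have "qc t (-1) (gen Aa * gen Ad + t \<cdot> (gen Ab * gen Ac)) (gen Ac)"
    by (simp add: qc_add_left qc_cs_left)
  then show "qc t (-1) (gen Asigma) (gen Ac)" by (rule qc_cong_left[OF c(9)])
  let ?bc = "gen Ab * gen Ac"
  have bca: "acong t (?bc * gen Aa) ((inverse t * inverse t) \<cdot> (gen Aa * ?bc))"
    using qc_mult_left[OF ba ca] by (simp add: qc_def)
  have "acong t (gen Asigma * gen Aa) ((gen Aa * gen Ad + t \<cdot> ?bc) * gen Aa)"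
    by (rule cong_mult_right[OF c(9)])
  also have "\<dots> = gen Aa * (gen Ad * gen Aa) + t \<cdot> (?bc * gen Aa)"
    by (simp add: distrib_right cs_mult mult.assoc)
  also have "acong t \<dots> (gen Aa * (gen Asigma - inverse t \<cdot> ?bc)
      + t \<cdot> ((inverse t * inverse t) \<cdot> (gen Aa * ?bc)))"
    by (intro cong_add cong_mult_left cong_cs c(7) bca)
  also have "\<dots> = gen Aa * gen Asigma"
    using right_inverse[OF t] by (simp add: right_diff_distrib cs_mult cs_cs flip: mult.assoc)
  finally show "qc t 1 (gen Asigma) (gen Aa)" by (simp add: qc_def)
  have bcd: "acong t (?bc * gen Ad) ((t * t) \<cdot> (gen Ad * ?bc))"
    using qc_mult_left[OF c(4) c(5)] by (simp add: qc_def)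
  have "acong t (gen Asigma) (gen Ad * gen Aa + inverse t \<cdot> ?bc)"
    using cong_add[OF c(7) cong_refl, of "inverse t \<cdot> ?bc"] by (simp add: cong_sym)
  then have "acong t (gen Asigma * gen Ad) ((gen Ad * gen Aa + inverse t \<cdot> ?bc) * gen Ad)"
    by (rule cong_mult_right)
  also have "\<dots> = gen Ad * (gen Aa * gen Ad) + inverse t \<cdot> (?bc * gen Ad)"
    by (simp add: distrib_right cs_mult mult.assoc)
  also have "acong t \<dots> (gen Ad * (gen Asigma - t \<cdot> ?bc) + inverse t \<cdot> ((t * t) \<cdot> (gen Ad * ?bc)))"
    by (intro cong_add cong_mult_left cong_cs c(6) bcd)
  also have "\<dots> = gen Ad * gen Asigma"
    using left_inverse[OF t] by (simp add: right_diff_distrib cs_mult cs_cs flip: mult.assoc)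
  finally show "qc t 1 (gen Asigma) (gen Ad)" by (simp add: qc_def)
qed

definition pw :: "int \<Rightarrow> agen free_alg" where
  "pw i = (if i \<ge> 0 then gen Aa ^ nat i else gen Ad ^ nat (- i))"

definition sw :: "bool \<Rightarrow> agen free_alg" where
  "sw s = (if s then gen Asigma else 1)"

fun nw :: "key \<Rightarrow> agen free_alg" where
  "nw (i, j, k, s) = pw i * (gen Ab ^ j * (gen Ac ^ k * sw s))"

lemma qc_pw:
  assumes t: "t \<noteq> 0"
  shows "qc t (bt t i) (gen Ab) (pw i)" "qc t (bt t i) (gen Ac) (pw i)" "qc t 1 (gen Asigma) (pw i)"
proof -
  have "qc t (inverse t) (gen Ab) (gen Aa)" "qc t (inverse t) (gen Ac) (gen Aa)"
    using A_cong(1,2)[OF t] t by (auto elim!: qc_swap)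
  then show "qc t (bt t i) (gen Ab) (pw i)" "qc t (bt t i) (gen Ac) (pw i)"
    using A_cong(4,5)[OF t] by (auto simp: bt_def pw_def intro: qc_pow_right)
  show "qc t 1 (gen Asigma) (pw i)"
    using qc_pow_right[OF qc_sa[OF t], of "nat i"] qc_pow_right[OF qc_sd[OF t], of "nat (- i)"]
    by (auto simp: pw_def)
qed

definition realz :: "(key \<Rightarrow>\<^sub>0 complex) \<Rightarrow> agen free_alg" where
  "realz = lext nw"

lemma lin_realz: "lin realz"
  by (simp add: realz_def)

lemma realz_bs [simp]: "realz (bs n) = nw n"
  by (simp add: realz_def)

lemmas [lsimps] = lin_simps[OF lin_realz]

lemma lext_idl:
  assumes "\<And>k. \<phi> k \<in> idl rels"
  shows "lext \<phi> x \<in> idl rels"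
  unfolding lext_def using assms by (intro idl_sum idl_cs)

lemma lin_cong:
  fixes f g :: "('k \<Rightarrow>\<^sub>0 complex) \<Rightarrow> 'g free_alg"
  assumes "lin f" "lin g" "\<And>k. cong rels (f (single k 1)) (g (single k 1))"
  shows "cong rels (f x) (g x)"
proof -
  have "f x - g x = lext (\<lambda>k. f (single k 1) - g (single k 1)) x"
    by (rule lin_ext[of "\<lambda>x. f x - g x"]) (simp_all add: lin_sub[OF assms(1,2)])
  then show ?thesis
    using lext_idl[of "\<lambda>k. f (single k 1) - g (single k 1)" rels x] assms(3)
    by (simp add: cong_def)
qed

lemma pw_up: "i \<ge> 0 \<Longrightarrow> gen Aa * pw i = pw (i + 1)"
  and pw_down: "i \<le> 0 \<Longrightarrow> gen Ad * pw i = pw (i - 1)"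
proof -
  show "i \<ge> 0 \<Longrightarrow> gen Aa * pw i = pw (i + 1)" by (simp add: pw_def nat_add_distrib)
  assume "i \<le> 0"
  then have "nat (- (i - 1)) = Suc (nat (- i))" by linarith
  then show "gen Ad * pw i = pw (i - 1)" using \<open>i \<le> 0\<close> by (auto simp: pw_def)
qed

text \<open>The spanning half of the basis property: in A the formal action is genuine left
  multiplication, so every word reduces to normal words.\<close>

lemma realz_act:
  assumes t: "t \<noteq> 0"
  shows "acong t (gen g * realz v) (realz (lext (act t g) v))"
proof -
  have b: "acong t (gen Ab * nw n) (realz (act t Ab n))" for n
  proof -
    obtain i j k s where n: "n = (i, j, k, s)" by (cases n)
    show ?thesis unfolding n using qc_move[OF qc_pw(1)[OF t], of i "gen Ab ^ j * (gen Ac ^ k * sw s)"]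
      by (simp add: lsimps mult.assoc)
  qed
  have c: "acong t (gen Ac * nw n) (realz (act t Ac n))" for n
  proof -
    obtain i j k s where n: "n = (i, j, k, s)" by (cases n)
    let ?r = "gen Ac ^ k * sw s"
    have cb: "qc t (-1) (gen Ac) (gen Ab)" using A_cong(3)[OF t] by (auto elim!: qc_swap)
    have "acong t (gen Ac * nw n) (bt t i \<cdot> (pw i * (gen Ac * (gen Ab ^ j * ?r))))"
      unfolding n using qc_move[OF qc_pw(2)[OF t]] by simp
    also have "acong t \<dots> (bt t i \<cdot> (pw i * ((-1) ^ j \<cdot> (gen Ab ^ j * (gen Ac * ?r)))))"
      by (intro cong_cs cong_mult_left qc_move qc_pow_right cb)
    also have "\<dots> = realz (act t Ac n)"
      by (simp add: n lsimps cs_mult cs_cs mult.assoc mult.commute[of "bt t i"])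
    finally show ?thesis .
  qed
  have s: "acong t (gen Asigma * nw n) (realz (act t Asigma n))" for n
  proof -
    obtain i j k s where n: "n = (i, j, k, s)" by (cases n)
    let ?S = "gen Asigma"
    have "acong t (?S * nw n) (1 \<cdot> (pw i * (?S * (gen Ab ^ j * (gen Ac ^ k * sw s)))))"
      unfolding n using qc_move[OF qc_pw(3)[OF t]] by simp
    also have "acong t \<dots> (1 \<cdot> (pw i * ((-1) ^ j \<cdot> (gen Ab ^ j * (?S * (gen Ac ^ k * sw s))))))"
      by (intro cong_cs cong_mult_left qc_move qc_pow_right qc_sb[OF t])
    also have "acong t \<dots> (1 \<cdot> (pw i * ((-1) ^ j \<cdot> (gen Ab ^ j * ((-1) ^ k \<cdot> (gen Ac ^ k * (?S * sw s)))))))"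
      by (intro cong_cs cong_mult_left qc_move qc_pow_right qc_sc[OF t])
    also have "acong t \<dots> (1 \<cdot> (pw i * ((-1) ^ j \<cdot> (gen Ab ^ j * ((-1) ^ k \<cdot> (gen Ac ^ k * (sw (\<not> s))))))))"
      by (intro cong_cs cong_mult_left) (use A_cong(8)[OF t] in \<open>simp add: sw_def\<close>)
    also have "\<dots> = realz (act t Asigma n)"
      by (simp add: n lsimps cs_mult cs_cs power_add)
    finally show ?thesis .
  qed
  have ext: "acong t (gen g * realz v) (realz (lext (act t g) v))"
    if "\<And>n. acong t (gen g * nw n) (realz (act t g n))" for g v
    by (rule lin_cong[of "\<lambda>v. gen g * realz v"]) (simp_all add: lin_def lsimps algebra_simps cs_mult that)
  have bc: "acong t (gen Ab * gen Ac * nw (i, j, k, s)) (((-1) ^ j * (bt t i)\<^sup>2) \<cdot> nw (i, Suc j, Suc k, s))" for i j k s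
  proof -
    have "acong t (gen Ab * (gen Ac * nw (i, j, k, s))) (gen Ab * realz (act t Ac (i, j, k, s)))"
      by (rule cong_mult_left[OF c])
    also have "acong t \<dots> (realz (lext (act t Ab) (act t Ac (i, j, k, s))))"
      by (rule ext[OF b])
    finally show ?thesis by (simp add: lsimps cs_cs power2_eq_square mult_ac)
  qed
  have s': "acong t (gen Asigma * nw (i, j, k, s)) ((-1) ^ (j + k) \<cdot> nw (i, j, k, \<not> s))" for i j k s'' s
    using s[of "(i, j, k, s)"] by (simp add: lsimps)
  have key: "acong t ((gen Asigma - z \<cdot> (gen Ab * gen Ac)) * nw (i, j, k, s))
     ((-1) ^ (j + k) \<cdot> nw (i, j, k, \<not> s) - (z * (-1) ^ j * (bt t i)\<^sup>2) \<cdot> nw (i, Suc j, Suc k, s))" for z i j k s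
    using cong_diff[OF s' cong_cs[OF bc, of z]] by (simp add: left_diff_distrib cs_mult cs_cs mult.assoc)
  have a: "acong t (gen Aa * nw n) (realz (act t Aa n))" for n
  proof -
    obtain i j k s where n: "n = (i, j, k, s)" by (cases n)
    show ?thesis
    proof (cases "i \<ge> 0")
      case True
      then show ?thesis by (simp add: n flip: pw_up mult.assoc)
    next
      case False
      have "gen Aa * nw n = gen Aa * gen Ad * nw (i + 1, j, k, s)"
        using False pw_down[of "i + 1"] by (simp add: n mult.assoc[symmetric]) (simp add: mult.assoc)
      also have "acong t \<dots> ((gen Asigma - t \<cdot> (gen Ab * gen Ac)) * nw (i + 1, j, k, s))"
        by (rule cong_mult_right[OF A_cong(6)[OF t]])
      also note key
      finally show ?thesis using False by (simp add: n lsimps)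
    qed
  qed
  have d: "acong t (gen Ad * nw n) (realz (act t Ad n))" for n
  proof -
    obtain i j k s where n: "n = (i, j, k, s)" by (cases n)
    show ?thesis
    proof (cases "i \<le> 0")
      case True
      then show ?thesis by (simp add: n flip: pw_down mult.assoc)
    next
      case False
      have "gen Ad * nw n = gen Ad * gen Aa * nw (i - 1, j, k, s)"
        using False pw_up[of "i - 1"] by (simp add: n mult.assoc[symmetric]) (simp add: mult.assoc)
      also have "acong t \<dots> ((gen Asigma - inverse t \<cdot> (gen Ab * gen Ac)) * nw (i - 1, j, k, s))"
        by (rule cong_mult_right[OF A_cong(7)[OF t]])
      also note key
      finally show ?thesis using False by (simp add: n lsimps)
    qed
  qed
  show ?thesis by (rule ext) (cases g; simp only: a b c d s)
qed

section \<open>Normal forms\<close>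

definition nf :: "complex \<Rightarrow> agen free_alg \<Rightarrow> (key \<Rightarrow>\<^sub>0 complex)" where
  "nf t x = actF t x (bs (0, 0, 0, False))"

lemma lin_nf: "lin (nf t)"
  unfolding nf_def[abs_def] by (rule lin_actF)

lemmas [lsimps] = lin_simps[OF lin_nf]

lemma nf_gen_mult: "nf t (gen g * x) = lext (act t g) (nf t x)"
  by (simp add: nf_def actF_mult actF_gen)

lemma nf_1: "nf t 1 = bs (0, 0, 0, False)"
  by (simp add: nf_def actF_1)

lemma nf_gen: "nf t (gen g) = act t g (0, 0, 0, False)"
  by (simp add: nf_def actF_gen)

lemma nf_idl:
  assumes "t \<noteq> 0" "x \<in> aidl t"
  shows "nf t x = 0"
proof -
  have "actF t x v = 0" for v
    using assms(2)
    by (induction arbitrary: v rule: idl_induct) (simp_all add: lsimps actF_mult actF_arels[OF assms(1)])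
  then show ?thesis by (simp add: nf_def)
qed

lemma realz_nf:
  assumes t: "t \<noteq> 0"
  shows "acong t (realz (nf t x)) x"
proof (rule lin_cong[of "\<lambda>x. realz (nf t x)" "\<lambda>x. x"])
  fix w show "acong t (realz (nf t (mon w))) (mon w)"
  proof (induction w)
    case Nil
    then show ?case by (simp add: mon_Nil nf_1 pw_def sw_def)
  next
    case (Cons g w)
    have "acong t (gen g * realz (nf t (mon w))) (gen g * mon w)"
      using Cons by (rule cong_mult_left)
    with realz_act[OF t, of g "nf t (mon w)"] show ?case
      unfolding mon_Cons nf_gen_mult by (meson cong_sym cong_trans)
  qed
qed (simp_all add: lin_id lin_def lsimps)

text \<open>Applying x to the basis vector of 1 is well defined on A (\<open>nf_idl\<close>) and
  loses nothing (\<open>realz_nf\<close>). Ideal membership thereby becomes a computation by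
  simplification.\<close>

lemma cong_nf:
  assumes "t \<noteq> 0"
  shows "acong t x y \<longleftrightarrow> nf t x = nf t y"
proof
  assume "acong t x y"
  then have "nf t (x - y) = 0" unfolding cong_def by (rule nf_idl[OF assms])
  then show "nf t x = nf t y" by (simp add: lsimps)
next
  assume "nf t x = nf t y"
  then show "acong t x y"
    using realz_nf[OF assms, of x] realz_nf[OF assms, of y] by (metis cong_sym cong_trans)
qed

lemma idl_nf: "t \<noteq> 0 \<Longrightarrow> x \<in> aidl t \<longleftrightarrow> nf t x = 0"
  using cong_nf[of t x 0] by (simp add: cong_0_iff lsimps)

text \<open>The independence half: distinct normal words have distinct basis vectors as normal
  forms.\<close>

lemma nf_nw [simp]: "nf t (nw n) = bs n"
proof -
  obtain i j k s where n: "n = (i, j, k, s)" by (cases n)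
  have neg: "- 1 - int m = - int m - 1" for m by simp
  have s: "nf t (sw s) = bs (0, 0, 0, s)"
    by (simp add: sw_def nf_1 nf_gen)
  have c: "nf t (gen Ac ^ k * sw s) = bs (0, 0, k, s)"
    by (induction k) (simp_all add: s mult.assoc nf_gen_mult bt_simps)
  have b: "nf t (gen Ab ^ j * (gen Ac ^ k * sw s)) = bs (0, j, k, s)"
    by (induction j) (simp_all add: c mult.assoc nf_gen_mult bt_simps)
  have "nf t (gen Aa ^ m * (gen Ab ^ j * (gen Ac ^ k * sw s))) = bs (int m, j, k, s)" for m
    by (induction m) (simp_all add: b mult.assoc nf_gen_mult add.commute)
  moreover have "nf t (gen Ad ^ m * (gen Ab ^ j * (gen Ac ^ k * sw s))) = bs (- int m, j, k, s)" for m
    by (induction m) (simp_all add: b mult.assoc nf_gen_mult neg)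
  ultimately show ?thesis by (simp add: n pw_def)
qed

section \<open>The actions on A\<close>

lemma bt_pm1 [simp]: "bt t 1 = inverse t" "bt t (-1) = - t" "bt t 0 = 1"
  by (simp_all add: bt_def)

lemmas nf_eval = lsimps nf_gen_mult nf_gen nf_1 cs_mult cs_cs cs_add cs_diff cs_minus cs_minus_left

lemma diag_arels:
  assumes t: "t \<noteq> 0" and r: "r \<in> arels t"
  shows "diag (kR t) r \<in> aidl t" "diag (\<lambda>g. sg g * kR t g) r \<in> aidl t"
    "diag (kL t) r \<in> aidl t" "diag (\<lambda>g. sg g * kL t g) r \<in> aidl t"
proof -
  have "diag (kR t) r \<in> aidl t \<and> diag (\<lambda>g. sg g * kR t g) r \<in> aidl t \<and>
    diag (kL t) r \<in> aidl t \<and> diag (\<lambda>g. sg g * kL t g) r \<in> aidl t"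
    by (rule arels_all[OF _ _ _ _ _ _ _ _ r, of "\<lambda>r. diag (kR t) r \<in> aidl t \<and> diag (\<lambda>g. sg g * kR t g) r \<in> aidl t \<and>
       diag (kL t) r \<in> aidl t \<and> diag (\<lambda>g. sg g * kL t g) r \<in> aidl t"];
      simp add: idl_nf[OF t] diag_mult nf_eval t;
      ((intro conjI)?; rule poly_mapping_eqI; simp add: lookup_linear lookup_single when_def field_simps t)?)
  then show "diag (kR t) r \<in> aidl t" "diag (\<lambda>g. sg g * kR t g) r \<in> aidl t"
    "diag (kL t) r \<in> aidl t" "diag (\<lambda>g. sg g * kL t g) r \<in> aidl t" by auto
qed

lemma tder_arels:
  assumes t: "t \<noteq> 0" and r: "r \<in> arels t"
  shows "DR t l m r \<in> aidl t" "DL t l m r \<in> aidl t"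
  by (rule arels_all[OF _ _ _ _ _ _ _ _ r, of "\<lambda>r. DR t l m r \<in> aidl t"]
      arels_all[OF _ _ _ _ _ _ _ _ r, of "\<lambda>r. DL t l m r \<in> aidl t"];
      simp add: idl_nf[OF t] DR_def DL_def tder_mult nf_eval t;
      (rule poly_mapping_eqI; simp add: lookup_linear lookup_single when_def field_simps t power2_eq_square)?)+

lemma diag_idl:
  assumes "x \<in> idl rels" "\<And>r. r \<in> rels \<Longrightarrow> diag \<kappa> r \<in> idl rels"
  shows "diag \<kappa> x \<in> idl rels"
  unfolding diag_def by (rule ahom_idl[OF _ assms(1)]) (simp add: assms(2) flip: diag_def)

lemma DR_idl:
  assumes "t \<noteq> 0" "x \<in> aidl t"
  shows "DR t l m x \<in> aidl t" "DL t l m x \<in> aidl t"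
  using assms tder_arels[OF assms(1), of _ l m] diag_arels[OF assms(1)] idl_rel
  unfolding DR_def DL_def by (auto intro!: tder_idl[OF _ _ _ assms(2)])

lemma TR_idl:
  assumes "t \<noteq> 0" "x \<in> aidl t"
  shows "TR t l m \<gamma> x \<in> aidl t" "TL t l m \<gamma> x \<in> aidl t"
  using assms unfolding TR_def TL_def
  by (auto intro!: idl_add idl_cs idl_diff DR_idl diag_idl[OF assms(2)] diag_arels)

lemma lin_TR: "lin (TR t l m \<gamma>)" and lin_TL: "lin (TL t l m \<gamma>)"
  by (simp_all add: lin_def TR_def TL_def DR_def DL_def lsimps cs_add cs_diff cs_cs mult.commute)

lemmas [lsimps] = lin_simps[OF lin_TR] lin_simps[OF lin_TL]

lemma cls_nonempty: "x \<in> cls rels x"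
  by (simp add: mem_cls)

text \<open>Independence of the representative of x comes from \<open>R_free_x\<close> and
  \<open>L_free_x\<close>, that of u from stability of the ideal (\<open>TR_idl\<close>).\<close>

lemma act_u_x:
  assumes t: "t \<noteq> 0" "q = - t\<^sup>2"
  shows "R_act q t (u_x q \<alpha> \<beta> \<gamma>) (acls t u) =
      acls t (TR t (\<alpha> * ((t - inverse t) / (q - inverse q))) (\<beta> * t) \<gamma> u)"
    and "L_act q t (u_x q \<alpha> \<beta> \<gamma>) (acls t u) =
      acls t (TL t (\<alpha> * ((t - inverse t) / (q - inverse q))) (\<beta> * t) \<gamma> u)"
proof -
  let ?T = "TR t (\<alpha> * ((t - inverse t) / (q - inverse q))) (\<beta> * t) \<gamma>"
  let ?L = "TL t (\<alpha> * ((t - inverse t) / (q - inverse q))) (\<beta> * t) \<gamma>"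
  have "acong t (?T u') (?T u) \<and> acong t (?L u') (?L u)" if "u' \<in> acls t u" for u'
    using that TR_idl[OF t(1), of "u' - u"] by (simp add: mem_cls cong_def lsimps)
  note * = this
  have ne: "cls (urels q) (x_rep \<alpha> \<beta> \<gamma>) \<times> acls t u \<noteq> {}"
    using cls_nonempty[of "x_rep \<alpha> \<beta> \<gamma>" "urels q"] cls_nonempty[of u "arels t"] by blast
  show "R_act q t (u_x q \<alpha> \<beta> \<gamma>) (acls t u) = acls t (?T u)"
    unfolding R_act_def u_x_def
  proof (rule the_elem_const[OF _ ne])
    fix p assume "p \<in> cls (urels q) (x_rep \<alpha> \<beta> \<gamma>) \<times> acls t u"
    then obtain x v where p: "p = (x, v)" "cong (urels q) x (x_rep \<alpha> \<beta> \<gamma>)" "v \<in> acls t u"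
      by (auto simp: mem_cls)
    show "(case p of (x, u) \<Rightarrow> acls t (R_free q t x u)) = acls t (?T u)"
      using *[OF p(3)] by (simp add: p(1) R_free_x[OF t p(2)] cls_eq)
  qed
  show "L_act q t (u_x q \<alpha> \<beta> \<gamma>) (acls t u) = acls t (?L u)"
    unfolding L_act_def u_x_def
  proof (rule the_elem_const[OF _ ne])
    fix p assume "p \<in> cls (urels q) (x_rep \<alpha> \<beta> \<gamma>) \<times> acls t u"
    then obtain x v where p: "p = (x, v)" "cong (urels q) x (x_rep \<alpha> \<beta> \<gamma>)" "v \<in> acls t u"
      by (auto simp: mem_cls)
    show "(case p of (x, u) \<Rightarrow> acls t (L_free q t x u)) = acls t (?L u)"
      using *[OF p(3)] by (simp add: p(1) L_free_x[OF t p(2)] cls_eq)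
  qed
qed

section \<open>The kernels of e and fk\<close>

text \<open>The q-integer in base t^2; through its nonvanishing the absence of roots of unity enters
  the kernels.\<close>

definition qi :: "complex \<Rightarrow> nat \<Rightarrow> complex" where
  "qi t n = (\<Sum>r<n. (t\<^sup>2) ^ r)"

lemma qi_simps [simp]: "qi t 0 = 0" "qi t (Suc n) = 1 + t\<^sup>2 * qi t n"
  unfolding qi_def sum.lessThan_Suc_shift by (simp_all add: sum_distrib_left)

lemma qi_nonzero:
  assumes "\<forall>n>0. (t\<^sup>2) ^ n \<noteq> 1" "n > 0"
  shows "qi t n \<noteq> 0"
proof -
  have "(1 - t\<^sup>2) * qi t n = 1 - (t\<^sup>2) ^ n"
    unfolding qi_def by (rule one_diff_power_eq[symmetric])
  then show ?thesis using assms by auto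
qed

text \<open>The action of e, up to a scalar, on normal words. For i > 0 the derivative of b^j
  produces d, and a^i d = a^(i-1) (\<sigma> - t bc): the bc part merges with the derivative of a^i
  into the q-integer of i + j, the \<sigma> part is the second term. At j = 0 the truncated j - 1 is
  harmless, as \<open>qi t 0 = 0\<close>.\<close>

fun Dv :: "complex \<Rightarrow> complex \<Rightarrow> key \<Rightarrow> (key \<Rightarrow>\<^sub>0 complex)" where
  "Dv t l (i, j, k, s) = (if i > 0 then
       ((-1) ^ j * l * inverse t ^ nat (i - 1) * qi t (nat i + j)) \<cdot> bs (i - 1, j, Suc k, s)
       + (t ^ nat i * l * qi t j * (-1) ^ (j - 1 + k)) \<cdot> bs (i - 1, j - 1, k, \<not> s)
     else ((- inverse t) ^ nat (- i) * l * qi t j) \<cdot> bs (i - 1, j - 1, k, s))"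

lemma nf_DR_nw:
  assumes t: "t \<noteq> 0"
  shows "nf t (DR t l 0 (nw n)) = Dv t l n"
proof -
  obtain i j k s where n: "n = (i, j, k, s)" by (cases n)
  let ?r = "gen Ac ^ k * sw s"
  let ?y = "gen Ab ^ j * ?r"
  \<comment> \<open>The derivation with m = 0 kills c and \<sigma>, so only the letters in front
    contribute.\<close>
  have r: "DR t l 0 ?r = 0"
  proof (induction k)
    case 0
    then show ?case by (simp add: sw_def DR_def)
  next
    case (Suc k)
    then show ?case by (simp add: DR_def mult.assoc tder_Cons)
  qed
  have nfb: "nf t (gen Ab ^ j * ?r) = bs (0, j, k, s)" for j
    using nf_nw[of t "(0, j, k, s)"] by (simp add: pw_def)
  have b: "nf t (DR t l 0 (gen Ab ^ j * ?r)) = (l * qi t j) \<cdot> bs (-1, j - 1, k, s)" for j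
  proof (induction j)
    case 0
    then show ?case by (simp add: r lsimps)
  next
    case (Suc j)
    have "nf t (DR t l 0 (gen Ab ^ Suc j * ?r))
        = l \<cdot> bs (-1, j, k, s) - t \<cdot> lext (act t Ab) (nf t (DR t l 0 (gen Ab ^ j * ?r)))"
      by (simp add: DR_def mult.assoc tder_Cons nf_eval nfb)
    also have "\<dots> = (l * qi t (Suc j)) \<cdot> bs (-1, j, k, s)"
      unfolding Suc by (cases j; simp add: lsimps; rule poly_mapping_eqI;
          simp add: lookup_linear lookup_single when_def power2_eq_square algebra_simps)
    finally show ?case by simp
  qed
  have nfa: "nf t (gen Aa ^ m * ?y) = bs (int m, j, k, s)" for m
    using nf_nw[of t "(int m, j, k, s)"] by (simp add: pw_def)
  have a: "nf t (DR t l 0 (gen Aa ^ Suc m * ?y)) =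
       ((-1) ^ j * l * inverse t ^ m * qi t (Suc m + j)) \<cdot> bs (int m, j, Suc k, s)
       + (t ^ Suc m * l * qi t j * (-1) ^ (j - 1 + k)) \<cdot> bs (int m, j - 1, k, \<not> s)" for m
  proof (induction m)
    case 0
    have "nf t (DR t l 0 (gen Aa ^ Suc 0 * ?y))
        = (l * (-1) ^ j) \<cdot> bs (0, j, Suc k, s) + t \<cdot> lext (act t Aa) (nf t (DR t l 0 ?y))"
      by (simp add: DR_def mult.assoc tder_Cons nf_eval nfb)
    also have "\<dots> = ((-1) ^ j * l * inverse t ^ 0 * qi t (Suc 0 + j)) \<cdot> bs (int 0, j, Suc k, s)
       + (t ^ Suc 0 * l * qi t j * (-1) ^ (j - 1 + k)) \<cdot> bs (int 0, j - 1, k, \<not> s)"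
      unfolding b by (cases j; simp add: lsimps; intro poly_mapping_eqI;
          simp add: lookup_linear lookup_single when_def power2_eq_square algebra_simps)
    finally show ?case .
  next
    case (Suc m)
    have "nf t (DR t l 0 (gen Aa ^ Suc (Suc m) * ?y))
        = (l * (-1) ^ j * inverse t ^ Suc m) \<cdot> bs (1 + int m, j, Suc k, s)
          + t \<cdot> lext (act t Aa) (nf t (DR t l 0 (gen Aa ^ Suc m * ?y)))"
      using nfa[of "Suc m"]
      by (simp add: DR_def mult.assoc tder_Cons[of _ _ _ Aa "gen Aa * (gen Aa ^ m * ?y)", simplified mult.assoc] nf_eval bt_def nat_add_distrib)
    also have "\<dots> = ((-1) ^ j * l * inverse t ^ Suc m * qi t (Suc (Suc m) + j)) \<cdot> bs (int (Suc m), j, Suc k, s)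
       + (t ^ Suc (Suc m) * l * qi t j * (-1) ^ (j - 1 + k)) \<cdot> bs (int (Suc m), j - 1, k, \<not> s)"
      unfolding Suc by (simp add: lsimps; intro poly_mapping_eqI;
          simp add: lookup_linear lookup_single when_def power2_eq_square field_simps t)
    finally show ?case .
  qed
  have d: "nf t (DR t l 0 (gen Ad ^ m * ?y)) = ((- inverse t) ^ m * l * qi t j) \<cdot> bs (- int m - 1, j - 1, k, s)" for m
  proof (induction m)
    case 0
    then show ?case by (simp add: b)
  next
    case (Suc m)
    have "nf t (DR t l 0 (gen Ad ^ Suc m * ?y)) = (- inverse t) \<cdot> lext (act t Ad) (nf t (DR t l 0 (gen Ad ^ m * ?y)))"
      by (simp add: DR_def mult.assoc tder_Cons nf_eval)
    then show ?case unfolding Suc by (simp add: lsimps cs_cs cs_minus_left) (simp add: algebra_simps)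
  qed
  show ?thesis
  proof (cases "i > 0")
    case True
    then obtain m where "i = int (Suc m)" by (metis gr0_implies_Suc of_nat_0_less_iff zero_less_imp_eq_int)
    then show ?thesis using a[of m] by (simp add: n pw_def nat_add_distrib mult.assoc)
  next
    case False
    then obtain m where "i = - int m" by (metis minus_minus nonneg_eq_int not_less neg_0_le_iff_le)
    then show ?thesis using d[of m] b[of j] by (cases "m = 0") (simp_all add: n pw_def)
  qed
qed

lemma nf_DR:
  assumes t: "t \<noteq> 0"
  shows "nf t (DR t l 0 u) = lext (Dv t l) (nf t u)"
proof -
  have "DR t l 0 u - DR t l 0 (realz (nf t u)) \<in> aidl t"
    using DR_idl(1)[OF t, of "u - realz (nf t u)" l 0] realz_nf[OF t, of u, THEN cong_sym]
    by (simp add: cong_def DR_def lsimps)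
  then have "nf t (DR t l 0 u) = nf t (DR t l 0 (realz (nf t u)))"
    by (simp add: idl_nf[OF t] lsimps)
  also have "\<dots> = lext (Dv t l) (nf t u)"
    by (rule lin_ext[of "\<lambda>v. nf t (DR t l 0 (realz v))"])
      (simp_all add: lin_def DR_def lsimps flip: nf_DR_nw[OF t])
  finally show ?thesis .
qed

text \<open>The leading term device: a coefficient of the image that only one key can reach is a
  single product.\<close>

lemma lookup_lext_single:
  fixes v :: "'k \<Rightarrow>\<^sub>0 complex" and \<phi> :: "'k \<Rightarrow> ('j \<Rightarrow>\<^sub>0 complex)"
  assumes "\<And>n'. n' \<in> keys v \<Longrightarrow> n' \<noteq> n \<Longrightarrow> lookup (\<phi> n') x = 0"
  shows "lookup (lext \<phi> v) x = lookup v n * lookup (\<phi> n) x"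
proof -
  have "lookup (lext \<phi> v) x
      = (\<Sum>k\<in>insert n (keys v). lookup v k * lookup (\<phi> k) x)"
    by (subst lext_superset[of "insert n (keys v)"]) (auto simp: lookup_sum)
  also have "\<dots> = (\<Sum>k\<in>{n}. lookup v k * lookup (\<phi> k) x)"
    by (rule sum.mono_neutral_right) (use assms in auto)
  finally show ?thesis by simp
qed

text \<open>In each component with \<open>i > 0\<close> the term of the derivative that keeps the exponent of \<open>b\<close>
  cannot be cancelled when that exponent is maximal.\<close>

lemma Dv_kernel:
  assumes t: "t \<noteq> 0" "\<forall>n>0. (t\<^sup>2) ^ n \<noteq> 1" and l: "l \<noteq> 0" and v: "lext (Dv t l) v = 0"
    and n: "(i, j, k, s) \<in> keys v"
  shows "i \<le> 0 \<and> j = 0"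
proof -
  note qi = qi_nonzero[OF t(2)]
  let ?K = "keys v"
  have neg: "i \<le> 0" if "(i, j, k, s) \<in> ?K" for i j k s
  proof (rule ccontr)
    assume i: "\<not> i \<le> 0"
    let ?J = "{j. \<exists>i k s. (i, j, k, s) \<in> ?K \<and> i > 0}"
    have "?J \<subseteq> (\<lambda>(i, j, k, s). j) ` ?K" by force
    then have fin: "finite ?J" by (rule finite_subset) simp
    have "j \<in> ?J" using that i not_le by blast
    then have "Max ?J \<in> ?J" using fin by (intro Max_in) auto
    then obtain i' k' s' where m: "(i', Max ?J, k', s') \<in> ?K" "i' > 0" by auto
    let ?j = "Max ?J"
    have "lookup (lext (Dv t l) v) (i' - 1, ?j, Suc k', s')
        = lookup v (i', ?j, k', s') * lookup (Dv t l (i', ?j, k', s')) (i' - 1, ?j, Suc k', s')"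
    proof (rule lookup_lext_single)
      fix n assume nK: "n \<in> ?K" and ne: "n \<noteq> (i', ?j, k', s')"
      obtain i2 j2 k2 s2 where n2: "n = (i2, j2, k2, s2)" by (cases n)
      \<comment> \<open>Another key with positive i reaches this target only by lowering the
        exponent of b from \<open>?j + 1\<close>, which maximality excludes; keys with i \<le> 0
        land at a negative exponent.\<close>
      have "j2 \<le> ?j" if "i2 > 0" using nK n2 that fin by (intro Max_ge) auto
      then show "lookup (Dv t l n) (i' - 1, ?j, Suc k', s') = 0"
        using ne m(2) unfolding n2 by (cases j2) (auto simp: lookup_add lookup_single when_def)
    qed
    moreover have "lookup (Dv t l (i', ?j, k', s')) (i' - 1, ?j, Suc k', s') \<noteq> 0"
      using m(2) t l qi[of "nat i' + ?j"] by (simp add: lookup_add lookup_single)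
    ultimately show False using v m(1) by (simp add: in_keys_iff)
  qed
  \<comment> \<open>With all i \<le> 0, distinct keys with positive exponent of b go to multiples of
    distinct keys, so nothing can cancel.\<close>
  moreover have "j = 0"
  proof (rule ccontr)
    assume j: "j \<noteq> 0"
    have "lookup (lext (Dv t l) v) (i - 1, j - 1, k, s)
        = lookup v (i, j, k, s) * lookup (Dv t l (i, j, k, s)) (i - 1, j - 1, k, s)"
    proof (rule lookup_lext_single)
      fix n assume nK: "n \<in> ?K" and ne: "n \<noteq> (i, j, k, s)"
      obtain i2 j2 k2 s2 where n2: "n = (i2, j2, k2, s2)" by (cases n)
      show "lookup (Dv t l n) (i - 1, j - 1, k, s) = 0"
        using ne j neg[of i2 j2 k2 s2] nK unfolding n2 by (cases j2) (auto simp: lookup_single when_def)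
    qed
    moreover have "lookup (Dv t l (i, j, k, s)) (i - 1, j - 1, k, s) \<noteq> 0"
      using neg[OF n] t l qi[of j] j by (simp add: lookup_single)
    ultimately show False using v n by (simp add: in_keys_iff)
  qed
  ultimately show ?thesis using n by blast
qed

definition mons :: "agen \<Rightarrow> agen \<Rightarrow> agen free_alg set" where
  "mons x y = {gen x ^ m * (gen y ^ k * sw s) | m k s. True}"

lemma kernel_e:
  assumes t: "t \<noteq> 0" "\<forall>n>0. (t\<^sup>2) ^ n \<noteq> 1" and l: "l \<noteq> 0" and u: "DR t l 0 u \<in> aidl t"
  shows "\<exists>u'\<in>cspan (mons Ad Ac). acong t u u'"
proof -
  have v: "lext (Dv t l) (nf t u) = 0"
    using u by (simp add: idl_nf[OF t(1)] nf_DR[OF t(1)])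
  have "nw n \<in> mons Ad Ac" if nK: "n \<in> keys (nf t u)" for n
  proof -
    obtain i j k s where n: "n = (i, j, k, s)" by (cases n)
    have "i \<le> 0" "j = 0" using Dv_kernel[OF t l v, of i j k s] nK n by auto
    then have "nw n = gen Ad ^ nat (- i) * (gen Ac ^ k * sw s)"
      by (auto simp: n pw_def)
    then show ?thesis unfolding mons_def by blast
  qed
  then have "realz (nf t u) \<in> cspan (mons Ad Ac)"
    unfolding realz_def lext_def by (intro cspan_sum cspan_cs cspan_base)
  then show ?thesis using realz_nf[OF t(1), of u] cong_sym by blast
qed

section \<open>Two symmetries\<close>

primrec swp :: "agen \<Rightarrow> agen" where
  "swp Aa = Ad" | "swp Ab = Ac" | "swp Ac = Ab" | "swp Ad = Aa" | "swp Asigma = Asigma"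

text \<open>An isomorphism from the algebra with parameter \<open>t\<close> to the one with parameter \<open>- 1 / t\<close>, which
  exchanges \<open>e\<close> and \<open>fk\<close>.\<close>

definition tau :: "agen free_alg \<Rightarrow> agen free_alg" where
  "tau = ahom (\<lambda>g. gen (swp g))"

text \<open>An automorphism that turns the left action into the right one.\<close>

primrec th :: "complex \<Rightarrow> agen \<Rightarrow> agen free_alg" where
  "th z Aa = gen Aa" | "th z Ab = z \<cdot> gen Ac" | "th z Ac = (- z) \<cdot> gen Ab" | "th z Ad = gen Ad"
| "th z Asigma = gen Asigma"

lemma tau_tau: "tau (tau x) = x"
proof -
  have "(\<lambda>g. ahom (\<lambda>g. gen (swp g)) (gen (swp g))) = gen"
  proof
    fix g show "ahom (\<lambda>g. gen (swp g)) (gen (swp g)) = gen g" by (cases g) simp_all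
  qed
  then show ?thesis unfolding tau_def ahom_ahom by (simp add: ahom_id)
qed

lemma th_th: "z\<^sup>2 = 1 \<Longrightarrow> ahom (th (- z)) (ahom (th z) x) = x"
proof -
  assume z: "z\<^sup>2 = 1"
  have "(\<lambda>g. ahom (th (- z)) (th z g)) = gen"
  proof
    fix g show "ahom (th (- z)) (th z g) = gen g"
      using z by (cases g) (simp_all add: lsimps cs_cs cs_minus cs_minus_left power2_eq_square)
  qed
  then show ?thesis unfolding ahom_ahom by (simp add: ahom_id)
qed

lemma tau_idl:
  assumes t: "t \<noteq> 0" and x: "x \<in> aidl t"
  shows "tau x \<in> idl (arels (- inverse t))"
proof -
  have t': "- inverse t \<noteq> 0" using t by simp
  show ?thesis unfolding tau_def
  proof (rule ahom_idl[OF _ x])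
    fix r assume r: "r \<in> arels t"
    show "ahom (\<lambda>g. gen (swp g)) r \<in> idl (arels (- inverse t))"
      by (rule arels_all[OF _ _ _ _ _ _ _ _ r, of "\<lambda>r. ahom (\<lambda>g. gen (swp g)) r \<in> idl (arels (- inverse t))"];
        simp add: idl_nf[OF t'] ahom_mult nf_eval t;
        (rule poly_mapping_eqI; simp add: lookup_linear lookup_single when_def field_simps t)?)
  qed
qed

lemma th_idl:
  assumes t: "t \<noteq> 0" and z: "z\<^sup>2 = 1" and x: "x \<in> aidl t"
  shows "ahom (th z) x \<in> aidl t"
proof (rule ahom_idl[OF _ x])
  fix r assume r: "r \<in> arels t"
  from z have "z = 1 \<or> z = -1" by (simp add: power2_eq_1_iff)
  then show "ahom (th z) r \<in> aidl t"
    by (rule disjE; intro arels_all[OF _ _ _ _ _ _ _ _ r, of "\<lambda>r. ahom (th z) r \<in> aidl t"];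
      simp add: idl_nf[OF t] ahom_mult nf_eval t;
      (simp add: cs_diff_left)?)
qed

lemma tau_DR: "t \<noteq> 0 \<Longrightarrow> tau (DR t l m x) = DR (- inverse t) m l (tau x)"
  unfolding tau_def DR_def
proof (rule ahom_tder)
  fix g assume "t \<noteq> 0"
  then show "tder (\<lambda>g. sg g * kR (- inverse t) g) (\<lambda>_. 1) (dR m l) (gen (swp g)) = ahom (\<lambda>g. gen (swp g)) (dR l m g)"
    "diag (\<lambda>g. sg g * kR (- inverse t) g) (gen (swp g)) = (sg g * kR t g) \<cdot> gen (swp g)"
    by (cases g; simp add: lsimps)+
qed

text \<open>\<open>th\<close> is a signed transposition of the matrix of generators: it exchanges
  rows and columns, hence \<open>kR\<close> and \<open>kL\<close>, and b and c, hence l and m up to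
  sign.\<close>

lemma th_TR:
  assumes z: "z\<^sup>2 = 1"
  shows "ahom (th z) (TR t (z * m) (- z * l) \<gamma> x) = TL t l m \<gamma> (ahom (th z) x)"
proof -
  have "ahom (th z) (DR t (z * m) (- z * l) x) = DL t l m (ahom (th z) x)"
    unfolding DR_def DL_def
  proof (rule ahom_tder)
    fix g
    show "tder (\<lambda>g. sg g * kL t g) (\<lambda>_. 1) (dL l m) (th z g) = ahom (th z) (dR (z * m) (- z * l) g)"
      "diag (\<lambda>g. sg g * kL t g) (th z g) = (sg g * kR t g) \<cdot> th z g"
      using z by (cases g; simp add: lsimps cs_cs cs_minus_left cs_minus power2_eq_square mult_ac)+
  qed
  moreover have "ahom (th z) (diag (kR t) x) = diag (kL t) (ahom (th z) x)"
    by (rule ahom_diag, case_tac g) (simp_all add: lsimps cs_cs cs_minus_left cs_minus mult_ac)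
  ultimately show ?thesis by (simp add: TR_def TL_def lsimps)
qed

text \<open>Transport along \<open>tau\<close> of the kernel of e at the parameter -1/t, whose
  square again is not a root of unity.\<close>

lemma kernel_f:
  assumes t: "t \<noteq> 0" "\<forall>n>0. (t\<^sup>2) ^ n \<noteq> 1" and m: "m \<noteq> 0" and u: "DR t 0 m u \<in> aidl t"
  shows "\<exists>u'\<in>cspan (mons Aa Ab). acong t u u'"
proof -
  let ?t = "- inverse t"
  have t': "?t \<noteq> 0" "\<forall>n>0. (?t\<^sup>2) ^ n \<noteq> 1"
    using t by (auto simp: power_inverse)
  have "DR ?t m 0 (tau u) \<in> idl (arels ?t)"
    using tau_idl[OF t(1) u] by (simp add: tau_DR[OF t(1)])
  from kernel_e[OF t' m this] obtain u' where u': "u' \<in> cspan (mons Ad Ac)" "cong (arels ?t) (tau u) u'" by blast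
  have lt: "lin tau" by (simp add: tau_def lin_ahom)
  have "tau (tau u - u') \<in> idl (arels (- inverse ?t))"
    using u'(2) by (intro tau_idl[OF t'(1)]) (simp add: cong_def)
  then have "acong t u (tau u')"
    by (simp add: cong_def lin_simps[OF lt] tau_tau)
  moreover have "tau ` mons Ad Ac \<subseteq> mons Aa Ab"
  proof -
    have "tau (sw s) = sw s" for s by (simp add: sw_def tau_def)
    then have "tau (gen Ad ^ i * (gen Ac ^ k * sw s)) = gen Aa ^ i * (gen Ab ^ k * sw s)" for i k s
      unfolding tau_def by (simp add: ahom_mult ahom_pow)
    then show ?thesis unfolding mons_def by blast
  qed
  then have "tau u' \<in> cspan (mons Aa Ab)"
    using cspan_minimal[OF cspan_image_lin[OF lt u'(1)], of "cspan (mons Aa Ab)"]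
    by (blast intro: cspan_base cspan.zero cspan_add cspan_cs)
  ultimately show ?thesis by blast
qed

section \<open>No invariants of spin 1/2 or 1\<close>

text \<open>One shape for characteristic polynomials of sizes two and three; the quadratic case has
  \<open>c3 = 0\<close>.\<close>

definition pol :: "('v::cvec \<Rightarrow> 'v) \<Rightarrow> complex \<Rightarrow> complex \<Rightarrow> complex \<Rightarrow> complex \<Rightarrow> 'v \<Rightarrow> 'v" where
  "pol T c3 c2 c1 c0 v = c3 \<cdot> T (T (T v)) + c2 \<cdot> T (T v) + c1 \<cdot> T v + c0 \<cdot> v"

lemma lin_pol: "lin T \<Longrightarrow> lin (pol T c3 c2 c1 c0)"
  unfolding pol_def[abs_def] by (simp add: lin_def cs_add cs_cs mult.commute algebra_simps)

text \<open>The operators annihilating the two halves of the span commute, so their product kills the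
  whole span; on the kernel of \<open>T\<close> it is multiplication by the product of the constant terms.\<close>

lemma pol_kernel:
  assumes T: "lin T" and c: "c0 \<noteq> 0" "d0 \<noteq> 0"
    and V: "\<And>v. v \<in> V \<Longrightarrow> pol T c3 c2 c1 c0 v = 0" and W: "\<And>v. v \<in> W \<Longrightarrow> pol T d3 d2 d1 d0 v = 0"
    and u: "u \<in> cspan (V \<union> W)" "T u = 0"
  shows "u = 0"
proof -
  let ?P = "pol T c3 c2 c1 c0" and ?Q = "pol T d3 d2 d1 d0"
  have TP: "T (?P v) = ?P (T v)" for v
    by (simp add: pol_def lin_simps[OF T])
  have comm: "?Q (?P v) = ?P (?Q v)" for v
    unfolding pol_def[of T d3] by (simp add: TP lin_simps[OF lin_pol[OF T]])
  have "u \<in> {u. ?Q (?P u) = 0}"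
    using u(1)
  proof (rule cspan_minimal)
    show "V \<union> W \<subseteq> {u. ?Q (?P u) = 0}"
      using V by (auto simp: lin_simps[OF lin_pol[OF T]]) (simp add: comm W lin_simps[OF lin_pol[OF T]])
  qed (simp_all add: lin_simps[OF lin_pol[OF T]])
  moreover have "?P u = c0 \<cdot> u" "?Q u = d0 \<cdot> u"
    using u(2) by (simp_all add: pol_def lin_simps[OF T])
  ultimately have "(c0 * d0) \<cdot> u = 0"
    by (simp add: lin_simps[OF lin_pol[OF T]] cs_cs)
  moreover have "u = (inverse (c0 * d0) * (c0 * d0)) \<cdot> u"
    by (subst left_inverse) (use c in simp_all)
  ultimately show ?thesis by (metis cs_cs cs_zero)
qed

text \<open>Cayley-Hamilton for a 2 by 2 matrix. Only the product of the off-diagonal entries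
  enters, so differently normalised columns share the polynomial.\<close>

lemma pol_chain2:
  fixes v0 v1 :: "'k \<Rightarrow>\<^sub>0 complex"
  assumes T: "lin T" and v: "T v0 = x0 \<cdot> v0 + y \<cdot> v1" "T v1 = z \<cdot> v0 + x1 \<cdot> v1" and p: "y * z = p"
    and w: "w \<in> {v0, v1}"
  shows "pol T 0 1 (- (x0 + x1)) (x0 * x1 - p) w = 0"
  using w by (auto simp: pol_def lin_simps[OF T] v cs_add cs_cs; intro poly_mapping_eqI)
    (simp_all add: lookup_linear algebra_simps flip: p)

text \<open>Cayley-Hamilton for a tridiagonal 3 by 3 matrix; again the off-diagonal entries enter
  only through the products \<open>p\<close> and \<open>r\<close>.\<close>

lemma pol_chain3:
  fixes v0 v1 v2 :: "'k \<Rightarrow>\<^sub>0 complex"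
  assumes T: "lin T" and v: "T v0 = x0 \<cdot> v0 + y0 \<cdot> v1" "T v1 = z0 \<cdot> v0 + x1 \<cdot> v1 + y1 \<cdot> v2" "T v2 = z1 \<cdot> v1 + x2 \<cdot> v2"
    and p: "y0 * z0 = p" "y1 * z1 = r" and w: "w \<in> {v0, v1, v2}"
  shows "pol T 1 (- (x0 + x1 + x2)) (x0 * x1 + x0 * x2 + x1 * x2 - p - r) (- (x0 * x1 * x2 - p * x2 - r * x0)) w = 0"
  using w by (auto simp: pol_def lin_simps[OF T] v cs_add cs_cs; intro poly_mapping_eqI)
    (simp_all add: lookup_linear algebra_simps flip: p)

section \<open>The action of x in coordinates, on the columns of spin 1/2 and spin 1\<close>

definition TV :: "complex \<Rightarrow> complex \<Rightarrow> complex \<Rightarrow> complex \<Rightarrow> (key \<Rightarrow>\<^sub>0 complex) \<Rightarrow> (key \<Rightarrow>\<^sub>0 complex)" where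
  "TV t l m \<gamma> v = nf t (TR t l m \<gamma> (realz v))"

lemma lin_TV: "lin (TV t l m \<gamma>)"
  by (simp add: lin_def TV_def lsimps)

lemma TV_nf:
  assumes t: "t \<noteq> 0"
  shows "TV t l m \<gamma> (nf t u) = nf t (TR t l m \<gamma> u)"
proof -
  have "realz (nf t u) - u \<in> aidl t" using realz_nf[OF t, of u] by (simp add: cong_def)
  then have "nf t (TR t l m \<gamma> (realz (nf t u) - u)) = 0" using TR_idl(1)[OF t] idl_nf[OF t] by blast
  then show ?thesis by (simp add: TV_def lsimps)
qed

definition word2 :: "agen \<Rightarrow> agen \<Rightarrow> bool \<Rightarrow> agen free_alg" where
  "word2 g h s = gen g * (gen h * sw s)"

text \<open>The central matrix element of spin 1, times a power of \<sigma> (see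
  \<open>cfw_one\<close>).\<close>

definition mid :: "complex \<Rightarrow> bool \<Rightarrow> agen free_alg" where
  "mid t s = word2 Aa Ad s - inverse t \<cdot> word2 Ab Ac s"

text \<open>The image of \<open>mid\<close> under \<open>th (-1)\<close>. It is equal to
  \<open>mid\<close> in A but not in the free algebra; listing both makes \<open>Wone\<close> stable
  under that map up to sign.\<close>

definition mid' :: "complex \<Rightarrow> bool \<Rightarrow> agen free_alg" where
  "mid' t s = word2 Aa Ad s + inverse t \<cdot> word2 Ac Ab s"

definition Whalf :: "bool \<Rightarrow> agen free_alg set" where
  "Whalf s = {gen Aa * sw s, gen Ac * sw s, gen Ab * sw s, gen Ad * sw s}"

definition Wone :: "complex \<Rightarrow> bool \<Rightarrow> agen free_alg set" where
  "Wone t s = {word2 Aa Aa s, word2 Aa Ac s, word2 Ac Ac s, word2 Aa Ab s, mid t s, mid' t s, word2 Ac Ad s,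
     word2 Ab Ab s, word2 Ab Ad s, word2 Ad Ad s}"

lemmas eval_TR = TR_def DR_def tder_Cons diag_mult nf_eval sw_def word2_def mid_def mid'_def

lemma nf_mid': "t \<noteq> 0 \<Longrightarrow> nf t (mid' t s) = nf t (mid t s)"
  by (cases s; simp add: eval_TR)

text \<open>The columns {a, c} and {b, d}. The derivation has trivial right twist, so \<sigma> is
  inert for it, while k contributes the sign \<open>e\<close>.\<close>

lemma half_chains:
  fixes e t \<gamma> :: complex
  assumes t: "t \<noteq> 0" and e: "e = (if s then -1 else 1)"
  defines "x0 \<equiv> \<gamma> * (e * t - 1)" and "x1 \<equiv> \<gamma> * (- e * inverse t - 1)"
  shows "TV t l m \<gamma> (nf t (gen Aa * sw s)) = x0 \<cdot> nf t (gen Aa * sw s) + l \<cdot> nf t (gen Ac * sw s)"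
    "TV t l m \<gamma> (nf t (gen Ac * sw s)) = m \<cdot> nf t (gen Aa * sw s) + x1 \<cdot> nf t (gen Ac * sw s)"
    "TV t l m \<gamma> (nf t (gen Ab * sw s)) = x0 \<cdot> nf t (gen Ab * sw s) + l \<cdot> nf t (gen Ad * sw s)"
    "TV t l m \<gamma> (nf t (gen Ad * sw s)) = m \<cdot> nf t (gen Ab * sw s) + x1 \<cdot> nf t (gen Ad * sw s)"
  unfolding TV_nf[OF t] x0_def x1_def e
  by (cases s; simp add: eval_TR; rule poly_mapping_eqI;
      simp add: lookup_linear lookup_single when_def algebra_simps)+

text \<open>Three tridiagonal columns with the same diagonal; the eigenvalues of k are t^2, -1, t^-2
  times the sign, alternating as e t^2, -e, e t^-2. Off-diagonal entries differ, but their products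
  agree across the columns.\<close>

lemma one_chains:
  fixes e t \<gamma> :: complex
  assumes t: "t \<noteq> 0" and e: "e = (if s then -1 else 1)"
  defines "x0 \<equiv> \<gamma> * (e * t\<^sup>2 - 1)" and "x1 \<equiv> \<gamma> * (- e - 1)" and "x2 \<equiv> \<gamma> * (e * inverse (t\<^sup>2) - 1)"
    and "N \<equiv> \<lambda>g h. nf t (word2 g h s)"
  shows "TV t l m \<gamma> (N Aa Aa) = x0 \<cdot> N Aa Aa + (l * (t + inverse t)) \<cdot> N Aa Ac"
    "TV t l m \<gamma> (N Aa Ac) = (m * t) \<cdot> N Aa Aa + x1 \<cdot> N Aa Ac + l \<cdot> N Ac Ac"
    "TV t l m \<gamma> (N Ac Ac) = (m * (1 + inverse (t\<^sup>2))) \<cdot> N Aa Ac + x2 \<cdot> N Ac Ac"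
    "TV t l m \<gamma> (N Aa Ab) = x0 \<cdot> N Aa Ab + (l * t) \<cdot> nf t (mid t s)"
    "TV t l m \<gamma> (nf t (mid t s)) = (m * (t + inverse t)) \<cdot> N Aa Ab + x1 \<cdot> nf t (mid t s) + (l * (1 + inverse (t\<^sup>2))) \<cdot> N Ac Ad"
    "TV t l m \<gamma> (N Ac Ad) = m \<cdot> nf t (mid t s) + x2 \<cdot> N Ac Ad"
    "TV t l m \<gamma> (N Ab Ab) = x0 \<cdot> N Ab Ab + (- l * (t + inverse t)) \<cdot> N Ab Ad"
    "TV t l m \<gamma> (N Ab Ad) = (- m * t) \<cdot> N Ab Ab + x1 \<cdot> N Ab Ad + l \<cdot> N Ad Ad"
    "TV t l m \<gamma> (N Ad Ad) = (m * (1 + inverse (t\<^sup>2))) \<cdot> N Ab Ad + x2 \<cdot> N Ad Ad"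
  unfolding N_def TV_nf[OF t] x0_def x1_def x2_def e
  by (cases s; simp add: eval_TR; rule poly_mapping_eqI;
      simp add: lookup_linear lookup_single when_def field_simps power2_eq_square t)+

lemma no_invariants_half:
  assumes t: "t \<noteq> 0" "t\<^sup>2 \<noteq> 1" and c: "(\<gamma> = 0) \<noteq> (l * m = 0)"
    and u: "u \<in> cspan (Whalf False \<union> Whalf True)" "TR t l m \<gamma> u \<in> aidl t"
  shows "u \<in> aidl t"
proof -
  define x0 x1 where "x0 e = \<gamma> * (e * t - 1)" and "x1 e = \<gamma> * (- e * inverse t - 1)" for e
  have pol: "pol (TV t l m \<gamma>) 0 1 (- (x0 e + x1 e)) (x0 e * x1 e - l * m) v = 0"
    if "v \<in> nf t ` Whalf s" "e = (if s then -1 else 1)" for v s e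
  proof -
    note ch = half_chains[OF t(1) that(2), of l m \<gamma>, folded x0_def x1_def]
    have "v \<in> {nf t (gen Aa * sw s), nf t (gen Ac * sw s)} \<or> v \<in> {nf t (gen Ab * sw s), nf t (gen Ad * sw s)}"
      using that(1) by (auto simp: Whalf_def)
    then show ?thesis
      using pol_chain2[OF lin_TV ch(1,2)] pol_chain2[OF lin_TV ch(3,4)] by blast
  qed
  \<comment> \<open>The \<gamma> parts of both determinants, cleared of the denominator t. As
    exactly one of \<gamma> and l m vanishes, each determinant is either this part or - l m.\<close>
  have "t * x0 1 * x1 1 = - (\<gamma>\<^sup>2 * (t\<^sup>2 - 1))" "t * x0 (-1) * x1 (-1) = \<gamma>\<^sup>2 * (t\<^sup>2 - 1)"
    using t by (simp_all add: x0_def x1_def field_simps power2_eq_square)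
  then have nz: "x0 1 * x1 1 - l * m \<noteq> 0" "x0 (-1) * x1 (-1) - l * m \<noteq> 0"
    using c t by (auto simp: x0_def x1_def mult.assoc)
  have "nf t u = 0"
  proof (rule pol_kernel[OF lin_TV nz])
    show "nf t u \<in> cspan (nf t ` Whalf False \<union> nf t ` Whalf True)"
      using cspan_image_lin[OF lin_nf u(1)] by (simp add: image_Un)
    show "TV t l m \<gamma> (nf t u) = 0" using u(2) by (simp add: TV_nf[OF t(1)] idl_nf[OF t(1)])
  qed (use pol[of _ False 1] pol[of _ True "-1"] in auto)
  then show ?thesis by (simp add: idl_nf[OF t(1)])
qed

lemma no_invariants_one:
  assumes t: "t \<noteq> 0" "t\<^sup>2 \<noteq> 1" "t\<^sup>2 \<noteq> -1" and c: "\<gamma> \<noteq> 0" "l * m \<noteq> 0"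
    and u: "u \<in> cspan (Wone t False \<union> Wone t True)" "TR t l m \<gamma> u \<in> aidl t"
  shows "u \<in> aidl t"
proof -
  define x0 x1 x2 where "x0 e = \<gamma> * (e * t\<^sup>2 - 1)" and "x1 e = \<gamma> * (- e - 1)"
    and "x2 e = \<gamma> * (e * inverse (t\<^sup>2) - 1)" for e
  define p r where "p = l * m * (t\<^sup>2 + 1)" and "r = l * m * (1 + inverse (t\<^sup>2))"
  define c2 c1 c0 where "c2 e = - (x0 e + x1 e + x2 e)"
    and "c1 e = x0 e * x1 e + x0 e * x2 e + x1 e * x2 e - p - r"
    and "c0 e = - (x0 e * x1 e * x2 e - p * x2 e - r * x0 e)" for e
  have pol: "pol (TV t l m \<gamma>) 1 (c2 e) (c1 e) (c0 e) v = 0"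
    if "v \<in> nf t ` Wone t s" "e = (if s then -1 else 1)" for v s e
  proof -
    note ch = one_chains[OF t(1) that(2), of l m \<gamma>, folded x0_def x1_def x2_def]
    have p: "l * (t + inverse t) * (m * t) = p" "l * t * (m * (t + inverse t)) = p"
      "- l * (t + inverse t) * (- m * t) = p" "l * (m * (1 + inverse (t\<^sup>2))) = r"
      "l * (1 + inverse (t\<^sup>2)) * m = r"
      using t(1) by (simp_all add: p_def r_def field_simps power2_eq_square)
    let ?N = "\<lambda>g h. nf t (word2 g h s)"
    have "v \<in> {?N Aa Aa, ?N Aa Ac, ?N Ac Ac} \<or> v \<in> {?N Aa Ab, nf t (mid t s), ?N Ac Ad} \<or>
        v \<in> {?N Ab Ab, ?N Ab Ad, ?N Ad Ad}"
      using that(1) by (auto simp: Wone_def nf_mid'[OF t(1)])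
    then show ?thesis
      using pol_chain3[OF lin_TV ch(1-3) p(1) p(4)] pol_chain3[OF lin_TV ch(4-6) p(2) p(5)]
        pol_chain3[OF lin_TV ch(7-9) p(3) p(4)]
      unfolding c2_def c1_def c0_def by blast
  qed
  \<comment> \<open>The constant terms are minus the determinants. For the sign 1 the contributions
    of \<open>p\<close> and \<open>r\<close> cancel; for the sign -1 the middle eigenvalue
    \<open>x1\<close> is zero and only they survive.\<close>
  have "t\<^sup>2 * c0 1 = - 2 * \<gamma> ^ 3 * (t\<^sup>2 - 1)\<^sup>2" "t\<^sup>2 * c0 (-1) = - 2 * \<gamma> * (l * m) * (t\<^sup>2 + 1)\<^sup>2"
    using t(1) by (simp_all add: c0_def x0_def x1_def x2_def p_def r_def field_simps power2_eq_square power3_eq_cube)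
  moreover have "t\<^sup>2 + 1 \<noteq> 0" using t(3) by (simp add: add_eq_0_iff2)
  ultimately have nz: "c0 1 \<noteq> 0" "c0 (-1) \<noteq> 0"
    using c t by auto
  have "nf t u = 0"
  proof (rule pol_kernel[OF lin_TV nz])
    show "nf t u \<in> cspan (nf t ` Wone t False \<union> nf t ` Wone t True)"
      using cspan_image_lin[OF lin_nf u(1)] by (simp add: image_Un)
    show "TV t l m \<gamma> (nf t u) = 0" using u(2) by (simp add: TV_nf[OF t(1)] idl_nf[OF t(1)])
  qed (use pol[of _ False 1] pol[of _ True "-1"] in auto)
  then show ?thesis by (simp add: idl_nf[OF t(1)])
qed

text \<open>An invariant u of the left action with parameters (l, m) gives the invariant
  \<open>ahom (th (-1)) u\<close> of the right action with (m, - l), and \<open>th 1\<close> leads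
  back.\<close>

lemma th_kernel:
  assumes t: "t \<noteq> 0"
    and R: "\<And>x. x \<in> cspan W \<Longrightarrow> TR t m (- l) \<gamma> x \<in> aidl t \<Longrightarrow> x \<in> aidl t"
    and W: "\<And>x. x \<in> W \<Longrightarrow> ahom (th (-1)) x \<in> cspan W"
    and u: "u \<in> cspan W" "TL t l m \<gamma> u \<in> aidl t"
  shows "u \<in> aidl t"
proof -
  let ?x = "ahom (th (-1)) u"
  have inv_th: "ahom (th 1) (ahom (th (-1)) x) = x" "ahom (th (-1)) (ahom (th 1) x) = x" for x
    using th_th[of "-1"] th_th[of 1] by simp_all
  have "?x \<in> cspan W"
    using cspan_image_lin[OF lin_ahom u(1)]
    by (rule cspan_minimal) (use W in \<open>auto intro: cspan.zero cspan_add cspan_cs\<close>)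
  moreover have "ahom (th 1) (TR t m (- l) \<gamma> ?x) = TL t l m \<gamma> u"
    using th_TR[of 1 t m l \<gamma> ?x] by (simp add: inv_th)
  then have "TR t m (- l) \<gamma> ?x = ahom (th (-1)) (TL t l m \<gamma> u)"
    using inv_th(2)[of "TR t m (- l) \<gamma> ?x"] by simp
  then have "TR t m (- l) \<gamma> ?x \<in> aidl t"
    using th_idl[OF t _ u(2), of "-1"] by simp
  ultimately have "?x \<in> aidl t" by (rule R)
  then have "ahom (th 1) ?x \<in> aidl t" by (rule th_idl[OF t, rotated]) simp_all
  then show ?thesis by (simp add: inv_th)
qed

lemma cspan_neg: "x \<in> G \<Longrightarrow> - x \<in> cspan G"
  using cspan_cs[OF cspan_base, of x G "-1"] by (simp add: cs_minus_left)

lemma th_Whalf: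
  assumes "x \<in> Whalf False \<union> Whalf True"
  shows "ahom (th (-1)) x \<in> cspan (Whalf False \<union> Whalf True)"
proof -
  have "ahom (th (-1)) (sw s) = sw s" for s by (simp add: sw_def)
  then show ?thesis
    using assms unfolding Whalf_def by (auto simp: ahom_mult cs_mult cs_minus_left intro: cspan_base cspan_neg)
qed

lemma th_Wone:
  assumes "x \<in> Wone t False \<union> Wone t True"
  shows "ahom (th (-1)) x \<in> cspan (Wone t False \<union> Wone t True)"
proof -
  have s: "ahom (th (-1)) (sw s) = sw s" for s by (simp add: sw_def)
  have "ahom (th (-1)) (mid t s) = mid' t s" "ahom (th (-1)) (mid' t s) = mid t s" for s
    by (simp_all add: mid_def mid'_def word2_def s lsimps ahom_mult cs_mult cs_minus_left cs_minus)
  moreover have "ahom (th (-1)) (word2 g h s) = th (-1) g * (th (-1) h * sw s)" for g h s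
    by (simp add: word2_def ahom_mult s)
  ultimately show ?thesis
    using assms unfolding Wone_def
    by (auto simp: cs_mult cs_minus_left word2_def[symmetric] intro: cspan_base cspan_neg)
qed

section \<open>The tensor square and the coproduct\<close>

definition tv :: "(key \<Rightarrow>\<^sub>0 complex) \<Rightarrow> (key \<Rightarrow>\<^sub>0 complex) \<Rightarrow> (key \<times> key \<Rightarrow>\<^sub>0 complex)" where
  "tv u v = lext (\<lambda>m. lext (\<lambda>n. single (m, n) 1) v) u"

lemma lin_tv_left: "lin (\<lambda>u. tv u v)"
  unfolding tv_def by (rule lin_lext)

lemma lin_tv_right: "lin (tv u)"
  unfolding tv_def by (rule lin_arg_cs_fun) (rule lin_lext)

lemmas [lsimps] = lin_simps[OF lin_tv_left] lin_simps[OF lin_tv_right]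

lemma tv_bs [simp]: "tv (bs m) (bs n) = single (m, n) 1"
  by (simp add: tv_def)

lemma lookup_tv: "lookup (tv u v) (m, n) = lookup u m * lookup v n"
proof -
  have lin: "lin (\<lambda>D :: key \<times> key \<Rightarrow>\<^sub>0 complex. lookup D (m, n))"
    by (simp add: lin_def lookup_add)
  show ?thesis
    by (rule lin_ext2[of "\<lambda>u v. lookup (tv u v) (m, n)"])
      (auto simp: lin_def lsimps lookup_add algebra_simps lookup_single when_def)
qed

definition nf2 :: "complex \<Rightarrow> free_tens \<Rightarrow> (key \<times> key \<Rightarrow>\<^sub>0 complex)" where
  "nf2 t = lext (\<lambda>p. tv (nf t (mon (fst p))) (nf t (mon (snd p))))"

lemma lin_nf2: "lin (nf2 t)"
  by (simp add: nf2_def)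

lemmas [lsimps] = lin_simps[OF lin_nf2]

lemma nf2_tens: "nf2 t (tens x y) = tv (nf t x) (nf t y)"
  by (rule lin_ext2[of "\<lambda>x y. nf2 t (tens x y)"]) (simp_all add: lin_def lsimps, simp add: nf2_def)

lemma tens_ker_0: "0 \<in> tens_ker t"
  by (auto simp: tens_ker_def Let_def intro!: exI[of _ "{}"])

text \<open>The pairs of a representation form a set; a pair that already occurs is replaced by a
  rescaling \<open>(z x, y / z)\<close> that does not.\<close>

lemma tens_ker_add1:
  assumes D: "D \<in> tens_ker t" and xy: "x \<in> aidl t \<or> y \<in> aidl t"
  shows "tens x y + D \<in> tens_ker t"
proof (cases "x = 0")
  case True
  then show ?thesis using D by (simp add: lsimps)
next
  case False
  from D obtain S where S: "finite S" "S \<subseteq> aidl t \<times> UNIV \<union> UNIV \<times> aidl t"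
    and D: "D = (\<Sum>(x, y)\<in>S. tens x y)" by (auto simp: tens_ker_def Let_def)
  obtain k where k: "lookup x k \<noteq> 0" using False by (metis lookup_zero poly_mapping_eqI)
  let ?f = "\<lambda>z. (z \<cdot> x, inverse z \<cdot> y)"
  have "inj ?f"
  proof (rule injI)
    fix z w assume "?f z = ?f w"
    then have "lookup (z \<cdot> x) k = lookup (w \<cdot> x) k" by simp
    then show "z = w" using k by simp
  qed
  then have "finite (?f -` S)" using S(1) by (rule finite_vimageI[rotated])
  then have "finite (insert 0 (?f -` S))" by simp
  then obtain z where "z \<notin> insert 0 (?f -` S)" using ex_new_if_finite[OF infinite_UNIV_char_0] by blast
  then have z: "z \<noteq> 0" "?f z \<notin> S" by auto
  have "tens (z \<cdot> x) (inverse z \<cdot> y) = tens x y" using z by (simp add: lsimps cs_cs)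
  then have "tens x y + D = (\<Sum>(x, y)\<in>insert (?f z) S. tens x y)"
    using z S(1) by (simp add: D)
  moreover have "insert (?f z) S \<subseteq> aidl t \<times> UNIV \<union> UNIV \<times> aidl t"
    using S(2) xy by (auto intro: idl_cs)
  ultimately show ?thesis using S(1) unfolding tens_ker_def Let_def by blast
qed

lemma tens_ker_induct [consumes 1, case_names zero add]:
  assumes "D \<in> tens_ker t" "P 0"
    "\<And>x y D. x \<in> aidl t \<or> y \<in> aidl t \<Longrightarrow> D \<in> tens_ker t \<Longrightarrow> P D \<Longrightarrow> P (tens x y + D)"
  shows "P D"
proof -
  from assms(1) obtain S where S: "finite S" "S \<subseteq> aidl t \<times> UNIV \<union> UNIV \<times> aidl t"
    and D: "D = (\<Sum>(x, y)\<in>S. tens x y)" by (auto simp: tens_ker_def Let_def)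
  from S have "(\<Sum>(x, y)\<in>S. tens x y) \<in> tens_ker t \<and> P (\<Sum>(x, y)\<in>S. tens x y)"
    by (induction S) (auto simp: tens_ker_0 assms intro!: assms tens_ker_add1)
  then show ?thesis by (simp add: D)
qed

lemma tens_ker_base: "x \<in> aidl t \<or> y \<in> aidl t \<Longrightarrow> tens x y \<in> tens_ker t"
  using tens_ker_add1[OF tens_ker_0] by simp

lemma tens_ker_add: "D \<in> tens_ker t \<Longrightarrow> E \<in> tens_ker t \<Longrightarrow> D + E \<in> tens_ker t"
  by (induction rule: tens_ker_induct) (auto simp: add.assoc intro: tens_ker_add1)

lemma tens_ker_cs: "D \<in> tens_ker t \<Longrightarrow> z \<cdot> D \<in> tens_ker t"
proof (induction rule: tens_ker_induct)
  case (add x y D)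
  have "tens (z \<cdot> x) y + z \<cdot> D \<in> tens_ker t"
    using add by (intro tens_ker_add1) (auto intro: idl_cs)
  then show ?case by (simp add: lsimps cs_add)
qed (simp add: tens_ker_0)

lemma tens_ker_sum: "(\<And>i. i \<in> S \<Longrightarrow> f i \<in> tens_ker t) \<Longrightarrow> sum f S \<in> tens_ker t"
  by (induction S rule: infinite_finite_induct) (auto intro: tens_ker_0 tens_ker_add)

text \<open>Pairs of normal words form a basis of the tensor square of A, so membership in I
  \<otimes> F + F \<otimes> I can be computed.\<close>

lemma tens_ker_nf2:
  assumes t: "t \<noteq> 0"
  shows "D \<in> tens_ker t \<longleftrightarrow> nf2 t D = 0"
proof
  assume "D \<in> tens_ker t"
  then show "nf2 t D = 0"
    by (induction rule: tens_ker_induct) (auto simp: lsimps nf2_tens nf_idl[OF t])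
next
  assume 0: "nf2 t D = 0"
  let ?r = "lext (\<lambda>p. tens (nw (fst p)) (nw (snd p))) :: _ \<Rightarrow> free_tens"
  have r: "?r (tv u v) = tens (realz u) (realz v)" for u v
    by (rule lin_ext2[of "\<lambda>u v. ?r (tv u v)"]) (simp_all add: lin_def lsimps)
  have 1: "tens x y - tens (realz (nf t x)) (realz (nf t y)) \<in> tens_ker t" for x y
  proof -
    have "x - realz (nf t x) \<in> aidl t" "y - realz (nf t y) \<in> aidl t"
      using cong_sym[OF realz_nf[OF t]] by (simp_all add: cong_def)
    \<comment> \<open>Replacing one tensor factor at a time by its normal form leaves an error with
      a factor in the ideal.\<close>
    then have "tens (x - realz (nf t x)) y + tens (realz (nf t x)) (y - realz (nf t y)) \<in> tens_ker t"
      by (intro tens_ker_add tens_ker_base) auto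
    then show ?thesis by (simp add: lsimps)
  qed
  have "D - ?r (nf2 t D) = lext (\<lambda>p. single p 1 - ?r (nf2 t (single p 1))) D"
    by (rule lin_ext[of "\<lambda>D. D - ?r (nf2 t D)"]) (simp_all add: lin_def lsimps cs_diff)
  also have "\<dots> \<in> tens_ker t"
    unfolding lext_def[of _ D]
  proof (intro tens_ker_sum tens_ker_cs)
    fix p :: "agen list \<times> agen list"
    show "single p 1 - ?r (nf2 t (single p 1)) \<in> tens_ker t"
      using 1[of "mon (fst p)" "mon (snd p)"] by (simp add: nf2_def r)
  qed
  finally show "D \<in> tens_ker t" by (simp add: 0 lsimps)
qed

lemma tens_cls_eq:
  assumes "t \<noteq> 0"
  shows "tens_cls t D = {E. nf2 t E = nf2 t D}"
proof -
  have "tens_cls t D = {E. \<exists>h\<in>tens_ker t. E = h + D}"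
    by (auto simp: tens_cls_def a_r_coset_def r_coset_def free_tens_ring_def)
  also have "\<dots> = {E. E - D \<in> tens_ker t}"
  proof -
    have "E = h + D \<longleftrightarrow> h = E - D" for E h by auto
    then show ?thesis by simp
  qed
  finally show ?thesis by (simp add: tens_ker_nf2[OF assms] lsimps)
qed

lemma tens_cls_cong: "t \<noteq> 0 \<Longrightarrow> tens_cls t D = tens_cls t E \<longleftrightarrow> nf2 t D = nf2 t E"
  by (auto simp: tens_cls_eq set_eq_iff)

lemma AA_simps:
  assumes "t \<noteq> 0"
  shows "carrier (AA t) = range (tens_cls t)" "\<zero>\<^bsub>AA t\<^esub> = tens_cls t 0"
    "tens_cls t D \<oplus>\<^bsub>AA t\<^esub> tens_cls t E = tens_cls t (D + E)"
proof -
  show "carrier (AA t) = range (tens_cls t)"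
    by (auto simp: AA_def FactRing_def A_RCOSETS_def RCOSETS_def tens_cls_def a_r_coset_def free_tens_ring_def)
  show "\<zero>\<^bsub>AA t\<^esub> = tens_cls t 0"
    by (auto simp: AA_def FactRing_def tens_cls_eq[OF assms] tens_ker_nf2[OF assms] lsimps)
  have "tens_cls t D \<oplus>\<^bsub>AA t\<^esub> tens_cls t E = (\<Union>h\<in>tens_cls t D. \<Union>k\<in>tens_cls t E. {h + k})"
    by (simp add: AA_def FactRing_def set_add_def set_mult_def free_tens_ring_def)
  also have "\<dots> = tens_cls t (D + E)"
  proof (intro equalityI subsetI)
    fix x assume "x \<in> tens_cls t (D + E)"
    then have "x - E \<in> tens_cls t D" "E \<in> tens_cls t E"
      by (simp_all add: tens_cls_eq[OF assms] lsimps)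
    then show "x \<in> (\<Union>h\<in>tens_cls t D. \<Union>k\<in>tens_cls t E. {h + k})" by force
  qed (auto simp: tens_cls_eq[OF assms] lsimps)
  finally show "tens_cls t D \<oplus>\<^bsub>AA t\<^esub> tens_cls t E = tens_cls t (D + E)" .
qed

lemma abelian_monoid_AA: "t \<noteq> 0 \<Longrightarrow> abelian_monoid (AA t)"
  by (rule abelian_monoidI) (auto simp: AA_simps algebra_simps)

lemma AA_finsum:
  assumes t: "t \<noteq> 0" and S: "finite S" "\<And>j. j \<in> S \<Longrightarrow> F j = tens_cls t (f j)"
  shows "(\<Oplus>\<^bsub>AA t\<^esub>j\<in>S. F j) = tens_cls t (\<Sum>j\<in>S. f j)"
proof -
  interpret abelian_monoid "AA t" by (rule abelian_monoid_AA[OF t])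
  have "(\<Oplus>\<^bsub>AA t\<^esub>j\<in>S. F j) = (\<Oplus>\<^bsub>AA t\<^esub>j\<in>S. tens_cls t (f j))"
    by (rule finsum_cong') (use S(2) in \<open>auto simp: AA_simps[OF t]\<close>)
  also have "\<dots> = tens_cls t (\<Sum>j\<in>S. f j)"
    using S(1) by (induction S) (auto simp: AA_simps[OF t])
  finally show ?thesis .
qed

lemma A_tens_cls:
  assumes t: "t \<noteq> 0"
  shows "A_tens t (acls t x) (acls t y) = tens_cls t (tens x y)"
  unfolding A_tens_def
proof (rule the_elem_const)
  fix p assume "p \<in> acls t x \<times> acls t y"
  then show "(case p of (x, y) \<Rightarrow> tens_cls t (tens x y)) = tens_cls t (tens x y)"
    by (cases p) (simp add: mem_cls cong_nf[OF t] tens_cls_cong[OF t] nf2_tens)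
qed (use cls_nonempty in blast)

text \<open>A power of the grading automorphism: the sign created by moving an element of parity
  \<open>p\<close> past x (\<open>tens_mult_left\<close>).\<close>

definition sd :: "nat \<Rightarrow> agen free_alg \<Rightarrow> agen free_alg" where
  "sd p = diag (\<lambda>g. (-1) ^ (p * apar g))"

lemmas [lsimps] = lin_simps[OF lin_diag[of "\<lambda>g. (-1) ^ (p * apar g)" for p], folded sd_def]

lemma sd_mon: "sd p (mon w) = (-1) ^ (p * word_parity apar w) \<cdot> mon w"
  by (induction w) (simp_all add: sd_def mon_Nil mon_Cons diag_mult cs_mult cs_cs power_add distrib_left mult.commute)

lemma sd_idl:
  assumes t: "t \<noteq> 0" and x: "x \<in> aidl t"
  shows "sd p x \<in> aidl t"
  unfolding sd_def
proof (rule diag_idl[OF x])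
  fix r assume r: "r \<in> arels t"
  define e :: complex where "e = (-1) ^ p"
  have e: "e * e = 1" by (simp add: e_def)
  show "diag (\<lambda>g. (-1) ^ (p * apar g)) r \<in> aidl t"
    by (rule arels_all[OF _ _ _ _ _ _ _ _ r, of "\<lambda>r. diag (\<lambda>g. (-1) ^ (p * apar g)) r \<in> aidl t"];
      simp add: idl_nf[OF t] diag_mult nf_eval t e e_def[symmetric];
      (rule poly_mapping_eqI; simp add: lookup_linear lookup_single when_def field_simps t e)?)
qed

lemma tens_single: "tens (single u x) (single v y) = single (u, v) (x * y)"
  by (simp add: tens_lext cs_single)

lemma tens_mult_left: "tens_mult (single (z, w) 1) (tens x y)
    = tens (mon z * sd (word_parity apar w) x) (mon w * y)"
  by (rule lin_ext2[of "\<lambda>x y. tens_mult (single (z, w) 1) (tens x y)"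
      "\<lambda>x y. tens (mon z * sd (word_parity apar w) x) (mon w * y)"])
    (simp_all add: lin_def lsimps distrib_left distrib_right cs_mult,
     simp add: tens_mult_single tmul_def sd_mon lsimps cs_mult single_mult cs_single tens_single)

lemma tens_mult_right: "tens_mult (tens x y) (single (z, w) 1)
    = tens (x * mon z) (sd (word_parity apar z) y * mon w)"
  by (rule lin_ext2[of "\<lambda>x y. tens_mult (tens x y) (single (z, w) 1)"
      "\<lambda>x y. tens (x * mon z) (sd (word_parity apar z) y * mon w)"])
    (simp_all add: lin_def lsimps distrib_left distrib_right cs_mult,
     simp add: tens_mult_single tmul_def sd_mon lsimps cs_mult single_mult cs_single tens_single mult.commute)

text \<open>The grading signs preserve the ideal since the relations are homogeneous
  (\<open>sd_idl\<close>), so the kernel is stable under multiplication on this side.\<close>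

lemma tens_ker_left: "t \<noteq> 0 \<Longrightarrow> D \<in> tens_ker t \<Longrightarrow> tens_mult E D \<in> tens_ker t"
proof -
  assume t: "t \<noteq> 0" and D: "D \<in> tens_ker t"
  have 1: "tens_mult (single (z, w) 1) D \<in> tens_ker t" for z w
    using D
  proof (induction rule: tens_ker_induct)
    case (add x y D)
    then show ?case unfolding lin_plus[OF lin_tens_mult_right] tens_mult_left
      by (intro tens_ker_add1) (auto intro: idl_mult sd_idl[OF t])
  qed (simp add: lsimps tens_ker_0)
  have "tens_mult E D = lext (\<lambda>p. tens_mult (single p 1) D) E"
    by (rule lin_eq_lext[OF lin_tens_mult_left])
  then show ?thesis unfolding lext_def using 1 by (auto intro!: tens_ker_sum tens_ker_cs)
qed

lemma tens_ker_right: "t \<noteq> 0 \<Longrightarrow> D \<in> tens_ker t \<Longrightarrow> tens_mult D E \<in> tens_ker t"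
proof -
  assume t: "t \<noteq> 0" and D: "D \<in> tens_ker t"
  have 1: "tens_mult D (single (z, w) 1) \<in> tens_ker t" for z w
    using D
  proof (induction rule: tens_ker_induct)
    case (add x y D)
    then show ?case unfolding lin_plus[OF lin_tens_mult_left] tens_mult_right
      by (intro tens_ker_add1) (auto intro: idl_mult sd_idl[OF t])
  qed (simp add: lsimps tens_ker_0)
  have "tens_mult D E = lext (\<lambda>p. tens_mult D (single p 1)) E"
    by (rule lin_eq_lext[OF lin_tens_mult_right])
  then show ?thesis unfolding lext_def using 1 by (auto intro!: tens_ker_sum tens_ker_cs)
qed

lemma tens_mult_assoc: "tens_mult (tens_mult D E) G = tens_mult D (tens_mult E G)"
proof (rule lin_ext2[of "\<lambda>D E. tens_mult (tens_mult D E) G" "\<lambda>D E. tens_mult D (tens_mult E G)"])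
  fix k l :: "agen list \<times> agen list"
  show "tens_mult (tens_mult (single k 1) (single l 1)) G =
    tens_mult (single k 1) (tens_mult (single l 1) G)"
    by (rule lin_ext[of "\<lambda>G. tens_mult (tens_mult (single k 1) (single l 1)) G"])
      (simp_all add: lin_def lsimps,
       simp add: tens_mult_single tmul_def cs_single power_add distrib_left distrib_right mult_ac)
qed (simp_all add: lin_def lsimps)

lemma tens_mult_one: "tens_mult (single ([], []) 1) D = D"
  by (rule lin_ext[of "tens_mult (single ([], []) 1)" "\<lambda>D. D"])
    (simp_all add: lin_tens_mult_right lin_id tens_mult_single tmul_def)

lemma coprod_free_mult: "coprod_free (x * y) = tens_mult (coprod_free x) (coprod_free y)"
proof (rule lin_ext2[of "\<lambda>x y. coprod_free (x * y)" "\<lambda>x y. tens_mult (coprod_free x) (coprod_free y)"])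
  fix v w :: "agen list"
  show "coprod_free (mon v * mon w) = tens_mult (coprod_free (mon v)) (coprod_free (mon w))"
    by (induction v) (simp_all add: single_mult tens_mult_one tens_mult_assoc)
qed (simp_all add: lin_def lsimps algebra_simps cs_mult)

lemma coprod_free_gen: "coprod_free (gen g) = coprod_gen g"
proof -
  have "tens_mult D (single ([], []) 1) = D" for D
    by (rule lin_ext[of "\<lambda>D. tens_mult D (single ([], []) 1)" "\<lambda>D. D"])
      (simp_all add: lin_tens_mult_left lin_id tens_mult_single tmul_def)
  then show ?thesis by (simp add: gen_def)
qed

lemma coprod_free_1: "coprod_free 1 = single ([], []) 1"
  by (simp flip: mon_Nil)

lemma nf2_single: "nf2 t (single (v, w) z) = z \<cdot> tv (nf t (mon v)) (nf t (mon w))"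
  by (simp add: nf2_def)

text \<open>The coproduct descends to A. As \<open>tens_ker\<close> absorbs products from both
  sides, only the relations have to be evaluated.\<close>

lemma coprod_idl:
  assumes t: "t \<noteq> 0" and x: "x \<in> aidl t"
  shows "coprod_free x \<in> tens_ker t"
  using x
proof (induction rule: idl_induct)
  case (rel r)
  show ?case
    by (rule arels_all[OF _ _ _ _ _ _ _ _ rel, of "\<lambda>r. coprod_free r \<in> tens_ker t"];
      simp add: tens_ker_nf2[OF t] lsimps coprod_free_mult coprod_free_gen coprod_free_1 tens_gen tens_mult_single
        tmul_def nf2_single mon_Cons mon_Nil nf_eval t;
      (rule poly_mapping_eqI; simp add: lookup_linear lookup_single when_def field_simps t power2_eq_square)?)
qed (auto simp: lsimps coprod_free_mult intro: tens_ker_0 tens_ker_add tens_ker_left[OF t] tens_ker_right[OF t])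

lemma coprod_cls:
  assumes t: "t \<noteq> 0"
  shows "coprod t (acls t u) = tens_cls t (coprod_free u)"
  unfolding coprod_def
proof (rule the_elem_const)
  fix v assume "v \<in> acls t u"
  then have "coprod_free (v - u) \<in> tens_ker t"
    by (intro coprod_idl[OF t]) (simp add: mem_cls cong_def)
  then show "tens_cls t (coprod_free v) = tens_cls t (coprod_free u)"
    by (simp add: tens_cls_cong[OF t] tens_ker_nf2[OF t] lsimps)
qed (use cls_nonempty in blast)

section \<open>Matrix elements\<close>

lemma sd_0 [simp]: "sd 0 x = x"
  by (simp add: sd_def)

fun par :: "key \<Rightarrow> nat" where "par (i, j, k, s) = j + k"

lemma diag_pow: "diag \<kappa> (x ^ n) = diag \<kappa> x ^ n"
  by (simp add: diag_def ahom_pow)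

lemma cs_pow: "(z \<cdot> x) ^ n = z ^ n \<cdot> x ^ n" for x :: "'g free_alg"
  by (induction n) (simp_all add: cs_mult cs_cs mult.commute)

lemma sd_nw: "sd p (nw n) = (-1) ^ (p * par n) \<cdot> nw n"
proof -
  obtain i j k s where n: "n = (i, j, k, s)" by (cases n)
  have "sd p (pw i) = pw i" "sd p (sw s) = sw s"
    by (simp_all add: sd_def pw_def sw_def diag_pow)
  moreover have "sd p (gen Ab ^ j) = (-1) ^ (p * j) \<cdot> gen Ab ^ j" "sd p (gen Ac ^ k) = (-1) ^ (p * k) \<cdot> gen Ac ^ k"
    by (simp_all add: sd_def diag_pow cs_pow power_mult)
  ultimately show ?thesis
    unfolding n nw.simps sd_def diag_mult by (simp add: cs_mult cs_cs power_add distrib_left mult.commute)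
qed

lemma nf_sd:
  assumes t: "t \<noteq> 0" and u: "nf t u = z \<cdot> bs n"
  shows "nf t (sd p u) = ((-1) ^ (p * par n) * z) \<cdot> bs n"
proof -
  have "nf t u = nf t (z \<cdot> nw n)" by (simp add: u lsimps)
  then have "acong t u (z \<cdot> nw n)" by (simp only: cong_nf[OF t])
  then have "sd p (u - z \<cdot> nw n) \<in> aidl t" unfolding cong_def by (rule sd_idl[OF t])
  then have "nf t (sd p u) = nf t (z \<cdot> sd p (nw n))" by (simp add: idl_nf[OF t] lsimps)
  then show ?thesis by (simp add: sd_nw lsimps cs_cs mult.commute)
qed

text \<open>The vector \<xi> without its constant, for N = 2 l and j = l + i.\<close>

definition yw :: "nat \<Rightarrow> nat \<Rightarrow> agen free_alg" where
  "yw N j = gen Aa ^ (N - j) * gen Ac ^ j"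

definition wN :: "nat \<Rightarrow> nat \<Rightarrow> agen list" where
  "wN N n = replicate (N - n) Aa @ replicate n Ac"

text \<open>For g = a or g = c the coproduct of g is g \<otimes> a + \<open>nxt g\<close> \<otimes>
  c.\<close>

definition nxt :: "agen \<Rightarrow> agen" where
  "nxt g = (if g = Aa then Ab else Ad)"

text \<open>The coefficient of \<open>a\<^bsup>N - j\<^esup> c\<^bsup>j\<^esup>\<close> in the coproduct of a word of length \<open>N\<close> in \<open>a\<close> and \<open>c\<close>.\<close>

primrec cfw :: "complex \<Rightarrow> agen list \<Rightarrow> nat \<Rightarrow> agen free_alg" where
  "cfw t [] j = (if j = 0 then 1 else 0)"
| "cfw t (g # w) j = gen g * cfw t w j +
     (if j = 0 then 0 else inverse t ^ (length w + 1 - j) \<cdot> (gen (nxt g) * sd 1 (cfw t w (j - 1))))"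

lemma cfw_0: "j > length w \<Longrightarrow> cfw t w j = 0"
  by (induction w arbitrary: j) (auto simp: lsimps)

lemma mon_replicate: "mon (replicate n g) = gen g ^ n"
  by (induction n) (simp_all add: mon_Nil mon_Cons)

lemma mon_append: "mon (v @ w) = mon v * mon w"
  by (simp add: single_mult)

lemma mon_wN: "mon (wN N n) = yw N n"
  unfolding wN_def yw_def mon_append mon_replicate ..

lemma nf_yw: "nf t (yw N j) = bs (int (N - j), 0, j, False)"
proof -
  have "yw N j = nw (int (N - j), 0, j, False)"
    by (simp add: yw_def pw_def sw_def)
  then show ?thesis by (simp only: nf_nw)
qed

lemma nf2_cong_left:
  assumes "t \<noteq> 0" "nf2 t D = nf2 t E"
  shows "nf2 t (tens_mult G D) = nf2 t (tens_mult G E)" "nf2 t (tens_mult D G) = nf2 t (tens_mult E G)"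
proof -
  have "D - E \<in> tens_ker t" using assms by (simp add: tens_ker_nf2 lsimps)
  then have "nf2 t (tens_mult G (D - E)) = 0" "nf2 t (tens_mult (D - E) G) = 0"
    using tens_ker_left[OF assms(1)] tens_ker_right[OF assms(1)] tens_ker_nf2[OF assms(1)] by blast+
  then show "nf2 t (tens_mult G D) = nf2 t (tens_mult G E)" "nf2 t (tens_mult D G) = nf2 t (tens_mult E G)"
    by (simp_all add: lsimps)
qed

text \<open>Prefixing a letter multiplies by g \<otimes> a + \<open>nxt g\<close> \<otimes> c. The
  odd c passes the first factors, whence \<open>sd 1\<close>, and then the power of a in the second
  factor, whence the power of 1/t.\<close>

lemma coprod_cfw:
  assumes t: "t \<noteq> 0" and w: "set w \<subseteq> {Aa, Ac}"
  shows "nf2 t (coprod_word w) = nf2 t (\<Sum>j\<le>length w. tens (cfw t w j) (yw (length w) j))"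
  using w
proof (induction w)
  case Nil
  then show ?case by (simp add: yw_def mon_Nil flip: tens_mon)
next
  case (Cons g w)
  let ?M = "length w"
  let ?Y = "\<lambda>j. nf t (yw (Suc ?M) j)"
  have cg: "coprod_gen g = single ([g], [Aa]) 1 + single ([nxt g], [Ac]) 1"
    using Cons.prems by (auto simp: nxt_def tens_gen)
  have Y: "nf t (gen Aa * yw ?M j) = ?Y j" "nf t (gen Ac * yw ?M j) = inverse t ^ (?M - j) \<cdot> ?Y (Suc j)"
    if "j \<le> ?M" for j
    using that by (simp_all add: nf_gen_mult nf_yw Suc_diff_le bt_def add.commute del: of_nat_diff)
  let ?p = "\<lambda>j. tv (nf t (gen g * cfw t w j)) (?Y j)"
  let ?r = "\<lambda>j. inverse t ^ (?M - j) \<cdot> tv (nf t (gen (nxt g) * sd 1 (cfw t w j))) (?Y (Suc j))"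
  have "nf2 t (coprod_word (g # w)) = nf2 t (tens_mult (coprod_gen g) (\<Sum>j\<le>?M. tens (cfw t w j) (yw ?M j)))"
    using nf2_cong_left(1)[OF t Cons.IH] Cons.prems by simp
  also have "\<dots> = (\<Sum>j\<le>?M. ?p j) + (\<Sum>j\<le>?M. ?r j)"
    unfolding cg lin_plus[OF lin_tens_mult_left] lin_sum[OF lin_tens_mult_right] lin_plus[OF lin_nf2] lin_sum[OF lin_nf2]
    by (subst sum.distrib[symmetric], rule sum.cong)
      (simp_all add: tens_mult_left nf2_tens Y mon_Cons mon_Nil lsimps)
  also have "(\<Sum>j\<le>?M. ?p j) = (\<Sum>j\<le>Suc ?M. ?p j)"
    by (simp add: cfw_0 lsimps)
  also have "(\<Sum>j\<le>?M. ?r j) = (\<Sum>j\<le>Suc ?M. if j = 0 then 0 else ?r (j - 1))"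
    unfolding sum.atMost_Suc_shift by simp
  also have "(\<Sum>j\<le>Suc ?M. ?p j) + (\<Sum>j\<le>Suc ?M. if j = 0 then 0 else ?r (j - 1))
      = (\<Sum>j\<le>Suc ?M. tv (nf t (cfw t (g # w) j)) (?Y j))"
    unfolding sum.distrib[symmetric]
    by (intro sum.cong refl) (auto simp: lsimps gr0_conv_Suc)
  also have "\<dots> = nf2 t (\<Sum>j\<le>length (g # w). tens (cfw t (g # w) j) (yw (length (g # w)) j))"
    unfolding lin_sum[OF lin_nf2] nf2_tens length_Cons ..
  finally show ?case .
qed

section \<open>Indexing by natural numbers; existence and uniqueness of the matrix elements\<close>

definition ix :: "nat \<Rightarrow> nat \<Rightarrow> rat" where
  "ix N n = of_nat n - of_nat N / 2"

lemma idx_ix: "idx (of_nat N / 2) = ix N ` {..N}"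
proof -
  have "i \<in> ix N ` {..N}" if "i = - (of_nat N / 2) + of_nat r" "i \<le> of_nat N / 2" for i :: rat and r
  proof -
    have "(of_nat r :: rat) \<le> of_nat N" using that by (simp add: field_simps)
    then show ?thesis using that by (auto simp: ix_def)
  qed
  moreover have "\<exists>r::nat. ix N n = - (of_nat N / 2) + of_nat r \<and> ix N n \<le> of_nat N / 2" if "n \<le> N" for n
  proof (intro exI conjI)
    show "ix N n = - (of_nat N / 2) + of_nat n" by (simp add: ix_def)
    have "(of_nat n :: rat) \<le> of_nat N" using that by simp
    then show "ix N n \<le> of_nat N / 2" by (simp add: ix_def field_simps)
  qed
  ultimately show ?thesis unfolding idx_def by auto
qed

lemma inj_ix: "inj (ix N)"
  by (auto simp: inj_def ix_def)

definition cf :: "(nat \<Rightarrow> nat \<Rightarrow> complex) \<Rightarrow> nat \<Rightarrow> nat \<Rightarrow> complex" where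
  "cf rt N n = \<i> ^ (n div 2) * rt N n"

definition pos :: "nat \<Rightarrow> rat \<Rightarrow> nat" where
  "pos N i = nat \<lfloor>i + of_nat N / 2\<rfloor>"

lemma pos_ix [simp]: "pos N (ix N n) = n"
  by (simp add: pos_def ix_def)

lemma xi_ix:
  assumes "n \<le> N"
  shows "xi t rt (of_nat N / 2) (ix N n) = acls t (cf rt N n \<cdot> yw N n)"
proof -
  let ?l = "of_nat N / 2 :: rat"
  have 1: "?l + ix N n = of_nat n" "?l - ix N n = of_nat (N - n)"
    using assms by (simp_all add: ix_def of_nat_diff)
  have "\<lfloor>(of_nat n :: rat) / 2\<rfloor> = int (n div 2)"
    using floor_divide_of_nat_eq[of n 2, where ?'a = rat] by simp
  then have 2: "nat \<lfloor>(?l + ix N n) / 2\<rfloor> = n div 2" unfolding 1 by simp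
  have 3: "nat \<lfloor>2 * ?l\<rfloor> = N" by simp
  show ?thesis
    unfolding xi_def 2 3 unfolding 1 by (simp add: cf_def yw_def const_mult cs_mult)
qed

lemma sigma_pow: "sigma t [^]\<^bsub>A t\<^esub> (s::nat) = acls t (gen Asigma ^ s)"
  by (simp add: sigma_def cls_pow)

lemma matrix_sum:
  assumes t: "t \<noteq> 0" and m: "\<And>j. j \<le> N \<Longrightarrow> m (ix N j) = acls t (p j)"
  shows "(\<Oplus>\<^bsub>AA t\<^esub>j\<in>idx (of_nat N / 2). A_tens t (m j \<otimes>\<^bsub>A t\<^esub> sigma t [^]\<^bsub>A t\<^esub> (s::nat))
      (xi t rt (of_nat N / 2) j \<otimes>\<^bsub>A t\<^esub> sigma t [^]\<^bsub>A t\<^esub> s)) =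
    tens_cls t (\<Sum>j\<le>N. tens (p j * gen Asigma ^ s) (cf rt N j \<cdot> yw N j * gen Asigma ^ s))"
proof -
  let ?f = "\<lambda>j. tens (p j * gen Asigma ^ s) (cf rt N j \<cdot> yw N j * gen Asigma ^ s)"
  have "(\<Oplus>\<^bsub>AA t\<^esub>j\<in>idx (of_nat N / 2). A_tens t (m j \<otimes>\<^bsub>A t\<^esub> sigma t [^]\<^bsub>A t\<^esub> s)
      (xi t rt (of_nat N / 2) j \<otimes>\<^bsub>A t\<^esub> sigma t [^]\<^bsub>A t\<^esub> s)) =
      tens_cls t (\<Sum>j\<in>idx (of_nat N / 2). ?f (pos N j))"
  proof (rule AA_finsum[OF t])
    fix i assume "i \<in> idx (of_nat N / 2)"
    then obtain j where j: "i = ix N j" "j \<le> N" by (auto simp: idx_ix)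
    then show "A_tens t (m i \<otimes>\<^bsub>A t\<^esub> sigma t [^]\<^bsub>A t\<^esub> s) (xi t rt (of_nat N / 2) i \<otimes>\<^bsub>A t\<^esub> sigma t [^]\<^bsub>A t\<^esub> s) =
        tens_cls t (?f (pos N i))"
      by (simp add: m xi_ix sigma_pow cls_mult A_tens_cls[OF t] pos_ix)
  qed (simp add: idx_ix)
  also have "(\<Sum>j\<in>idx (of_nat N / 2). ?f (pos N j)) = (\<Sum>j\<le>N. ?f j)"
    unfolding idx_ix by (subst sum.reindex) (simp_all add: inj_on_subset[OF inj_ix] pos_ix)
  finally show ?thesis .
qed

lemma coprod_xi:
  assumes t: "t \<noteq> 0" and n: "n \<le> N" and s: "s \<in> {0, 1::nat}"
  shows "coprod t (xi t rt (of_nat N / 2) (ix N n) \<otimes>\<^bsub>A t\<^esub> sigma t [^]\<^bsub>A t\<^esub> s) =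
    tens_cls t (\<Sum>j\<le>N. tens ((cf rt N n \<cdot> cfw t (wN N n) j) * gen Asigma ^ s) (yw N j * gen Asigma ^ s))"
proof -
  let ?s = "replicate s Asigma"
  have len: "length (wN N n) = N" and sub: "set (wN N n) \<subseteq> {Aa, Ac}"
    using n by (auto simp: wN_def)
  have cs: "coprod_free (gen Asigma ^ s) = single (?s, ?s) 1"
    using s by (auto simp: coprod_free_1 coprod_free_gen tens_gen)
  have ps: "word_parity apar ?s = 0" using s by auto
  have "coprod_free (cf rt N n \<cdot> yw N n * gen Asigma ^ s) =
      cf rt N n \<cdot> tens_mult (coprod_word (wN N n)) (single (?s, ?s) 1)"
    by (simp add: cs_mult lsimps coprod_free_mult cs flip: mon_wN)
  then have "nf2 t (coprod_free (cf rt N n \<cdot> yw N n * gen Asigma ^ s)) =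
      cf rt N n \<cdot> nf2 t (tens_mult (\<Sum>j\<le>N. tens (cfw t (wN N n) j) (yw N j)) (single (?s, ?s) 1))"
    using nf2_cong_left(2)[OF t coprod_cfw[OF t sub]] by (simp add: lsimps len)
  also have "\<dots> = nf2 t (\<Sum>j\<le>N. tens ((cf rt N n \<cdot> cfw t (wN N n) j) * gen Asigma ^ s) (yw N j * gen Asigma ^ s))"
    unfolding lin_sum[OF lin_tens_mult_left] tens_mult_right ps mon_replicate sd_0
    by (simp add: lin_sum[OF lin_nf2] cs_sum cs_mult lsimps)
  finally show ?thesis
    by (simp add: xi_ix[OF n] sigma_pow cls_mult coprod_cls[OF t] tens_cls_cong[OF t])
qed

text \<open>The quotient of constants turns coefficients of a^(N-j) c^j into coefficients of \<xi>.
  Since \<sigma> is even and group-like, the equation for s = 1 is the one for s = 0 multiplied by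
  \<sigma> on the right.\<close>

lemma is_matrix_elements_cfw:
  assumes t: "t \<noteq> 0" and rt: "\<And>j. j \<le> N \<Longrightarrow> cf rt N j \<noteq> 0"
  shows "is_matrix_elements t rt (of_nat N / 2)
    (\<lambda>i j. acls t ((cf rt N (pos N i) / cf rt N (pos N j)) \<cdot> cfw t (wN N (pos N i)) (pos N j)))"
  unfolding is_matrix_elements_def
proof (intro conjI ballI)
  fix i and s :: nat assume "i \<in> idx (of_nat N / 2)" and s: "s \<in> {0, 1}"
  then obtain n where n: "i = ix N n" "n \<le> N" by (auto simp: idx_ix)
  let ?p = "\<lambda>j. (cf rt N n / cf rt N j) \<cdot> cfw t (wN N n) j"
  have "tens (?p j * x) (cf rt N j \<cdot> y * x) = tens ((cf rt N n \<cdot> cfw t (wN N n) j) * x) (y * x)"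
    if "j \<le> N" for j x y
    using rt[OF that] by (simp add: cs_mult lsimps cs_cs)
  then show "coprod t (xi t rt (of_nat N / 2) i \<otimes>\<^bsub>A t\<^esub> sigma t [^]\<^bsub>A t\<^esub> s) =
      (\<Oplus>\<^bsub>AA t\<^esub>j\<in>idx (of_nat N / 2). A_tens t (acls t ((cf rt N (pos N i) / cf rt N (pos N j)) \<cdot>
          cfw t (wN N (pos N i)) (pos N j)) \<otimes>\<^bsub>A t\<^esub> sigma t [^]\<^bsub>A t\<^esub> s)
        (xi t rt (of_nat N / 2) j \<otimes>\<^bsub>A t\<^esub> sigma t [^]\<^bsub>A t\<^esub> s))"
    unfolding n(1) pos_ix coprod_xi[OF t n(2) s]
    by (subst matrix_sum[OF t, where p = ?p]) (simp_all add: pos_ix)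
qed simp

text \<open>\<open>mat_elt\<close> is chosen by \<open>SOME\<close>, so its entries are known only
  because the conditions determine them: the a^(N-j) c^j are distinct basis vectors.\<close>

lemma matrix_elements_unique:
  assumes t: "t \<noteq> 0" and rt: "\<And>j. j \<le> N \<Longrightarrow> cf rt N j \<noteq> 0"
    and m: "is_matrix_elements t rt (of_nat N / 2) m" and n: "n \<le> N" and j: "j \<le> N"
  shows "m (ix N n) (ix N j) = acls t ((cf rt N n / cf rt N j) \<cdot> cfw t (wN N n) j)"
proof -
  have idx: "ix N j \<in> idx (of_nat N / 2)" if "j \<le> N" for j using that by (auto simp: idx_ix)
  define p where "p j = (SOME x. m (ix N n) (ix N j) = acls t x)" for j
  have p: "m (ix N n) (ix N j) = acls t (p j)" if "j \<le> N" for j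
  proof -
    have "m (ix N n) (ix N j) \<in> carrier (A t)"
      using m idx[OF n] idx[OF that] by (simp add: is_matrix_elements_def)
    then obtain x where "m (ix N n) (ix N j) = acls t x" by (rule carrier_cases)
    then show ?thesis unfolding p_def by (rule someI)
  qed
  have "coprod t (xi t rt (of_nat N / 2) (ix N n) \<otimes>\<^bsub>A t\<^esub> sigma t [^]\<^bsub>A t\<^esub> (0::nat)) =
      (\<Oplus>\<^bsub>AA t\<^esub>j\<in>idx (of_nat N / 2). A_tens t (m (ix N n) j \<otimes>\<^bsub>A t\<^esub> sigma t [^]\<^bsub>A t\<^esub> (0::nat))
        (xi t rt (of_nat N / 2) j \<otimes>\<^bsub>A t\<^esub> sigma t [^]\<^bsub>A t\<^esub> (0::nat)))"
    using m idx[OF n] unfolding is_matrix_elements_def by blast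
  note h = this
  have z: "0 \<in> {0, 1::nat}" by simp
  have "(\<Oplus>\<^bsub>AA t\<^esub>j\<in>idx (of_nat N / 2). A_tens t (m (ix N n) j \<otimes>\<^bsub>A t\<^esub> sigma t [^]\<^bsub>A t\<^esub> (0::nat))
        (xi t rt (of_nat N / 2) j \<otimes>\<^bsub>A t\<^esub> sigma t [^]\<^bsub>A t\<^esub> (0::nat))) =
      tens_cls t (\<Sum>j\<le>N. tens (p j * gen Asigma ^ 0) (cf rt N j \<cdot> yw N j * gen Asigma ^ 0))"
    by (rule matrix_sum[OF t]) (rule p)
  from h[unfolded coprod_xi[OF t n z] this]
  have eq: "(\<Sum>j\<le>N. cf rt N n \<cdot> tv (nf t (cfw t (wN N n) j)) (bs (int (N - j), 0, j, False))) =
      (\<Sum>j\<le>N. cf rt N j \<cdot> tv (nf t (p j)) (bs (int (N - j), 0, j, False)))"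
    by (simp add: tens_cls_cong[OF t] lin_sum[OF lin_nf2] nf2_tens nf_yw lsimps)
  have "nf t (cf rt N n \<cdot> cfw t (wN N n) j) = nf t (cf rt N j \<cdot> p j)"
  proof (rule poly_mapping_eqI)
    fix k
    \<comment> \<open>The basis vector in the second tensor factor isolates the j-th
      summand.\<close>
    have "lookup (\<Sum>j\<le>N. z j \<cdot> tv (x j) (bs (int (N - j), 0, j, False))) (k, (int (N - j), 0, j, False))
        = z j * lookup (x j) k" for z x
    proof -
      have "lookup (\<Sum>j\<le>N. z j \<cdot> tv (x j) (bs (int (N - j), 0, j, False))) (k, (int (N - j), 0, j, False))
        = (\<Sum>i\<le>N. if i = j then z j * lookup (x j) k else 0)"
        unfolding lookup_sum by (intro sum.cong refl) (auto simp: lookup_tv lookup_single when_def)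
      then show ?thesis using j by simp
    qed
    then show "lookup (nf t (cf rt N n \<cdot> cfw t (wN N n) j)) k = lookup (nf t (cf rt N j \<cdot> p j)) k"
      using arg_cong[OF eq, of "\<lambda>D. lookup D (k, (int (N - j), 0, j, False))"] by (simp add: lsimps)
  qed
  then have "inverse (cf rt N j) \<cdot> nf t (cf rt N n \<cdot> cfw t (wN N n) j) = inverse (cf rt N j) \<cdot> nf t (cf rt N j \<cdot> p j)"
    by simp
  then have "nf t (p j) = nf t ((cf rt N n / cf rt N j) \<cdot> cfw t (wN N n) j)"
    using rt[OF j] by (simp add: lsimps cs_cs divide_inverse mult.commute)
  then show ?thesis using p[OF j] by (simp add: cls_eq cong_nf[OF t])
qed

lemma mat_elt_cfw:
  assumes "t \<noteq> 0" "\<And>j. j \<le> N \<Longrightarrow> cf rt N j \<noteq> 0" "n \<le> N" "j \<le> N"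
  shows "mat_elt t rt (of_nat N / 2) (ix N n) (ix N j) = acls t ((cf rt N n / cf rt N j) \<cdot> cfw t (wN N n) j)"
proof (rule matrix_elements_unique[OF assms(1,2) _ assms(3,4)])
  show "is_matrix_elements t rt (of_nat N / 2) (mat_elt t rt (of_nat N / 2))"
    unfolding mat_elt_def by (rule someI[where P = "is_matrix_elements t rt (of_nat N / 2)"], rule is_matrix_elements_cfw[OF assms(1)]) (rule assms(2))
qed

section \<open>The extreme rows of the matrix elements\<close>

text \<open>The Gaussian binomial coefficient, by the form of Pascal's rule that the recursion of
  \<open>cfw\<close> produces. Its quotient formula, in multiplied form, is
  \<open>gb_qpoch\<close>.\<close>

fun gb :: "complex \<Rightarrow> nat \<Rightarrow> nat \<Rightarrow> complex" where
  "gb v M 0 = 1"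
| "gb v 0 (Suc j) = 0"
| "gb v (Suc M) (Suc j) = gb v M (Suc j) + v ^ (M - j) * gb v M j"

lemma gb_0: "j > M \<Longrightarrow> gb v M j = 0"
  by (induction v M j rule: gb.induct) auto

lemma qpoch_Suc: "qpoch v v (Suc n) = qpoch v v n * (1 - v ^ Suc n)"
  by (simp add: qpoch_def)

lemma gb_qpoch: "j \<le> M \<Longrightarrow> gb v M j * qpoch v v j * qpoch v v (M - j) = qpoch v v M"
proof (induction v M j rule: gb.induct)
  case (1 v M)
  then show ?case by (simp add: qpoch_def)
next
  case (3 v M j)
  show ?case
  proof (cases "j = M")
    case True
    have "gb v M M * qpoch v v M * qpoch v v 0 = qpoch v v M" using 3(2) True by simp
    moreover have "gb v (Suc M) (Suc j) * qpoch v v (Suc j) * qpoch v v (Suc M - Suc j)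
        = (gb v M M * qpoch v v M * qpoch v v 0) * (1 - v ^ Suc M)"
      by (simp add: True gb_0 qpoch_Suc)
    ultimately show ?thesis by (simp only: qpoch_Suc)
  next
    case False
    then obtain d where d: "M = Suc (j + d)" using 3(3) by (metis Suc_le_mono le_neq_implies_less less_iff_Suc_add)
    let ?p = "qpoch v v"
    have IH: "gb v M (Suc j) * ?p (Suc j) * ?p d = ?p M" "gb v M j * ?p j * ?p (Suc d) = ?p M"
      using 3 d by simp_all
    have "gb v (Suc M) (Suc j) * ?p (Suc j) * ?p (Suc M - Suc j)
        = (gb v M (Suc j) * ?p (Suc j) * ?p d) * (1 - v ^ Suc d)
          + v ^ Suc d * (gb v M j * ?p j * ?p (Suc d)) * (1 - v ^ Suc j)"
      by (simp add: d qpoch_Suc[of v d] qpoch_Suc[of v j] algebra_simps)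
    \<comment> \<open>With M = j + d + 1, this is 1 - v^(M+1) = (1 - v^(d+1)) + v^(d+1) (1 -
      v^(j+1)).\<close>
    also have "\<dots> = ?p M * (1 - v ^ Suc M)"
      unfolding IH by (simp add: d algebra_simps power_add)
    finally show ?thesis by (simp add: qpoch_Suc[of v M])
  qed
qed simp

lemma qpoch_nonzero: "(\<And>n. n > 0 \<Longrightarrow> v ^ n \<noteq> 1) \<Longrightarrow> qpoch v v m \<noteq> 0"
  unfolding qpoch_def by (auto simp flip: power_Suc)

lemma gb_nonzero: "(\<And>n. n > 0 \<Longrightarrow> v ^ n \<noteq> 1) \<Longrightarrow> j \<le> M \<Longrightarrow> gb v M j \<noteq> 0"
  using gb_qpoch[of j M v] qpoch_nonzero[of v M] by auto

text \<open>The quantum binomial theorem for (c \<otimes> a + d \<otimes> c)^N, whose summands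
  commute up to t^-2. The power of -t comes from reordering c^(N-j) d^j into d^j c^(N-j).\<close>

lemma nf_cfw_c:
  assumes t: "t \<noteq> 0" and "j \<le> N"
  shows "nf t (cfw t (replicate N Ac) j) =
    ((- t) ^ (j * (N - j)) * gb (inverse (t\<^sup>2)) N j) \<cdot> bs (- int j, 0, N - j, False)"
  using assms(2)
proof (induction N arbitrary: j)
  case 0
  then show ?case by (simp add: nf_1)
next
  case (Suc N)
  let ?v = "inverse (t\<^sup>2)"
  have first: "nf t (gen Ac * cfw t (replicate N Ac) j) =
      ((- t) ^ (j * (Suc N - j)) * gb ?v N j) \<cdot> bs (- int j, 0, Suc N - j, False)"
  proof (cases "j \<le> N")
    case True
    then show ?thesis
      using Suc.IH[OF True] by (simp add: nf_gen_mult lsimps cs_cs bt_def Suc_diff_le power_add mult_ac)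
  next
    case False
    then show ?thesis by (simp add: cfw_0 gb_0 lsimps)
  qed
  show ?case
  proof (cases j)
    case 0
    then show ?thesis using first by (simp add: lsimps)
  next
    case (Suc i)
    then have i: "i \<le> N" using Suc.prems by simp
    have "nf t (inverse t ^ (N - i) \<cdot> (gen (nxt Ac) * sd 1 (cfw t (replicate N Ac) i)))
      = (inverse t ^ (N - i) * ((-1) ^ (N - i) * ((- t) ^ (i * (N - i)) * gb ?v N i))) \<cdot> bs (- int j, 0, N - i, False)"
    proof -
      have "- 1 - int i = - int i - 1" by simp
      with nf_sd[OF t Suc.IH[OF i], of 1] Suc show ?thesis
        by (simp add: nf_gen_mult lsimps cs_cs nxt_def \<open>- 1 - int i = - int i - 1\<close>)
    qed
    moreover have "inverse t ^ (N - i) * ((-1) ^ (N - i) * ((- t) ^ (i * (N - i)) * gb ?v N i))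
      = (- t) ^ (j * (Suc N - j)) * (?v ^ (N - i) * gb ?v N i)"
    proof -
      \<comment> \<open>Converts the factors for moving c, odd and past a, into the power of t^-2 in
        Pascal's rule and one more power of -t.\<close>
      have "inverse t * (-1) = (- t) * ?v" using t by (simp add: power2_eq_square field_simps)
      then have "inverse t ^ (N - i) * (-1) ^ (N - i) = (- t) ^ (N - i) * ?v ^ (N - i)"
        by (metis power_mult_distrib)
      then show ?thesis using Suc by (simp add: power_add mult_ac)
    qed
    ultimately show ?thesis
      using first Suc by (simp add: lsimps distrib_left flip: cs_add2)
  qed
qed

text \<open>The quantum binomial theorem for (a \<otimes> a + b \<otimes> c)^N. The product of signs
  is that of (b \<otimes> c)^j, where odd letters pass each other.\<close>

lemma nf_cfw_a:
  assumes t: "t \<noteq> 0" and "j \<le> N"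
  shows "nf t (cfw t (replicate N Aa) j) =
    ((\<Prod>r<j. (-1) ^ r) * gb (inverse (t\<^sup>2)) N j) \<cdot> bs (int (N - j), j, 0, False)"
  using assms(2)
proof (induction N arbitrary: j)
  case 0
  then show ?case by (simp add: nf_1)
next
  case (Suc N)
  let ?v = "inverse (t\<^sup>2)" and ?e = "\<lambda>j. (\<Prod>r<j. (-1) ^ r) :: complex"
  have first: "nf t (gen Aa * cfw t (replicate N Aa) j) =
      (?e j * gb ?v N j) \<cdot> bs (int (Suc N - j), j, 0, False)"
  proof (cases "j \<le> N")
    case True
    then show ?thesis
      using Suc.IH[OF True] by (simp add: nf_gen_mult lsimps cs_cs Suc_diff_le add.commute del: of_nat_diff)
  next
    case False
    then show ?thesis by (simp add: cfw_0 gb_0 lsimps)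
  qed
  show ?case
  proof (cases j)
    case 0
    then show ?thesis using first by (simp add: lsimps)
  next
    case (Suc i)
    then have i: "i \<le> N" using Suc.prems by simp
    have "nf t (inverse t ^ (N - i) \<cdot> (gen (nxt Aa) * sd 1 (cfw t (replicate N Aa) i)))
      = (inverse t ^ (N - i) * ((-1) ^ i * (?e i * gb ?v N i) * inverse t ^ (N - i))) \<cdot> bs (int (N - i), j, 0, False)"
      using nf_sd[OF t Suc.IH[OF i], of 1] Suc by (simp add: nf_gen_mult lsimps cs_cs nxt_def bt_def del: of_nat_diff)
    moreover have "inverse t ^ (N - i) * ((-1) ^ i * (?e i * gb ?v N i) * inverse t ^ (N - i))
      = ?e j * (?v ^ (N - i) * gb ?v N i)"
      using Suc by (simp add: power2_eq_square power_mult_distrib mult_ac)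
    ultimately show ?thesis
      using first Suc by (simp add: lsimps distrib_left flip: cs_add2)
  qed
qed

lemma cong_cspan:
  assumes "\<And>x. x \<in> G \<Longrightarrow> \<exists>w\<in>cspan W. cong rels x w" "x \<in> cspan G"
  shows "\<exists>w\<in>cspan W. cong rels x w"
proof -
  have "x \<in> {x. \<exists>w\<in>cspan W. cong rels x w}"
    using assms(2)
  proof (rule cspan_minimal)
    show "0 \<in> {x. \<exists>w\<in>cspan W. cong rels x w}" using cspan.zero cong_refl by blast
  next
    fix x y assume "x \<in> {x. \<exists>w\<in>cspan W. cong rels x w}" "y \<in> {x. \<exists>w\<in>cspan W. cong rels x w}"
    then show "x + y \<in> {x. \<exists>w\<in>cspan W. cong rels x w}" using cspan_add cong_add by blast
  next
    fix z x assume "x \<in> {x. \<exists>w\<in>cspan W. cong rels x w}"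
    then show "z \<cdot> x \<in> {x. \<exists>w\<in>cspan W. cong rels x w}" using cspan_cs cong_cs by blast
  qed (use assms(1) in blast)
  then show ?thesis by simp
qed

text \<open>Generators that agree up to scalars span the same space; in the second condition the
  scalar has to be invertible.\<close>

lemma lincombs_mons:
  assumes t: "t \<noteq> 0"
    and 1: "\<And>X. X \<in> S \<Longrightarrow> \<exists>z. \<exists>x\<in>M. X = acls t (z \<cdot> x)"
    and 2: "\<And>x. x \<in> M \<Longrightarrow> \<exists>z. z \<noteq> 0 \<and> acls t (z \<cdot> x) \<in> S"
  shows "lincombs (arels t) S = {acls t u | u. \<exists>u'\<in>cspan M. acong t u u'}"
proof -
  have car: "S \<subseteq> carrier (A t)" using 1 by force
  show ?thesis
    unfolding lincombs_cspan[OF car]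
  proof (intro equalityI subsetI)
    fix X assume "X \<in> acls t ` cspan {x. acls t x \<in> S}"
    then obtain u where u: "X = acls t u" "u \<in> cspan {x. acls t x \<in> S}" by blast
    have "\<exists>w\<in>cspan M. acong t u w"
      using u(2)
    proof (rule cong_cspan[rotated])
      fix x assume "x \<in> {x. acls t x \<in> S}"
      then obtain z y where "y \<in> M" "acls t x = acls t (z \<cdot> y)" using 1 by blast
      then show "\<exists>w\<in>cspan M. acong t x w"
        unfolding cls_eq by (meson cspan_cs cspan_base)
    qed
    then show "X \<in> {acls t u | u. \<exists>u'\<in>cspan M. acong t u u'}" using u(1) by blast
  next
    fix X assume "X \<in> {acls t u | u. \<exists>u'\<in>cspan M. acong t u u'}"
    then obtain u where u: "X = acls t u" "u \<in> cspan M" by (auto simp: cls_eq[symmetric])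
    have "u \<in> cspan {x. acls t x \<in> S}"
      using u(2)
    proof (rule cspan_minimal)
      show "M \<subseteq> cspan {x. acls t x \<in> S}"
      proof
        fix x assume "x \<in> M"
        then obtain z where z: "z \<noteq> 0" "acls t (z \<cdot> x) \<in> S" using 2 by blast
        then have "inverse z \<cdot> (z \<cdot> x) \<in> cspan {x. acls t x \<in> S}"
          by (intro cspan_cs cspan_base) simp
        then show "x \<in> cspan {x. acls t x \<in> S}" using z(1) by (simp add: cs_cs)
      qed
    qed (auto intro: cspan.zero cspan_add cspan_cs)
    then show "X \<in> acls t ` cspan {x. acls t x \<in> S}" using u(1) by blast
  qed
qed

section \<open>The theorem\<close>

lemma sigma_sw: "s \<in> {0, 1::nat} \<Longrightarrow> gen Asigma ^ s = sw (s = 1)"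
  by (auto simp: sw_def)

lemma half_nats_iff: "l \<in> half_nats \<longleftrightarrow> (\<exists>N. l = of_nat N / 2)"
  by (auto simp: half_nats_def)

lemma ix_extreme: "ix N N = of_nat N / 2" "ix N 0 = - (of_nat N / 2)"
  by (simp_all add: ix_def)

text \<open>Common to the rows \<ell> and -\<ell>: \<open>f N\<close> is the number of the row,
  \<open>p\<close> and \<open>q'\<close> are the exponents of its entries, and \<open>surj\<close>
  says that every monomial occurs in some spin.\<close>

lemma row_span:
  assumes t: "t \<noteq> 0" and rt: "\<And>N j. j \<le> N \<Longrightarrow> cf rt N j \<noteq> 0"
    and row: "\<And>N j. j \<le> N \<Longrightarrow> \<exists>z. z \<noteq> 0 \<and> nf t (cfw t (wN N (f N)) j) = nf t (z \<cdot> (gen g ^ p N j * gen h ^ q' N j))"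
    and f: "\<And>N. f N \<le> N" "\<And>N. ix N (f N) = e (of_nat N / 2)"
    and surj: "\<And>m k. \<exists>N j. j \<le> N \<and> p N j = m \<and> q' N j = k"
  shows "lincombs (arels t) {mat_elt t rt l (e l) j \<otimes>\<^bsub>A t\<^esub> sigma t [^]\<^bsub>A t\<^esub> s | l j s.
         l \<in> half_nats \<and> j \<in> idx l \<and> s \<in> {0, 1::nat}}
    = {acls t u | u. \<exists>u'\<in>cspan (mons g h). acong t u u'}"
proof -
  let ?x = "\<lambda>N j s. gen g ^ p N j * (gen h ^ q' N j * gen Asigma ^ s)"
  have entry: "\<exists>z. z \<noteq> 0 \<and> mat_elt t rt (of_nat N / 2) (e (of_nat N / 2)) (ix N j) \<otimes>\<^bsub>A t\<^esub> sigma t [^]\<^bsub>A t\<^esub> (s::nat)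
      = acls t (z \<cdot> ?x N j s)" if jN: "j \<le> N" for N j s
  proof -
    obtain z where z: "z \<noteq> 0" "acong t (cfw t (wN N (f N)) j) (z \<cdot> (gen g ^ p N j * gen h ^ q' N j))"
      using row[OF jN] by (auto simp: cong_nf[OF t])
    let ?c = "cf rt N (f N) / cf rt N j"
    have "mat_elt t rt (of_nat N / 2) (e (of_nat N / 2)) (ix N j) \<otimes>\<^bsub>A t\<^esub> sigma t [^]\<^bsub>A t\<^esub> s
        = acls t ((?c \<cdot> cfw t (wN N (f N)) j) * gen Asigma ^ s)"
      using mat_elt_cfw[OF t rt f(1) jN] by (simp add: f(2) sigma_pow cls_mult)
    also have "\<dots> = acls t ((?c \<cdot> (z \<cdot> (gen g ^ p N j * gen h ^ q' N j))) * gen Asigma ^ s)"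
      unfolding cls_eq by (intro cong_mult_right cong_cs z(2))
    also have "(?c \<cdot> (z \<cdot> (gen g ^ p N j * gen h ^ q' N j))) * gen Asigma ^ s = (?c * z) \<cdot> ?x N j s"
      by (simp add: cs_mult cs_cs mult.assoc)
    finally show ?thesis using z(1) rt[OF jN] rt[OF f(1)] by (intro exI[of _ "?c * z"]) simp
  qed
  show ?thesis
  proof (rule lincombs_mons[OF t])
    fix X assume "X \<in> {mat_elt t rt l (e l) j \<otimes>\<^bsub>A t\<^esub> sigma t [^]\<^bsub>A t\<^esub> s | l j s.
         l \<in> half_nats \<and> j \<in> idx l \<and> s \<in> {0, 1::nat}}"
    then obtain l i and s :: nat where X: "X = mat_elt t rt l (e l) i \<otimes>\<^bsub>A t\<^esub> sigma t [^]\<^bsub>A t\<^esub> s"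
      "l \<in> half_nats" "i \<in> idx l" "s \<in> {0, 1}" by blast
    obtain N where "l = of_nat N / 2" using X(2) by (auto simp: half_nats_iff)
    moreover from this have "i \<in> ix N ` {..N}" using X(3) by (simp only: idx_ix)
    then obtain j where "i = ix N j" "j \<le> N" by auto
    ultimately have "X = mat_elt t rt (of_nat N / 2) (e (of_nat N / 2)) (ix N j) \<otimes>\<^bsub>A t\<^esub> sigma t [^]\<^bsub>A t\<^esub> s"
      "j \<le> N" using X(1) by (simp_all only:)
    then show "\<exists>z. \<exists>x\<in>mons g h. X = acls t (z \<cdot> x)"
      using entry[of j N s] sigma_sw[OF X(4)] unfolding mons_def by fastforce
  next
    fix x assume "x \<in> mons g h"
    then obtain m k b where x: "x = gen g ^ m * (gen h ^ k * sw b)" by (auto simp: mons_def)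
    obtain N j where j: "j \<le> N" "p N j = m" "q' N j = k" using surj by blast
    define s :: nat where "s = (if b then 1 else 0)"
    have s: "s \<in> {0, 1}" "sw b = gen Asigma ^ s" by (auto simp: s_def sw_def)
    have l: "ix N j \<in> idx (of_nat N / 2)" "of_nat N / 2 \<in> half_nats"
      using j by (auto simp: idx_ix half_nats_iff)
    obtain z where z0: "z \<noteq> 0" and z: "mat_elt t rt (of_nat N / 2) (e (of_nat N / 2)) (ix N j)
        \<otimes>\<^bsub>A t\<^esub> sigma t [^]\<^bsub>A t\<^esub> s = acls t (z \<cdot> x)"
      using entry[OF j(1), of s] unfolding x s(2) j(2,3) by blast
    show "\<exists>z. z \<noteq> 0 \<and> acls t (z \<cdot> x) \<in> {mat_elt t rt l (e l) j \<otimes>\<^bsub>A t\<^esub> sigma t [^]\<^bsub>A t\<^esub> s | l j s.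
         l \<in> half_nats \<and> j \<in> idx l \<and> s \<in> {0, 1::nat}}"
    proof (intro exI[of _ z] conjI CollectI z0)
      show "\<exists>l j' s'. acls t (z \<cdot> x) = mat_elt t rt l (e l) j' \<otimes>\<^bsub>A t\<^esub> sigma t [^]\<^bsub>A t\<^esub> s' \<and>
          l \<in> half_nats \<and> j' \<in> idx l \<and> s' \<in> {0, 1::nat}"
        using z[symmetric] l s(1) by blast
    qed
  qed
qed

text \<open>Replaces the matrix elements of one spin by an explicit list \<open>W\<close>, to which
  they belong up to scalars, so that invariants can be sought in a finite span.\<close>

lemma Msp_span:
  assumes t: "t \<noteq> 0" and rt: "\<And>j. j \<le> N \<Longrightarrow> cf rt N j \<noteq> 0" and s: "s \<in> {0, 1::nat}"
    and W: "\<And>n j b. n \<le> N \<Longrightarrow> j \<le> N \<Longrightarrow> \<exists>z. \<exists>w\<in>W b. nf t (cfw t (wN N n) j * sw b) = nf t (z \<cdot> w)"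
    and X: "X \<in> Msp t rt (of_nat N / 2) s"
  shows "\<exists>u\<in>cspan (W False \<union> W True). X = acls t u"
proof -
  let ?S = "{mat_elt t rt (of_nat N / 2) i j \<otimes>\<^bsub>A t\<^esub> sigma t [^]\<^bsub>A t\<^esub> s | i j.
      i \<in> idx (of_nat N / 2) \<and> j \<in> idx (of_nat N / 2)}"
  have gen: "\<exists>z. \<exists>w\<in>W False \<union> W True. Y = acls t (z \<cdot> w)" if "Y \<in> ?S" for Y
  proof -
    from that obtain n j where Y: "Y = mat_elt t rt (of_nat N / 2) (ix N n) (ix N j) \<otimes>\<^bsub>A t\<^esub> sigma t [^]\<^bsub>A t\<^esub> s"
      "n \<le> N" "j \<le> N" by (auto simp: idx_ix)
    let ?c = "cf rt N n / cf rt N j"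
    obtain z w where w: "w \<in> W (s = 1)" "acong t (cfw t (wN N n) j * sw (s = 1)) (z \<cdot> w)"
      using W[OF Y(2,3), of "s = 1"] cong_nf[OF t] by blast
    have "Y = acls t (?c \<cdot> (cfw t (wN N n) j * sw (s = 1)))"
      using mat_elt_cfw[OF t rt Y(2,3)] by (simp add: Y(1) sigma_pow cls_mult cs_mult sigma_sw[OF s])
    also have "\<dots> = acls t (?c \<cdot> (z \<cdot> w))"
      unfolding cls_eq by (rule cong_cs[OF w(2)])
    finally have "Y = acls t ((?c * z) \<cdot> w)" by (simp add: cs_cs)
    then show ?thesis using w(1) by (cases "s = 1") auto
  qed
  have car: "?S \<subseteq> carrier (A t)" using gen by force
  from X obtain u where u: "X = acls t u" "u \<in> cspan {x. acls t x \<in> ?S}"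
    unfolding Msp_def lincombs_cspan[OF car] by blast
  have "\<exists>w\<in>cspan (W False \<union> W True). acong t u w"
    using u(2)
  proof (rule cong_cspan[rotated])
    fix x assume "x \<in> {x. acls t x \<in> ?S}"
    then obtain z w where "w \<in> W False \<union> W True" "acls t x = acls t (z \<cdot> w)" using gen by blast
    then show "\<exists>w\<in>cspan (W False \<union> W True). acong t x w"
      unfolding cls_eq by (meson cspan_cs cspan_base)
  qed
  then show ?thesis using u(1) by (auto simp: cls_eq)
qed

lemma cfw_half:
  assumes "n \<le> 1" "j \<le> 1"
  shows "\<exists>z. \<exists>w\<in>Whalf b. nf t (cfw t (wN 1 n) j * sw b) = nf t (z \<cdot> w)"
proof (intro exI[of _ 1])
  have "n = 0 \<or> n = 1" "j = 0 \<or> j = 1" using assms by auto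
  then show "\<exists>w\<in>Whalf b. nf t (cfw t (wN 1 n) j * sw b) = nf t (1 \<cdot> w)"
    by (auto simp: wN_def Whalf_def sd_def nxt_def)
qed

lemma cfw_one:
  assumes t: "t \<noteq> 0" and "n \<le> 2" "j \<le> 2"
  shows "\<exists>z. \<exists>w\<in>Wone t b. nf t (cfw t (wN 2 n) j * sw b) = nf t (z \<cdot> w)"
proof -
  have n: "n = 0 \<or> n = 1 \<or> n = 2" and j: "j = 0 \<or> j = 1 \<or> j = 2" using assms by auto
  \<comment> \<open>1 + t^-2 is the Gaussian coefficient of 2 over 1 in the first and last rows; -1
    is the sign of (b \<otimes> c)^2.\<close>
  define z where "z = (if n = j \<and> n = 1 \<or> j = 0 then 1 else if j = 1 then 1 + inverse (t\<^sup>2) else if n = 0 then -1 else (1::complex))"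
  define w where "w = (if n = 0 then (if j = 0 then word2 Aa Aa b else if j = 1 then word2 Aa Ab b else word2 Ab Ab b)
    else if n = 1 then (if j = 0 then word2 Aa Ac b else if j = 1 then mid t b else word2 Ab Ad b)
    else (if j = 0 then word2 Ac Ac b else if j = 1 then word2 Ac Ad b else word2 Ad Ad b))"
  have "w \<in> Wone t b" by (auto simp: w_def Wone_def)
  moreover have "nf t (cfw t (wN 2 n) j * sw b) = nf t (z \<cdot> w)"
    using n j by (elim disjE; cases b; simp add: wN_def numeral_2_eq_2 z_def w_def nxt_def sd_def diag_mult
        word2_def mid_def sw_def nf_eval cs_add2 distrib_right left_diff_distrib mult.assoc t power2_eq_square;
        (rule poly_mapping_eqI; simp add: lookup_linear lookup_single when_def field_simps t)?)
  ultimately show ?thesis by blast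
qed

theorem theorem3p2:
  fixes q sq t :: complex and rt :: "nat \<Rightarrow> nat \<Rightarrow> complex"
  assumes "q \<noteq> 0" and "\<forall>n>0. q ^ n \<noteq> 1"
    and "sq ^ 2 = q" and "t = \<i> * sq"
    and "\<forall>m n. n \<le> m \<longrightarrow> rt m n ^ 2 = qbinom (inverse (t ^ 2)) m n"
  shows
    "(\<forall>\<alpha> \<beta> \<gamma>. \<not> (\<alpha> = 0 \<and> \<beta> = 0 \<and> \<gamma> = 0) \<longrightarrow>
        ((\<forall>l\<in>half_nats. \<exists>u\<in>Msp t rt l 0 <+>\<^bsub>A t\<^esub> Msp t rt l 1.
            u \<noteq> \<zero>\<^bsub>A t\<^esub> \<and> R_act q t (u_x q \<alpha> \<beta> \<gamma>) u = \<zero>\<^bsub>A t\<^esub>) \<or>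
         (\<forall>l\<in>half_nats. \<exists>u\<in>Msp t rt l 0 <+>\<^bsub>A t\<^esub> Msp t rt l 1.
            u \<noteq> \<zero>\<^bsub>A t\<^esub> \<and> L_act q t (u_x q \<alpha> \<beta> \<gamma>) u = \<zero>\<^bsub>A t\<^esub>)) \<longrightarrow>
        u_x q \<alpha> \<beta> \<gamma> \<in> uline q (u_e q) \<or> u_x q \<alpha> \<beta> \<gamma> \<in> uline q (u_fk q)) \<and>
     right_invariants q t (uline q (u_e q)) =
       lincombs (arels t) {mat_elt t rt l l j \<otimes>\<^bsub>A t\<^esub> sigma t [^]\<^bsub>A t\<^esub> s | l j s.
         l \<in> half_nats \<and> j \<in> idx l \<and> s \<in> {0, 1::nat}} \<and>
     right_invariants q t (uline q (u_fk q)) =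
       lincombs (arels t) {mat_elt t rt l (- l) j \<otimes>\<^bsub>A t\<^esub> sigma t [^]\<^bsub>A t\<^esub> s | l j s.
         l \<in> half_nats \<and> j \<in> idx l \<and> s \<in> {0, 1::nat}}"
proof -
  have t2: "t\<^sup>2 = - q" using assms(3,4) by (simp add: power_mult_distrib)
  have t: "t \<noteq> 0" using t2 assms(1) by auto
  have q: "q = - t\<^sup>2" using t2 by simp
  \<comment> \<open>Squaring removes the sign in t^2 = -q and leads to a power of q.\<close>
  have root: "(t\<^sup>2) ^ n \<noteq> 1" if "n > 0" for n
  proof
    assume "(t\<^sup>2) ^ n = 1"
    then have "((t\<^sup>2) ^ n)\<^sup>2 = 1" by simp
    then have "q ^ (n * 2) = 1" unfolding t2 by (simp flip: power_mult)
    then show False using assms(2) that by simp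
  qed
  have t21: "t\<^sup>2 \<noteq> 1" "t\<^sup>2 \<noteq> -1"
    using root[of 1] assms(2) t2 by (auto dest: spec[of _ 1])
  have rootv: "inverse (t\<^sup>2) ^ n \<noteq> 1" if "n > 0" for n
    using root[OF that] by (simp add: power_inverse)
  have cf: "cf rt N j \<noteq> 0" if "j \<le> N" for N j
  proof -
    have "qbinom (inverse (t\<^sup>2)) N j \<noteq> 0"
      using qpoch_nonzero[OF rootv] by (simp add: qbinom_def)
    then have "rt N j ^ 2 \<noteq> 0" using assms(5) that by simp
    then show ?thesis by (simp add: cf_def)
  qed
  \<comment> \<open>The value e(b). Being nonzero, it lets \<open>\<alpha> * e\<close> vanish only
    with \<alpha>.\<close>
  define e where "e = (t - inverse t) / (q - inverse q)"
  have e: "e \<noteq> 0"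
  proof -
    have "t - inverse t \<noteq> 0" using t t21(1) by (auto simp: field_simps power2_eq_square)
    moreover have "q - inverse q \<noteq> 0" using assms(1,2) by (auto simp: field_simps power2_eq_square dest: spec[of _ 2])
    ultimately show ?thesis by (simp add: e_def)
  qed
  note act = act_u_x[OF t q, folded e_def]
  let ?I = "aidl t"
  have zero: "acls t u = \<zero>\<^bsub>A t\<^esub> \<longleftrightarrow> u \<in> ?I" for u
    by (simp add: cls_0 cls_eq cong_0_iff)

  have line_e: "uline q (u_e q) = {u_x q z 0 0 | z. True}"
    by (simp add: uline_def u_e_def u_x_def scal_cls const_mult)
  have line_f: "uline q (u_fk q) = {u_x q 0 z 0 | z. True}"
    by (simp add: uline_def u_fk_def u_x_def scal_cls const_mult cs_mult)

  have part1: "u_x q \<alpha> \<beta> \<gamma> \<in> uline q (u_e q) \<or> u_x q \<alpha> \<beta> \<gamma> \<in> uline q (u_fk q)"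
    if inv: "(\<forall>l\<in>half_nats. \<exists>u\<in>Msp t rt l 0 <+>\<^bsub>A t\<^esub> Msp t rt l 1.
            u \<noteq> \<zero>\<^bsub>A t\<^esub> \<and> R_act q t (u_x q \<alpha> \<beta> \<gamma>) u = \<zero>\<^bsub>A t\<^esub>) \<or>
         (\<forall>l\<in>half_nats. \<exists>u\<in>Msp t rt l 0 <+>\<^bsub>A t\<^esub> Msp t rt l 1.
            u \<noteq> \<zero>\<^bsub>A t\<^esub> \<and> L_act q t (u_x q \<alpha> \<beta> \<gamma>) u = \<zero>\<^bsub>A t\<^esub>)" for \<alpha> \<beta> \<gamma>
  proof (rule ccontr)
    assume not: "\<not> ?thesis"
    let ?l = "\<alpha> * e" and ?m = "\<beta> * t"
    \<comment> \<open>Otherwise \<gamma> = 0 and \<alpha> \<beta> = 0, and x would lie on one of the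
      two lines.\<close>
    have c: "\<gamma> \<noteq> 0 \<or> ?l * ?m \<noteq> 0"
      using not e t unfolding line_e line_f by auto
    have get: "\<exists>u\<in>cspan (W False \<union> W True). u \<notin> ?I \<and> (TR t ?l ?m \<gamma> u \<in> ?I \<or> TL t ?l ?m \<gamma> u \<in> ?I)"
      if W: "\<And>n j b. n \<le> N \<Longrightarrow> j \<le> N \<Longrightarrow> \<exists>z. \<exists>w\<in>W b. nf t (cfw t (wN N n) j * sw b) = nf t (z \<cdot> w)" for N W
    proof -
      have "of_nat N / 2 \<in> half_nats" by (auto simp: half_nats_iff)
      with inv obtain X where X: "X \<in> Msp t rt (of_nat N / 2) 0 <+>\<^bsub>A t\<^esub> Msp t rt (of_nat N / 2) 1" "X \<noteq> \<zero>\<^bsub>A t\<^esub>"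
        "R_act q t (u_x q \<alpha> \<beta> \<gamma>) X = \<zero>\<^bsub>A t\<^esub> \<or> L_act q t (u_x q \<alpha> \<beta> \<gamma>) X = \<zero>\<^bsub>A t\<^esub>" by blast
      from X(1) obtain Y Z where YZ: "X = Y \<oplus>\<^bsub>A t\<^esub> Z" "Y \<in> Msp t rt (of_nat N / 2) 0" "Z \<in> Msp t rt (of_nat N / 2) 1"
        by (auto simp: set_add_def set_mult_def)
      obtain y z where "y \<in> cspan (W False \<union> W True)" "Y = acls t y"
        "z \<in> cspan (W False \<union> W True)" "Z = acls t z"
        using Msp_span[OF t cf _ W YZ(2)] Msp_span[OF t cf _ W YZ(3)] by auto
      then have "X = acls t (y + z)" "y + z \<in> cspan (W False \<union> W True)"
        using YZ(1) by (simp_all add: cls_add cspan_add)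
      then show ?thesis using X(2,3) by (intro bexI[of _ "y + z"]) (simp_all add: act zero)
    qed
    show False
    proof (cases "(\<gamma> = 0) \<noteq> (?l * ?m = 0)")
      case True
      from get[OF cfw_half, simplified] obtain u where u: "u \<in> cspan (Whalf False \<union> Whalf True)" "u \<notin> ?I"
        "TR t ?l ?m \<gamma> u \<in> ?I \<or> TL t ?l ?m \<gamma> u \<in> ?I" by blast
      \<comment> \<open>The conjugate right action has parameters (m, - l), whose product vanishes
        exactly when l m does.\<close>
      have True': "(\<gamma> = 0) \<noteq> (?m * - ?l = 0)" using True by auto
      have "u \<in> ?I" if "TL t ?l ?m \<gamma> u \<in> ?I"
        using no_invariants_half[OF t t21(1) True'] th_Whalf u(1) that by (rule th_kernel[OF t])
      then show False
        using u(2,3) no_invariants_half[OF t t21(1) True u(1)] by blast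
    next
      case False
      \<comment> \<open>Both equations hold or both fail, and \<open>c\<close> excludes that both
        hold.\<close>
      then have nz: "\<gamma> \<noteq> 0" "?l * ?m \<noteq> 0" "?m * - ?l \<noteq> 0" using c by auto
      from get[OF cfw_one[OF t]] obtain u where u: "u \<in> cspan (Wone t False \<union> Wone t True)" "u \<notin> ?I"
        "TR t ?l ?m \<gamma> u \<in> ?I \<or> TL t ?l ?m \<gamma> u \<in> ?I" by blast
      have "u \<in> ?I" if "TL t ?l ?m \<gamma> u \<in> ?I"
        using no_invariants_one[OF t t21 nz(1,3)] th_Wone u(1) that by (rule th_kernel[OF t])
      then show False
        using u(2,3) no_invariants_one[OF t t21 nz(1,2) u(1)] by blast
    qed
  qed

  have counit: "ucounit (u_x q \<alpha> \<beta> 0) = 0" for \<alpha> \<beta>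
    unfolding u_x_def by (rule ucounit_cls) (simp add: const_mult chom_simps cs_mult)
  have TR0: "TR t l m 0 u = DR t l m u" for l m u by (simp add: TR_def)
  have scal0: "scal (arels t) 0 (acls t u) = acls t 0" for u by (simp add: scal_cls)
  \<comment> \<open>The inclusion converse to \<open>kernel_e\<close>: c, d and \<sigma> are all
    killed, hence so are their products.\<close>
  have DR_mons: "DR t l 0 x = 0" if "x \<in> mons Ad Ac" for l x
  proof -
    have "DR t l 0 (gen Ac ^ k * sw s) = 0" for k s
      by (induction k) (simp_all add: DR_def sw_def tder_Cons mult.assoc)
    then have "DR t l 0 (gen Ad ^ m * (gen Ac ^ k * sw s)) = 0" for m k s
      by (induction m) (simp_all add: DR_def tder_Cons mult.assoc)
    then show ?thesis using that by (auto simp: mons_def)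
  qed
  have DR_mons': "DR t 0 m x = 0" if "x \<in> mons Aa Ab" for m x
  proof -
    have "DR t 0 m (gen Ab ^ k * sw s) = 0" for k s
      by (induction k) (simp_all add: DR_def sw_def tder_Cons mult.assoc)
    then have "DR t 0 m (gen Aa ^ i * (gen Ab ^ k * sw s)) = 0" for i k s
      by (induction i) (simp_all add: DR_def tder_Cons mult.assoc)
    then show ?thesis using that by (auto simp: mons_def)
  qed
  have ker: "DR t l m u \<in> ?I" if M: "\<And>x. x \<in> M \<Longrightarrow> DR t l m x = 0" and u: "\<exists>u'\<in>cspan M. acong t u u'" for l m u M
  proof -
    obtain u' where u': "u' \<in> cspan M" "u - u' \<in> ?I" using u by (auto simp: cong_def)
    have "u' \<in> {u. DR t l m u = 0}"
      using u'(1) by (rule cspan_minimal) (use M in \<open>auto simp: DR_def lsimps\<close>)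
    then show ?thesis using DR_idl(1)[OF t u'(2), of l m] by (simp add: DR_def lsimps)
  qed
  have root': "\<forall>n>0. (t\<^sup>2) ^ n \<noteq> 1" using root by blast
  have inv_e: "right_invariants q t (uline q (u_e q)) = {acls t u | u. \<exists>u'\<in>cspan (mons Ad Ac). acong t u u'}"
  proof -
    have "(\<forall>z. DR t (z * e) 0 u \<in> ?I) \<longleftrightarrow> (\<exists>u'\<in>cspan (mons Ad Ac). acong t u u')" for u
    proof
      assume "\<forall>z. DR t (z * e) 0 u \<in> ?I"
      then have "DR t (1 * e) 0 u \<in> ?I" by blast
      then show "\<exists>u'\<in>cspan (mons Ad Ac). acong t u u'" using kernel_e[OF t root' e] by simp
    next
      assume u: "\<exists>u'\<in>cspan (mons Ad Ac). acong t u u'"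
      show "\<forall>z. DR t (z * e) 0 u \<in> ?I" by (intro allI ker[OF DR_mons u])
    qed
    moreover have "R_act q t (u_x q z 0 0) (acls t u) = scal (arels t) (ucounit (u_x q z 0 0)) (acls t u)
        \<longleftrightarrow> DR t (z * e) 0 u \<in> ?I" for z u
      by (simp add: counit act scal0 TR0 cls_eq cong_0_iff)
    then have "acls t u \<in> right_invariants q t (uline q (u_e q)) \<longleftrightarrow> (\<forall>z. DR t (z * e) 0 u \<in> ?I)" for u
      unfolding right_invariants_def line_e by (simp only: mem_Collect_eq cls_carrier) blast
    moreover have "right_invariants q t (uline q (u_e q)) \<subseteq> range (acls t)"
      unfolding right_invariants_def carrier_presented by blast
    ultimately show ?thesis by blast
  qed
  have inv_f: "right_invariants q t (uline q (u_fk q)) = {acls t u | u. \<exists>u'\<in>cspan (mons Aa Ab). acong t u u'}"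
  proof -
    have "(\<forall>z. DR t 0 (z * t) u \<in> ?I) \<longleftrightarrow> (\<exists>u'\<in>cspan (mons Aa Ab). acong t u u')" for u
    proof
      assume "\<forall>z. DR t 0 (z * t) u \<in> ?I"
      then have "DR t 0 (1 * t) u \<in> ?I" by blast
      then show "\<exists>u'\<in>cspan (mons Aa Ab). acong t u u'" using kernel_f[OF t root' t] by simp
    next
      assume u: "\<exists>u'\<in>cspan (mons Aa Ab). acong t u u'"
      show "\<forall>z. DR t 0 (z * t) u \<in> ?I" by (intro allI ker[OF DR_mons' u])
    qed
    moreover have "R_act q t (u_x q 0 z 0) (acls t u) = scal (arels t) (ucounit (u_x q 0 z 0)) (acls t u)
        \<longleftrightarrow> DR t 0 (z * t) u \<in> ?I" for z u
      by (simp add: counit act scal0 TR0 cls_eq cong_0_iff)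
    then have "acls t u \<in> right_invariants q t (uline q (u_fk q)) \<longleftrightarrow> (\<forall>z. DR t 0 (z * t) u \<in> ?I)" for u
      unfolding right_invariants_def line_f by (simp only: mem_Collect_eq cls_carrier) blast
    moreover have "right_invariants q t (uline q (u_fk q)) \<subseteq> range (acls t)"
      unfolding right_invariants_def carrier_presented by blast
    ultimately show ?thesis by blast
  qed
  have row_e: "lincombs (arels t) {mat_elt t rt l l j \<otimes>\<^bsub>A t\<^esub> sigma t [^]\<^bsub>A t\<^esub> s | l j s.
         l \<in> half_nats \<and> j \<in> idx l \<and> s \<in> {0, 1::nat}}
      = {acls t u | u. \<exists>u'\<in>cspan (mons Ad Ac). acong t u u'}"
  proof (rule row_span[OF t cf, where f = "\<lambda>N. N" and e = "\<lambda>l. l" and p = "\<lambda>N j. j" and q' = "\<lambda>N j. N - j"])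
    fix N j :: nat assume j: "j \<le> N"
    have "gen Ad ^ j * gen Ac ^ (N - j) = nw (- int j, 0, N - j, False)"
      by (simp add: pw_def sw_def)
    then have "nf t (gen Ad ^ j * gen Ac ^ (N - j)) = bs (- int j, 0, N - j, False)" by (simp only: nf_nw)
    then show "\<exists>z. z \<noteq> 0 \<and> nf t (cfw t (wN N N) j) = nf t (z \<cdot> (gen Ad ^ j * gen Ac ^ (N - j)))"
      using nf_cfw_c[OF t j] gb_nonzero[OF rootv j] t
      by (intro exI[of _ "(- t) ^ (j * (N - j)) * gb (inverse (t\<^sup>2)) N j"]) (simp add: wN_def lsimps)
  next
    fix m k :: nat
    show "\<exists>N j. j \<le> N \<and> j = m \<and> N - j = k" by (intro exI[of _ "m + k"] exI[of _ m]) simp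
  qed (simp_all add: ix_extreme)
  have row_f: "lincombs (arels t) {mat_elt t rt l (- l) j \<otimes>\<^bsub>A t\<^esub> sigma t [^]\<^bsub>A t\<^esub> s | l j s.
         l \<in> half_nats \<and> j \<in> idx l \<and> s \<in> {0, 1::nat}}
      = {acls t u | u. \<exists>u'\<in>cspan (mons Aa Ab). acong t u u'}"
  proof (rule row_span[OF t cf, where f = "\<lambda>N. 0" and e = "\<lambda>l. - l" and p = "\<lambda>N j. N - j" and q' = "\<lambda>N j. j"])
    fix N j :: nat assume j: "j \<le> N"
    have "gen Aa ^ (N - j) * gen Ab ^ j = nw (int (N - j), j, 0, False)"
      by (simp add: pw_def sw_def)
    then have "nf t (gen Aa ^ (N - j) * gen Ab ^ j) = bs (int (N - j), j, 0, False)" by (simp only: nf_nw)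
    then show "\<exists>z. z \<noteq> 0 \<and> nf t (cfw t (wN N 0) j) = nf t (z \<cdot> (gen Aa ^ (N - j) * gen Ab ^ j))"
      using nf_cfw_a[OF t j] gb_nonzero[OF rootv j]
      by (intro exI[of _ "(\<Prod>r<j. (-1) ^ r) * gb (inverse (t\<^sup>2)) N j"]) (simp add: wN_def lsimps)
  next
    fix m k :: nat
    show "\<exists>N j. j \<le> N \<and> N - j = m \<and> j = k" by (intro exI[of _ "m + k"] exI[of _ k]) simp
  qed (simp_all add: ix_extreme)
  show ?thesis
    using part1 unfolding inv_e inv_f row_e row_f by blast
qed

end
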